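(* Let $k>2$. For a non-flat paraconformal structure of Veronese type on a manifold of dimension $k+1$, all totally geodesic paraconformal connections have non-vanishing torsion. In particular, a Veronese web is flat if and only if the corresponding canonical connection is torsion-free.
   Context: A Veronese web on a manifold $M$ of dimension $k+1$ is a one-parameter family $\{\mathcal{F}_t\}_{t\in\mathbb{R}}$ of codimension-one foliations such that locally there is a coframe $\omega_0,\ldots,\omega_k$ with $T\mathcal{F}_t=\ker\omega(t)$, $\omega(t)=\omega_0+t\omega_1+\cdots+t^k\omega_k$. The dual curve $V(t)=V_0+tV_1+\cdots+t^kV_k$ ($V_0,\ldots,V_k$ a local frame) is determined, up to multiplication by a function on $M$, by $V(t)\in\ker\omega(t)\cap\ker\omega'(t)\cap\cdots\cap\ker\omega^{(k-1)}(t)$ (derivatives in $t$). The field of cones over the rational normal curves $t\mapsto\mathbb{R}V(t)$ is the paraconformal structure (said to be of Veronese type) defined by the web. The web, and the corresponding paraconformal structure of Veronese type, is flat if locally there are coordinates in which, after multiplication of $\omega(t)$ by a function on $M$, all $\omega_i$ have constant coefficients. A connection $\nabla$ on $M$ is paraconformal if $\nabla_YV(t)\in\mathrm{span}\{V(t),V'(t)\}$ for all $t$ and all vector fields $Y$. It is totally geodesic if the leaves of all foliations $\mathcal{F}_t$ are totally geodesic with respect to $\nabla$. Torsion is $T(\nabla)(X,Y)=\nabla_XY-\nabla_YX-[X,Y]$. For $k>2$ there is a unique totally geodesic paraconformal connection such that $T(\nabla)(V(t),V'(t))\in\mathrm{span}\{V(t)\}$ for all $t\in\mathbb{R}$; it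 is called the canonical connection of the Veronese web. *)

theory Defs
  imports "HOL-Analysis.Analysis"
begin

section \<open>Smooth maps between normed spaces\<close>

text \<open>Only used for open \<open>S\<close>: all iterated directional derivatives exist, are differentiable, and
  are continuous, i.e. \<open>f\<close> is of class \<open>C\<^sup>\<infinity>\<close> on \<open>S\<close> (for a finite-dimensional domain).\<close>

primrec times_differentiable_on ::
  "nat \<Rightarrow> 'a::real_normed_vector set \<Rightarrow> ('a \<Rightarrow> 'b::real_normed_vector) \<Rightarrow> bool"
where
  "times_differentiable_on 0 S f \<longleftrightarrow> continuous_on S f"
| "times_differentiable_on (Suc n) S f \<longleftrightarrow>
     (\<forall>x\<in>S. f differentiable (at x)) \<and>
     (\<forall>v. times_differentiable_on n S (\<lambda>x. frechet_derivative f (at x) v))"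

definition smooth_on ::
  "'a::real_normed_vector set \<Rightarrow> ('a \<Rightarrow> 'b::real_normed_vector) \<Rightarrow> bool" where
  "smooth_on S f \<longleftrightarrow> (\<forall>n. times_differentiable_on n S f)"


section \<open>Smooth manifolds\<close>

text \<open>The manifold is the whole type \<open>'m\<close>, modelled on \<open>'e\<close> (so of dimension \<open>DIM('e)\<close>) by an
  atlas. A chart is its domain together with its coordinate map; the values of the coordinate map
  outside the domain are irrelevant.\<close>

type_synonym ('m, 'e) chart = "'m set \<times> ('m \<Rightarrow> 'e)"

abbreviation chart_image :: "('m, 'e) chart \<Rightarrow> 'm set \<Rightarrow> 'e set" where
  "chart_image c U \<equiv> snd c ` (U \<inter> fst c)"

abbreviation chart_inv :: "('m, 'e) chart \<Rightarrow> 'e \<Rightarrow> 'm" where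
  "chart_inv c \<equiv> inv_into (fst c) (snd c)"

definition is_chart :: "('m::topological_space, 'e::euclidean_space) chart \<Rightarrow> bool" where
  "is_chart c \<longleftrightarrow> open (fst c) \<and> open (snd c ` fst c) \<and>
     homeomorphism (fst c) (snd c ` fst c) (snd c) (chart_inv c)"

definition smooth_transition :: "('m, 'e::euclidean_space) chart \<Rightarrow> ('m, 'e) chart \<Rightarrow> bool" where
  "smooth_transition c d \<longleftrightarrow> smooth_on (chart_image c (fst d)) (snd d \<circ> chart_inv c)"

definition smooth_manifold ::
  "('m::{t2_space, second_countable_topology}, 'e::euclidean_space) chart set \<Rightarrow> bool" where
  "smooth_manifold A \<longleftrightarrow> (\<forall>c\<in>A. is_chart c) \<and> (\<Union>c\<in>A. fst c) = UNIV \<and>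
     (\<forall>c\<in>A. \<forall>d\<in>A. smooth_transition c d)"

text \<open>Members of the maximal atlas, i.e. arbitrary local coordinates on the manifold.\<close>

definition local_coordinates ::
  "('m::topological_space, 'e::euclidean_space) chart set \<Rightarrow> ('m, 'e) chart \<Rightarrow> bool" where
  "local_coordinates A c \<longleftrightarrow> is_chart c \<and>
     (\<forall>d\<in>A. smooth_transition c d \<and> smooth_transition d c)"

text \<open>The tangent space at \<open>p\<close> is \<open>'e\<close>: a tangent vector at \<open>p\<close> is given by its components in a chart
  around \<open>p\<close> chosen once and for all. No regularity in \<open>p\<close> of this choice is assumed, so fields must
  be re-expressed in a fixed chart (by \<open>components\<close>) before one speaks of their smoothness.\<close>

definition chart_at :: "('m, 'e) chart set \<Rightarrow> 'm \<Rightarrow> ('m, 'e) chart" where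
  "chart_at A p = (SOME c. c \<in> A \<and> p \<in> fst c)"

text \<open>The differential at \<open>p\<close> of a map \<open>f\<close> defined near \<open>p\<close>, applied to the tangent vector \<open>v\<close>.\<close>

definition differential ::
  "('m, 'e::euclidean_space) chart set \<Rightarrow> ('m \<Rightarrow> 'b::real_normed_vector) \<Rightarrow> 'm \<Rightarrow> 'e \<Rightarrow> 'b" where
  "differential A f p v =
     frechet_derivative (f \<circ> chart_inv (chart_at A p)) (at (snd (chart_at A p) p)) v"

text \<open>Components in the chart \<open>c\<close> of the tangent vector \<open>v\<close> at \<open>p\<close>.\<close>

abbreviation components ::
  "('m, 'e::euclidean_space) chart set \<Rightarrow> ('m, 'e) chart \<Rightarrow> 'm \<Rightarrow> 'e \<Rightarrow> 'e" where
  "components A c p v \<equiv> differential A (snd c) p v"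

definition smooth_fun ::
  "('m, 'e::euclidean_space) chart set \<Rightarrow> 'm set \<Rightarrow> ('m \<Rightarrow> real) \<Rightarrow> bool" where
  "smooth_fun A U f \<longleftrightarrow> (\<forall>c\<in>A. smooth_on (chart_image c U) (f \<circ> chart_inv c))"

text \<open>Vector fields and one-forms on the open set \<open>U\<close>; values outside \<open>U\<close> are irrelevant.\<close>

definition in_chart ::
  "('m, 'e::euclidean_space) chart set \<Rightarrow> ('m, 'e) chart \<Rightarrow> ('m \<Rightarrow> 'e) \<Rightarrow> 'e \<Rightarrow> 'e" where
  "in_chart A c X = (\<lambda>x. components A c (chart_inv c x) (X (chart_inv c x)))"

definition smooth_vector_field ::
  "('m, 'e::euclidean_space) chart set \<Rightarrow> 'm set \<Rightarrow> ('m \<Rightarrow> 'e) \<Rightarrow> bool" where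
  "smooth_vector_field A U X \<longleftrightarrow> (\<forall>c\<in>A. smooth_on (chart_image c U) (in_chart A c X))"

definition smooth_one_form ::
  "('m::topological_space, 'e::euclidean_space) chart set \<Rightarrow> 'm set \<Rightarrow> ('m \<Rightarrow> 'e \<Rightarrow>\<^sub>L real) \<Rightarrow> bool" where
  "smooth_one_form A U \<omega> \<longleftrightarrow>
     (\<forall>W X. open W \<and> W \<subseteq> U \<and> smooth_vector_field A W X \<longrightarrow>
        smooth_fun A W (\<lambda>p. blinfun_apply (\<omega> p) (X p)))"

text \<open>\<open>[X, Y] = DY X - DX Y\<close> in the chart that represents tangent vectors at \<open>p\<close>.\<close>

definition lie_bracket ::
  "('m, 'e::euclidean_space) chart set \<Rightarrow> ('m \<Rightarrow> 'e) \<Rightarrow> ('m \<Rightarrow> 'e) \<Rightarrow> 'm \<Rightarrow> 'e" where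
  "lie_bracket A X Y p =
     frechet_derivative (in_chart A (chart_at A p) Y) (at (snd (chart_at A p) p)) (X p) -
     frechet_derivative (in_chart A (chart_at A p) X) (at (snd (chart_at A p) p)) (Y p)"


section \<open>Connections\<close>

text \<open>\<open>D p v Y\<close> is the covariant derivative at \<open>p\<close>, in the direction of the tangent vector \<open>v\<close>, of a
  vector field \<open>Y\<close> that is smooth near \<open>p\<close>. It depends only on the germ of \<open>Y\<close> at \<open>p\<close>: this follows
  from the Leibniz rule, applied to functions that are \<open>0\<close> near \<open>p\<close> and \<open>1\<close> off a neighbourhood.\<close>

type_synonym ('m, 'e) conn = "'m \<Rightarrow> 'e \<Rightarrow> ('m \<Rightarrow> 'e) \<Rightarrow> 'e"

definition affine_connection ::
  "('m::topological_space, 'e::euclidean_space) chart set \<Rightarrow> ('m, 'e) conn \<Rightarrow> bool" where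
  "affine_connection A D \<longleftrightarrow>
     (\<forall>U X Y. open U \<and> smooth_vector_field A U X \<and> smooth_vector_field A U Y \<longrightarrow>
        smooth_vector_field A U (\<lambda>p. D p (X p) Y)) \<and>
     (\<forall>U Y. open U \<and> smooth_vector_field A U Y \<longrightarrow> (\<forall>p\<in>U. linear (\<lambda>v. D p v Y))) \<and>
     (\<forall>U Y Z. open U \<and> smooth_vector_field A U Y \<and> smooth_vector_field A U Z \<longrightarrow>
        (\<forall>p\<in>U. \<forall>v. D p v (\<lambda>q. Y q + Z q) = D p v Y + D p v Z)) \<and>
     (\<forall>U f Y. open U \<and> smooth_fun A U f \<and> smooth_vector_field A U Y \<longrightarrow>
        (\<forall>p\<in>U. \<forall>v. D p v (\<lambda>q. f q *\<^sub>R Y q) =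
            differential A f p v *\<^sub>R Y p + f p *\<^sub>R D p v Y))"

definition torsion ::
  "('m, 'e::euclidean_space) chart set \<Rightarrow> ('m, 'e) conn \<Rightarrow> ('m \<Rightarrow> 'e) \<Rightarrow> ('m \<Rightarrow> 'e) \<Rightarrow> 'm \<Rightarrow> 'e" where
  "torsion A D X Y p = D p (X p) Y - D p (Y p) X - lie_bracket A X Y p"

definition torsion_free ::
  "('m::topological_space, 'e::euclidean_space) chart set \<Rightarrow> ('m, 'e) conn \<Rightarrow> bool" where
  "torsion_free A D \<longleftrightarrow>
     (\<forall>U X Y. open U \<and> smooth_vector_field A U X \<and> smooth_vector_field A U Y \<longrightarrow>
        (\<forall>p\<in>U. torsion A D X Y p = 0))"


section \<open>Veronese webs\<close>

text \<open>A codimension-one foliation, given by its tangent distribution \<open>H\<close>: locally the leaves are the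
  level sets of a submersion \<open>f\<close>, and \<open>H p\<close> is the tangent space at \<open>p\<close> of the leaf through \<open>p\<close>.\<close>

definition codim_one_foliation ::
  "('m::topological_space, 'e::euclidean_space) chart set \<Rightarrow> ('m \<Rightarrow> 'e set) \<Rightarrow> bool" where
  "codim_one_foliation A H \<longleftrightarrow>
     (\<forall>p. \<exists>U f. open U \<and> p \<in> U \<and> smooth_fun A U f \<and>
        (\<forall>q\<in>U. (\<exists>v. differential A f q v \<noteq> 0) \<and> H q = {v. differential A f q v = 0}))"

text \<open>\<open>b\<^sub>0 + t b\<^sub>1 + \<dots> + t\<^sup>k b\<^sub>k\<close> and its iterated derivatives in \<open>t\<close>.\<close>

definition poly_curve :: "nat \<Rightarrow> (nat \<Rightarrow> 'v::real_normed_vector) \<Rightarrow> real \<Rightarrow> 'v" where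
  "poly_curve k b t = (\<Sum>i\<le>k. t ^ i *\<^sub>R b i)"

definition nth_derivative :: "nat \<Rightarrow> (real \<Rightarrow> 'v::real_normed_vector) \<Rightarrow> real \<Rightarrow> 'v" where
  "nth_derivative j = (\<lambda>c t. vector_derivative c (at t)) ^^ j"

definition is_basis :: "nat \<Rightarrow> (nat \<Rightarrow> 'v::real_normed_vector) \<Rightarrow> bool" where
  "is_basis k b \<longleftrightarrow> inj_on b {..k} \<and> independent (b ` {..k}) \<and> span (b ` {..k}) = UNIV"

text \<open>A local coframe on \<open>U\<close> defining the family of distributions \<open>F t\<close>.\<close>

definition web_coframe ::
  "('m::topological_space, 'e::euclidean_space) chart set \<Rightarrow> nat \<Rightarrow> (real \<Rightarrow> 'm \<Rightarrow> 'e set) \<Rightarrow>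
   'm set \<Rightarrow> (nat \<Rightarrow> 'm \<Rightarrow> 'e \<Rightarrow>\<^sub>L real) \<Rightarrow> bool" where
  "web_coframe A k F U \<omega> \<longleftrightarrow>
     (\<forall>i\<le>k. smooth_one_form A U (\<omega> i)) \<and>
     (\<forall>p\<in>U. is_basis k (\<lambda>i. \<omega> i p) \<and>
        (\<forall>t. F t p = {v. blinfun_apply (poly_curve k (\<lambda>i. \<omega> i p) t) v = 0}))"

definition veronese_web ::
  "('m::topological_space, 'e::euclidean_space) chart set \<Rightarrow> nat \<Rightarrow> (real \<Rightarrow> 'm \<Rightarrow> 'e set) \<Rightarrow> bool" where
  "veronese_web A k F \<longleftrightarrow> (\<forall>t. codim_one_foliation A (F t)) \<and>
     (\<forall>p. \<exists>U \<omega>. open U \<and> p \<in> U \<and> web_coframe A k F U \<omega>)"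

text \<open>The frame of the dual curve \<open>V(t)\<close>. The paraconformal structure of Veronese type defined by
  \<open>F\<close> is the field of cones consisting of the lines spanned by the \<open>V(t)\<close>.\<close>

definition dual_frame ::
  "('m::topological_space, 'e::euclidean_space) chart set \<Rightarrow> nat \<Rightarrow> (real \<Rightarrow> 'm \<Rightarrow> 'e set) \<Rightarrow>
   'm set \<Rightarrow> (nat \<Rightarrow> 'm \<Rightarrow> 'e) \<Rightarrow> bool" where
  "dual_frame A k F U V \<longleftrightarrow>
     (\<forall>i\<le>k. smooth_vector_field A U (V i)) \<and> (\<forall>p\<in>U. is_basis k (\<lambda>i. V i p)) \<and>
     (\<exists>\<omega>. web_coframe A k F U \<omega> \<and>
        (\<forall>p\<in>U. \<forall>t. \<forall>j<k.
           blinfun_apply (nth_derivative j (poly_curve k (\<lambda>i. \<omega> i p)) t)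
             (poly_curve k (\<lambda>i. V i p) t) = 0))"

abbreviation dual_curve :: "nat \<Rightarrow> (nat \<Rightarrow> 'm \<Rightarrow> 'e::euclidean_space) \<Rightarrow> real \<Rightarrow> 'm \<Rightarrow> 'e" where
  "dual_curve k V t \<equiv> (\<lambda>p. poly_curve k (\<lambda>i. V i p) t)"

abbreviation dual_curve' :: "nat \<Rightarrow> (nat \<Rightarrow> 'm \<Rightarrow> 'e::euclidean_space) \<Rightarrow> real \<Rightarrow> 'm \<Rightarrow> 'e" where
  "dual_curve' k V t \<equiv> (\<lambda>p. nth_derivative 1 (poly_curve k (\<lambda>i. V i p)) t)"

text \<open>The factor \<open>g\<close> must have no zeros; \<open>\<alpha> i\<close> is the constant value of \<open>g \<omega>\<^sub>i\<close> in the coordinates.\<close>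

definition flat_web ::
  "('m::topological_space, 'e::euclidean_space) chart set \<Rightarrow> nat \<Rightarrow> (real \<Rightarrow> 'm \<Rightarrow> 'e set) \<Rightarrow> bool" where
  "flat_web A k F \<longleftrightarrow>
     (\<forall>p. \<exists>c \<omega> g \<alpha>. local_coordinates A c \<and> p \<in> fst c \<and> web_coframe A k F (fst c) \<omega> \<and>
        smooth_fun A (fst c) g \<and>
        (\<forall>q\<in>fst c. g q \<noteq> 0 \<and>
           (\<forall>i\<le>k. \<forall>v. g q * blinfun_apply (\<omega> i q) v =
               blinfun_apply (\<alpha> i) (components A c q v))))"


section \<open>Connections adapted to a Veronese web\<close>

definition paraconformal ::
  "('m::topological_space, 'e::euclidean_space) chart set \<Rightarrow> nat \<Rightarrow> (real \<Rightarrow> 'm \<Rightarrow> 'e set) \<Rightarrow>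
   ('m, 'e) conn \<Rightarrow> bool" where
  "paraconformal A k F D \<longleftrightarrow>
     (\<forall>U V. open U \<and> dual_frame A k F U V \<longrightarrow>
        (\<forall>p\<in>U. \<forall>v t. D p v (dual_curve k V t) \<in> span {dual_curve k V t p, dual_curve' k V t p}))"

text \<open>The covariant derivative restricts to the leaves of each \<open>F t\<close>. Local vector fields tangent
  to the foliation suffice, as every vector field on a leaf locally extends to one of these.\<close>

definition totally_geodesic ::
  "('m::topological_space, 'e::euclidean_space) chart set \<Rightarrow> (real \<Rightarrow> 'm \<Rightarrow> 'e set) \<Rightarrow>
   ('m, 'e) conn \<Rightarrow> bool" where
  "totally_geodesic A F D \<longleftrightarrow>
     (\<forall>t U X Y. open U \<and> smooth_vector_field A U X \<and> smooth_vector_field A U Y \<and>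
        (\<forall>p\<in>U. X p \<in> F t p \<and> Y p \<in> F t p) \<longrightarrow> (\<forall>p\<in>U. D p (X p) Y \<in> F t p))"

text \<open>The defining properties of the canonical connection; for \<open>k > 2\<close> they determine it.\<close>

definition canonical_connection ::
  "('m::topological_space, 'e::euclidean_space) chart set \<Rightarrow> nat \<Rightarrow> (real \<Rightarrow> 'm \<Rightarrow> 'e set) \<Rightarrow>
   ('m, 'e) conn \<Rightarrow> bool" where
  "canonical_connection A k F D \<longleftrightarrow>
     affine_connection A D \<and> totally_geodesic A F D \<and> paraconformal A k F D \<and>
     (\<forall>U V. open U \<and> dual_frame A k F U V \<longrightarrow>
        (\<forall>p\<in>U. \<forall>t. torsion A D (dual_curve k V t) (dual_curve' k V t) p \<in> span {dual_curve k V t p}))"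

end

theory Submission
  imports Defs
begin

text \<open>Let \<open>E\<^sub>i\<close> be the frame dual to the coframe \<open>\<omega>\<^sub>i\<close>; the dual curve is then, up to a factor,
  \<open>V(t) = \<Sum>\<^sub>i (k choose i) (-t)\<^sup>k\<^sup>-\<^sup>i E\<^sub>i\<close>, normalised by \<open>\<omega>(s)(V(t)) = (s - t)\<^sup>k\<close>. If \<open>\<nabla>\<close> is paraconformal,
  then \<open>\<nabla>\<^sub>X V(t) = \<alpha>(X,t) V(t) + \<beta>(X,t) V'(t)\<close>, where \<open>\<beta>\<close> is a polynomial in \<open>t\<close> of degree at most \<open>2\<close>. If
  \<open>\<nabla>\<close> is also totally geodesic, then \<open>\<beta>(X,t) = 0\<close> for \<open>X\<close> in \<open>ker \<omega>(t)\<close>, so \<open>\<beta>(\<cdot>,t)\<close> is a multiple of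
  \<open>\<omega>(t)\<close>, which has degree \<open>k > 2\<close> in \<open>t\<close>; hence \<open>\<beta> = 0\<close>, \<open>\<alpha>\<close> does not depend on \<open>t\<close>, and
  \<open>\<nabla> E\<^sub>i = \<alpha> \<otimes> E\<^sub>i\<close> for a one-form \<open>\<alpha>\<close>.

  If \<open>\<nabla>\<close> is torsion-free, this means \<open>d\<omega>\<^sub>i = - \<alpha> \<and> \<omega>\<^sub>i\<close>, and \<open>d\<^sup>2 = 0\<close> gives \<open>d\<alpha> \<and> \<omega>\<^sub>i = 0\<close> for all
  \<open>i\<close>, so \<open>d\<alpha> = 0\<close>. Locally \<open>\<alpha> = df\<close>, the forms \<open>e\<^sup>f \<omega>\<^sub>i\<close> are closed, and their primitives are coordinates
  in which the web is flat. Conversely, in flat coordinates the \<open>E\<^sub>i\<close> commute after rescaling, so the torsion of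
  the canonical connection on \<open>(V(t), V'(t))\<close> is \<open>\<alpha>(V(t)) V'(t) - \<alpha>(V'(t)) V(t)\<close>. It lies in the span of
  \<open>V(t)\<close> only if \<open>\<alpha>(V(t)) = 0\<close>, so \<open>\<alpha> = 0\<close> and the connection is the flat one.\<close>

section \<open>Smooth maps between Euclidean spaces\<close>

text \<open>That \<beta>(X,t) vanishes for X in ker \<omega>(t) cannot be seen at V(t) itself: V(t)
  and V'(t) both lie in that kernel, so pairing with \<omega>(t) gives no information there. The
  pairing is made at V(s) with s different from t, where V(s) is first moved into the kernel by a
  multiple of \<open>E\<^sub>0\<close>; the value at s = t is recovered after cancelling a power of
  t - s. Closedness of \<alpha> needs three distinct indices:
  \<open>d\<alpha> \<and> \<omega>\<^sub>m = 0\<close> determines \<open>d\<alpha>\<close> on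
  \<open>E\<^sub>i\<close>, \<open>E\<^sub>j\<close> only when m differs from both. Two features of
  the definitions shape the analytic part. Tangent vectors are components in a chart chosen point by
  point without regularity, so every field is moved to one fixed chart before it is differentiated,
  and the bracket must be shown independent of the chart. A one-form is smooth only through its
  values on smooth fields, so smoothness of the dual frame has to be obtained by inverting a
  smoothly varying linear map.\<close>

lemma frechet_derivative_cong_open:
  assumes "open S" "x \<in> S" "\<And>y. y \<in> S \<Longrightarrow> f y = g y"
  shows "frechet_derivative f (at x) = frechet_derivative g (at x)"
proof -
  have "(f has_derivative D) (at x) \<longleftrightarrow> (g has_derivative D) (at x)" for D
    using assms by (metis has_derivative_transform_within_open)
  then show ?thesis by (simp add: frechet_derivative_def)
qed

lemma differentiable_cong_open:
  assumes "open S" "x \<in> S" "\<And>y. y \<in> S \<Longrightarrow> f y = g y"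
  shows "f differentiable (at x) \<longleftrightarrow> g differentiable (at x)"
  unfolding differentiable_def using assms by (metis has_derivative_transform_within_open)

section \<open>Maps of finite differentiability order\<close>

lemma times_differentiable_on_cong:
  assumes "open S" "\<And>x. x \<in> S \<Longrightarrow> f x = g x"
  shows "times_differentiable_on n S f \<longleftrightarrow> times_differentiable_on n S g"
  using assms(2)
proof (induction n arbitrary: f g)
  case 0
  then show ?case by (simp cong: continuous_on_cong)
next
  case (Suc n)
  have "f differentiable (at x) \<longleftrightarrow> g differentiable (at x)" if "x \<in> S" for x
    using differentiable_cong_open[OF assms(1) that] Suc.prems by blast
  moreover have "times_differentiable_on n S (\<lambda>x. frechet_derivative f (at x) v) \<longleftrightarrow>
      times_differentiable_on n S (\<lambda>x. frechet_derivative g (at x) v)" for v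
    by (rule Suc.IH) (metis frechet_derivative_cong_open assms(1) Suc.prems)
  ultimately show ?case by auto
qed

lemma times_differentiable_on_SucI:
  assumes "open S" "\<And>x. x \<in> S \<Longrightarrow> (f has_derivative f' x) (at x)"
    "\<And>v. times_differentiable_on n S (\<lambda>x. f' x v)"
  shows "times_differentiable_on (Suc n) S f"
proof -
  have "frechet_derivative f (at x) = f' x" if "x \<in> S" for x
    using frechet_derivative_at[OF assms(2)[OF that]] by (rule sym)
  then have "times_differentiable_on n S (\<lambda>x. frechet_derivative f (at x) v)" for v
    by (intro iffD2[OF times_differentiable_on_cong[OF assms(1)] assms(3)]) simp
  then show ?thesis using assms(2) by (auto simp: differentiable_def)
qed

lemma times_differentiable_on_SucD:
  assumes "times_differentiable_on (Suc n) S f"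
  shows "times_differentiable_on n S f"
  using assms
proof (induction n arbitrary: f)
  case 0
  then show ?case
    by (auto intro!: continuous_at_imp_continuous_on differentiable_imp_continuous_within)
next
  case (Suc n)
  then show ?case by (subst times_differentiable_on.simps) (auto simp del: times_differentiable_on.simps, auto)
qed

lemma times_differentiable_on_subset:
  assumes "times_differentiable_on n S f" "T \<subseteq> S"
  shows "times_differentiable_on n T f"
  using assms by (induction n arbitrary: f) (auto intro: continuous_on_subset)

lemma times_differentiable_on_local:
  assumes "\<And>x. x \<in> S \<Longrightarrow> \<exists>T. open T \<and> x \<in> T \<and> times_differentiable_on n T f"
  shows "times_differentiable_on n S f"
  using assms
proof (induction n arbitrary: f)
  case 0
  have "isCont f x" if "x \<in> S" for x
    using 0[OF that] continuous_on_eq_continuous_at by auto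
  then show ?case by (simp add: continuous_at_imp_continuous_on)
next
  case (Suc n)
  have "f differentiable (at x)" if "x \<in> S" for x
    using Suc.prems[OF that] by auto
  moreover have "times_differentiable_on n S (\<lambda>x. frechet_derivative f (at x) v)" for v
    by (rule Suc.IH) (use Suc.prems in fastforce)
  ultimately show ?case by simp
qed

lemma times_differentiable_on_const: "open S \<Longrightarrow> times_differentiable_on n S (\<lambda>_. c)"
proof (induction n arbitrary: c)
  case (Suc n)
  show ?case by (rule times_differentiable_on_SucI[where f' = "\<lambda>_ _. 0"]) (use Suc in auto)
qed auto

lemma times_differentiable_on_bounded_linear:
  assumes "open S" "bounded_linear h"
  shows "times_differentiable_on n S h"
proof (cases n)
  case 0
  then show ?thesis using assms by (simp add: linear_continuous_on)
next
  case (Suc m)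
  show ?thesis unfolding Suc
    by (rule times_differentiable_on_SucI[where f' = "\<lambda>_. h"])
      (use assms in \<open>auto intro: bounded_linear_imp_has_derivative times_differentiable_on_const\<close>)
qed

lemma times_differentiable_on_add:
  assumes "open S" "times_differentiable_on n S f" "times_differentiable_on n S g"
  shows "times_differentiable_on n S (\<lambda>x. f x + g x)"
  using assms(2,3)
proof (induction n arbitrary: f g)
  case 0
  then show ?case by (auto intro: continuous_on_add)
next
  case (Suc n)
  show ?case
  proof (rule times_differentiable_on_SucI[OF assms(1)])
    show "((\<lambda>x. f x + g x) has_derivative
       (\<lambda>v. frechet_derivative f (at x) v + frechet_derivative g (at x) v)) (at x)" if "x \<in> S" for x
      using Suc.prems that by (auto intro!: has_derivative_add simp: frechet_derivative_works)
  qed (use Suc in auto)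
qed

lemma times_differentiable_on_sum:
  assumes "open S" "\<And>i. i \<in> I \<Longrightarrow> times_differentiable_on n S (f i)"
  shows "times_differentiable_on n S (\<lambda>x. \<Sum>i\<in>I. f i x)"
  using assms(2)
  by (induction I rule: infinite_finite_induct)
    (auto intro: times_differentiable_on_add times_differentiable_on_const assms(1))

text \<open>Each term of the product rule has one undifferentiated factor, known to order
  \<open>Suc n\<close>; it is lowered to order \<open>n\<close> before the induction hypothesis
  applies.\<close>

lemma (in bounded_bilinear) times_differentiable_on:
  assumes "open S" "times_differentiable_on n S f" "times_differentiable_on n S g"
  shows "times_differentiable_on n S (\<lambda>x. prod (f x) (g x))"
  using assms(2,3)
proof (induction n arbitrary: f g)
  case 0
  then show ?case by (auto intro: continuous_on)
next
  case (Suc n)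
  show ?case
  proof (rule times_differentiable_on_SucI[OF assms(1)])
    show "((\<lambda>x. prod (f x) (g x)) has_derivative
       (\<lambda>v. prod (f x) (frechet_derivative g (at x) v) + prod (frechet_derivative f (at x) v) (g x))) (at x)"
      if "x \<in> S" for x
      using Suc.prems that by (auto intro!: FDERIV simp: frechet_derivative_works)
    show "times_differentiable_on n S
       (\<lambda>x. prod (f x) (frechet_derivative g (at x) v) + prod (frechet_derivative f (at x) v) (g x))" for v
      using Suc.prems times_differentiable_on_SucD[OF Suc.prems(1)] times_differentiable_on_SucD[OF Suc.prems(2)]
      by (intro times_differentiable_on_add assms(1) Suc.IH) auto
  qed
qed

text \<open>Below it reduces smoothness of a linear map that varies with a point to smoothness of
  its values on the fixed vectors \<open>b\<close>.\<close>

lemma linear_Basis_expansion: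
  fixes h :: "'a::euclidean_space \<Rightarrow> 'b::real_vector"
  assumes "linear h"
  shows "h v = (\<Sum>b\<in>Basis. (v \<bullet> b) *\<^sub>R h b)"
proof -
  have "h v = h (\<Sum>b\<in>Basis. (v \<bullet> b) *\<^sub>R b)" by (simp add: euclidean_representation)
  also have "\<dots> = (\<Sum>b\<in>Basis. (v \<bullet> b) *\<^sub>R h b)"
    using assms by (simp add: linear_sum linear_scale o_def)
  finally show ?thesis .
qed

lemma times_differentiable_on_compose:
  fixes f :: "'b::euclidean_space \<Rightarrow> 'c::real_normed_vector" and g :: "'a::real_normed_vector \<Rightarrow> 'b"
  assumes "open S" "times_differentiable_on n T f" "times_differentiable_on n S g" "g ` S \<subseteq> T"
  shows "times_differentiable_on n S (\<lambda>x. f (g x))"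
  using assms(2,3)
proof (induction n arbitrary: f)
  case 0
  then show ?case using assms(4) by (auto intro: continuous_on_compose2)
next
  case (Suc n)
  show ?case
  proof (rule times_differentiable_on_SucI[OF assms(1)])
    \<comment> \<open>The chain rule is expanded over \<open>Basis\<close> because the induction
      hypothesis covers \<open>\<lambda>y. frechet_derivative f (at y) b\<close> for a fixed
      \<open>b\<close>, not for a direction that varies with the point.\<close>
    show "((\<lambda>x. f (g x)) has_derivative (\<lambda>v. \<Sum>b\<in>Basis. (frechet_derivative g (at x) v \<bullet> b) *\<^sub>R frechet_derivative f (at (g x)) b)) (at x)"
      if "x \<in> S" for x
    proof -
      have f: "f differentiable (at (g x))" and g: "g differentiable (at x)"
        using Suc.prems that assms(4) by auto
      have "((\<lambda>x. f (g x)) has_derivative (\<lambda>v. frechet_derivative f (at (g x)) (frechet_derivative g (at x) v))) (at x)"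
        using has_derivative_compose[OF iffD1[OF frechet_derivative_works g] iffD1[OF frechet_derivative_works f]] .
      then show ?thesis
        by (rule has_derivative_eq_rhs)
          (rule ext, rule linear_Basis_expansion[OF linear_frechet_derivative[OF f]])
    qed
    show "times_differentiable_on n S
      (\<lambda>x. \<Sum>b\<in>Basis. (frechet_derivative g (at x) v \<bullet> b) *\<^sub>R frechet_derivative f (at (g x)) b)" for v
      using Suc.prems times_differentiable_on_SucD[OF Suc.prems(2)]
      by (intro times_differentiable_on_sum assms(1) bounded_bilinear.times_differentiable_on[OF bounded_bilinear_scaleR]
            bounded_bilinear.times_differentiable_on[OF bounded_bilinear_inner]
            times_differentiable_on_const Suc.IH) auto
  qed
qed

section \<open>Smooth maps\<close>

lemma smooth_on_cong: "open S \<Longrightarrow> (\<And>x. x \<in> S \<Longrightarrow> f x = g x) \<Longrightarrow> smooth_on S f \<longleftrightarrow> smooth_on S g"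
  unfolding smooth_on_def using times_differentiable_on_cong by blast

lemma smooth_on_eqI: "open S \<Longrightarrow> smooth_on S g \<Longrightarrow> (\<And>x. x \<in> S \<Longrightarrow> f x = g x) \<Longrightarrow> smooth_on S f"
  using smooth_on_cong[of S f g] by blast

lemma smooth_on_subset: "smooth_on S f \<Longrightarrow> T \<subseteq> S \<Longrightarrow> smooth_on T f"
  unfolding smooth_on_def using times_differentiable_on_subset by blast

lemma smooth_on_local:
  assumes "\<And>x. x \<in> S \<Longrightarrow> \<exists>T. open T \<and> x \<in> T \<and> smooth_on T f"
  shows "smooth_on S f"
  unfolding smooth_on_def
proof
  show "times_differentiable_on n S f" for n
    by (rule times_differentiable_on_local) (use assms in \<open>auto simp: smooth_on_def\<close>)
qed

lemma smooth_on_const: "open S \<Longrightarrow> smooth_on S (\<lambda>_. c)"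
  by (simp add: smooth_on_def times_differentiable_on_const)

lemma smooth_on_add: "open S \<Longrightarrow> smooth_on S f \<Longrightarrow> smooth_on S g \<Longrightarrow> smooth_on S (\<lambda>x. f x + g x)"
  by (simp add: smooth_on_def times_differentiable_on_add)

lemma smooth_on_sum:
  "open S \<Longrightarrow> (\<And>i. i \<in> I \<Longrightarrow> smooth_on S (f i)) \<Longrightarrow> smooth_on S (\<lambda>x. \<Sum>i\<in>I. f i x)"
  by (simp add: smooth_on_def times_differentiable_on_sum)

lemma (in bounded_bilinear) smooth_on:
  "open S \<Longrightarrow> smooth_on S f \<Longrightarrow> smooth_on S g \<Longrightarrow> smooth_on S (\<lambda>x. prod (f x) (g x))"
  by (simp add: smooth_on_def times_differentiable_on)

lemmas smooth_on_scaleR = bounded_bilinear.smooth_on[OF bounded_bilinear_scaleR]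
lemmas smooth_on_inner = bounded_bilinear.smooth_on[OF bounded_bilinear_inner]
lemmas smooth_on_mult = bounded_bilinear.smooth_on[OF bounded_bilinear_mult]

lemma smooth_on_compose:
  fixes f :: "'b::euclidean_space \<Rightarrow> 'c::real_normed_vector" and g :: "'a::real_normed_vector \<Rightarrow> 'b"
  assumes "open S" "smooth_on T f" "smooth_on S g" "g ` S \<subseteq> T"
  shows "smooth_on S (\<lambda>x. f (g x))"
  using assms times_differentiable_on_compose unfolding smooth_on_def by blast

lemma smooth_on_imp_differentiable: "smooth_on S f \<Longrightarrow> x \<in> S \<Longrightarrow> f differentiable (at x)"
  unfolding smooth_on_def by (metis times_differentiable_on.simps(2))

lemma smooth_on_imp_has_derivative:
  "smooth_on S f \<Longrightarrow> x \<in> S \<Longrightarrow> (f has_derivative frechet_derivative f (at x)) (at x)"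
  using smooth_on_imp_differentiable frechet_derivative_works by blast

lemma smooth_on_imp_linear: "smooth_on S f \<Longrightarrow> x \<in> S \<Longrightarrow> linear (frechet_derivative f (at x))"
  using smooth_on_imp_differentiable linear_frechet_derivative by blast

lemma smooth_on_imp_continuous_on: "smooth_on S f \<Longrightarrow> continuous_on S f"
  unfolding smooth_on_def by (metis times_differentiable_on.simps(1))

lemma smooth_on_derivative: "smooth_on S f \<Longrightarrow> smooth_on S (\<lambda>x. frechet_derivative f (at x) v)"
  unfolding smooth_on_def by (metis times_differentiable_on.simps(2))

lemma smooth_onI:
  assumes "open S" "\<And>x. x \<in> S \<Longrightarrow> (f has_derivative f' x) (at x)"
    "\<And>v. smooth_on S (\<lambda>x. f' x v)"
  shows "smooth_on S f"
  unfolding smooth_on_def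
proof
  show "times_differentiable_on n S f" for n
    by (rule times_differentiable_on_SucD, rule times_differentiable_on_SucI[OF assms(1,2)])
      (use assms(3) in \<open>auto simp: smooth_on_def\<close>)
qed

lemma times_differentiable_on_eqI:
  "open S \<Longrightarrow> times_differentiable_on n S g \<Longrightarrow> (\<And>x. x \<in> S \<Longrightarrow> f x = g x) \<Longrightarrow> times_differentiable_on n S f"
  using times_differentiable_on_cong[of S f g n] by blast

lemma times_differentiable_on_linear_family:
  fixes M :: "'a::real_normed_vector \<Rightarrow> 'b::euclidean_space \<Rightarrow> 'c::real_normed_vector"
  assumes "open S" "\<And>x. x \<in> S \<Longrightarrow> linear (M x)" "\<And>v. times_differentiable_on n S (\<lambda>x. M x v)"
    "times_differentiable_on n S g"
  shows "times_differentiable_on n S (\<lambda>x. M x (g x))"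
proof -
  have "times_differentiable_on n S (\<lambda>x. \<Sum>b\<in>Basis. (g x \<bullet> b) *\<^sub>R M x b)"
    by (intro times_differentiable_on_sum times_differentiable_on_const assms
        bounded_bilinear.times_differentiable_on[OF bounded_bilinear_scaleR]
        bounded_bilinear.times_differentiable_on[OF bounded_bilinear_inner])
  moreover have "M x (g x) = (\<Sum>b\<in>Basis. (g x \<bullet> b) *\<^sub>R M x b)" if "x \<in> S" for x
    using linear_Basis_expansion assms(2) that by blast
  ultimately show ?thesis by (rule times_differentiable_on_eqI[OF assms(1)])
qed

lemma smooth_on_linear_family:
  fixes M :: "'a::real_normed_vector \<Rightarrow> 'b::euclidean_space \<Rightarrow> 'c::real_normed_vector"
  assumes "open S" "\<And>x. x \<in> S \<Longrightarrow> linear (M x)" "\<And>v. smooth_on S (\<lambda>x. M x v)" "smooth_on S g"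
  shows "smooth_on S (\<lambda>x. M x (g x))"
  using assms times_differentiable_on_linear_family unfolding smooth_on_def by blast

lemma smooth_on_derivative_apply:
  fixes f :: "'a::euclidean_space \<Rightarrow> 'b::real_normed_vector"
  assumes "open S" "smooth_on T f" "smooth_on S h" "h ` S \<subseteq> T" "smooth_on S g"
  shows "smooth_on S (\<lambda>x. frechet_derivative f (at (h x)) (g x))"
proof (rule smooth_on_linear_family[OF assms(1) _ _ assms(5), where M = "\<lambda>x. frechet_derivative f (at (h x))"])
  show "linear (frechet_derivative f (at (h x)))" if "x \<in> S" for x
    using smooth_on_imp_linear assms that by blast
  show "smooth_on S (\<lambda>x. frechet_derivative f (at (h x)) v)" for v
    by (rule smooth_on_compose[OF assms(1) smooth_on_derivative[OF assms(2)] assms(3,4)])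
qed

lemma smooth_on_exp:
  fixes f :: "'a::real_normed_vector \<Rightarrow> real"
  assumes "open S" "smooth_on S f"
  shows "smooth_on S (\<lambda>x. exp (f x))"
proof (rule smooth_on_compose[OF assms(1) _ assms(2), where T = UNIV])
  \<comment> \<open>The factor \<open>c\<close> makes the claim inductive: the derivative in
    direction \<open>v\<close> is again \<open>exp x\<close> times a constant, now
    \<open>v * c\<close>.\<close>
  have "times_differentiable_on n UNIV (\<lambda>x::real. exp x * c)" for n c
  proof (induction n arbitrary: c)
    case 0
    then show ?case by (auto intro!: continuous_intros)
  next
    case (Suc n)
    have "((\<lambda>x::real. exp x * c) has_derivative (\<lambda>v. exp x * (v * c))) (at x)" for x
      by (auto intro!: derivative_eq_intros)
    then show ?case by (rule times_differentiable_on_SucI[OF open_UNIV]) (rule Suc)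
  qed
  from this[of _ 1] show "smooth_on UNIV (exp :: real \<Rightarrow> real)" by (simp add: smooth_on_def)
qed auto

text \<open>Where \<open>f\<close> vanishes, continuity of \<open>g\<close> is enough for the
  product rule: \<open>f (x + h)\<close> is of order \<open>norm h\<close> while
  \<open>g (x + h) - g x\<close> tends to 0. This allows an inverse family to be differentiated
  before it is known to be differentiable.\<close>

lemma has_derivative_scaleR_vanishing:
  fixes f :: "'a::real_normed_vector \<Rightarrow> real" and g :: "'a \<Rightarrow> 'b::real_normed_vector"
  assumes f: "(f has_derivative f') (at x)" "f x = 0" and g: "isCont g x"
  shows "((\<lambda>y. f y *\<^sub>R g y) has_derivative (\<lambda>v. f' v *\<^sub>R g x)) (at x)"
proof -
  have bl: "bounded_linear f'" and lim: "((\<lambda>h. norm (f (x + h) - f x - f' h) / norm h) \<longlongrightarrow> 0) (at 0)"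
    using f(1) by (auto simp: has_derivative_at)
  obtain K where K: "\<And>h. norm (f' h) \<le> norm h * K" using bounded_linear.bounded[OF bl] by blast
  have glim: "((\<lambda>h. norm (g (x + h) - g x)) \<longlongrightarrow> 0) (at 0)"
    using g by (intro tendsto_norm_zero) (simp add: isCont_iff LIM_zero_iff)
  have "((\<lambda>h. (norm (f (x + h) - f x - f' h) / norm h + K) * norm (g (x + h) - g x)) \<longlongrightarrow> (0 + K) * 0) (at 0)"
    by (intro tendsto_intros lim glim)
  then have "((\<lambda>h. (norm (f (x + h) - f x - f' h) / norm h + K) * norm (g (x + h) - g x)) \<longlongrightarrow> 0) (at 0)"
    by simp
  then have "((\<lambda>h. norm (f (x + h) *\<^sub>R (g (x + h) - g x)) / norm h) \<longlongrightarrow> 0) (at 0)"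
  proof (rule Lim_null_comparison[rotated])
    show "\<forall>\<^sub>F h in at 0. norm (norm (f (x + h) *\<^sub>R (g (x + h) - g x)) / norm h)
        \<le> (norm (f (x + h) - f x - f' h) / norm h + K) * norm (g (x + h) - g x)"
      unfolding eventually_at_filter
    proof (intro always_eventually allI impI)
      fix h :: 'a assume "h \<noteq> 0"
      have "norm (f (x + h)) \<le> norm (f (x + h) - f x - f' h) + norm (f' h)"
        using f(2) norm_triangle_ineq[of "f (x + h) - f x - f' h" "f' h"] by simp
      also have "\<dots> \<le> norm (f (x + h) - f x - f' h) + norm h * K" using K by auto
      finally have "norm (f (x + h)) / norm h \<le> (norm (f (x + h) - f x - f' h) + norm h * K) / norm h"
        by (rule divide_right_mono) simp
      also have "\<dots> = norm (f (x + h) - f x - f' h) / norm h + K"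
        using \<open>h \<noteq> 0\<close> by (simp add: add_divide_distrib)
      finally have "norm (f (x + h)) / norm h * norm (g (x + h) - g x) \<le>
         (norm (f (x + h) - f x - f' h) / norm h + K) * norm (g (x + h) - g x)"
        by (rule mult_right_mono) simp
      then show "norm (norm (f (x + h) *\<^sub>R (g (x + h) - g x)) / norm h) \<le>
         (norm (f (x + h) - f x - f' h) / norm h + K) * norm (g (x + h) - g x)"
        by simp
    qed
  qed
  then have "((\<lambda>y. f y *\<^sub>R (g y - g x)) has_derivative (\<lambda>v. 0)) (at x)"
    using f(2) by (simp add: has_derivative_at)
  from has_derivative_add[OF has_derivative_scaleR_left[OF f(1), of "g x"] this]
  show ?thesis by (simp add: algebra_simps)
qed

section \<open>Inverses of linear isomorphisms that depend smoothly on a point\<close>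

lemma inverse_family_linear:
  assumes "linear M" "\<And>v. N (M v) = v" "\<And>w. M (N w) = w"
  shows "linear N"
proof (rule linearI)
  show "N (a + b) = N a + N b" for a b
    using assms(2)[of "N a + N b"] by (simp add: linear_add[OF assms(1)] assms(3))
  show "N (r *\<^sub>R b) = r *\<^sub>R N b" for r b
    using assms(2)[of "r *\<^sub>R N b"] by (simp add: linear_scale[OF assms(1)] assms(3))
qed

text \<open>If \<open>C\<close> bounds \<open>N x\<close> and \<open>M y\<close> differs from
  \<open>M x\<close> by an operator of norm at most \<open>1 / (2 * C)\<close>, the defect can be
  absorbed: \<open>u = N y w\<close> satisfies \<open>norm u \<le> C * norm w + norm u / 2\<close>.
  The bound delivered is therefore \<open>2 * C\<close>.\<close>

lemma inverse_family_bound: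
  fixes M N :: "'a::real_normed_vector \<Rightarrow> 'b::euclidean_space \<Rightarrow> 'b"
  assumes "open S" "x \<in> S" "\<And>y. y \<in> S \<Longrightarrow> linear (M y)" "\<And>v. isCont (\<lambda>y. M y v) x"
    and inv: "\<And>y v. y \<in> S \<Longrightarrow> N y (M y v) = v" "\<And>y v. y \<in> S \<Longrightarrow> M y (N y v) = v"
  obtains C where "\<forall>\<^sub>F y in at x. \<forall>w. norm (N y w) \<le> C * norm w"
proof -
  have "linear (N x)" by (rule inverse_family_linear[OF assms(3)[OF assms(2)]]) (use assms in auto)
  then obtain C where C: "C > 0" "\<And>w. norm (N x w) \<le> norm w * C"
    using bounded_linear.pos_bounded[OF linear_conv_bounded_linear[THEN iffD1]] by blast
  have "((\<lambda>y. \<Sum>b\<in>Basis. norm (M y b - M x b)) \<longlongrightarrow> (\<Sum>b\<in>(Basis::'b set). 0)) (at x)"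
    by (intro tendsto_sum tendsto_norm_zero LIM_zero) (use assms(4) in \<open>auto simp: isCont_def\<close>)
  then have "((\<lambda>y. \<Sum>b\<in>(Basis::'b set). norm (M y b - M x b)) \<longlongrightarrow> 0) (at x)" by simp
  then have ev: "\<forall>\<^sub>F y in at x. (\<Sum>b\<in>(Basis::'b set). norm (M y b - M x b)) < 1 / (2 * C)"
    using C(1) by (intro order_tendstoD(2)) auto
  have evS: "\<forall>\<^sub>F y in at x. y \<in> S" using assms(1,2) by (simp add: eventually_at_in_open')
  have "\<forall>\<^sub>F y in at x. \<forall>w. norm (N y w) \<le> 2 * C * norm w"
    using ev evS
  proof eventually_elim
    case (elim y)
    show ?case
    proof
      fix w
      define u where "u = N y w"
      have lin: "linear (\<lambda>u. M y u - M x u)" using assms(2,3) elim by (intro linear_compose_sub) auto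
      have "norm (M y u - M x u) = norm (\<Sum>b\<in>Basis. (u \<bullet> b) *\<^sub>R (M y b - M x b))"
        using arg_cong[OF linear_Basis_expansion[OF lin, of u], of norm] .
      also have "\<dots> \<le> (\<Sum>b\<in>Basis. norm u * norm (M y b - M x b))"
        by (rule sum_norm_le) (auto intro!: mult_right_mono Basis_le_norm)
      also have "\<dots> = norm u * (\<Sum>b\<in>Basis. norm (M y b - M x b))" by (simp add: sum_distrib_left)
      also have "\<dots> \<le> norm u * (1 / (2 * C))" using elim by (intro mult_left_mono) auto
      finally have d: "norm (M y u - M x u) \<le> norm u / (2 * C)" by simp
      have "norm u = norm (N x (M x u))" using inv assms(2) by simp
      also have "\<dots> \<le> norm (M x u) * C" by (rule C)
      also have "norm (M x u) \<le> norm (M y u) + norm (M y u - M x u)"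
        using norm_triangle_ineq4[of "M y u" "M y u - M x u"] by simp
      then have "norm (M x u) * C \<le> (norm (M y u) + norm u / (2 * C)) * C"
        using d C(1) by (intro mult_right_mono) auto
      also have "\<dots> = norm w * C + norm u / 2" using C(1) inv elim by (simp add: u_def field_simps)
      finally have "norm u \<le> norm w * C + norm u / 2" .
      then show "norm (N y w) \<le> 2 * C * norm w" by (simp add: u_def algebra_simps)
    qed
  qed
  then show ?thesis by (rule that)
qed

text \<open>Used with \<open>M y\<close>, \<open>N y\<close> and \<open>u = N x w\<close>: it writes
  \<open>N y w\<close> as a constant plus \<open>N y\<close> applied to \<open>w - M y u\<close>,
  which vanishes at \<open>y = x\<close>. Continuity and differentiability of the inverse both rest
  on this.\<close>

lemma inverse_family_diff:
  assumes "linear N" "\<And>w. M (N w) = w" "\<And>v. N (M v) = v"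
  shows "N w = u + N (w - M u)"
  using assms by (simp add: linear_diff)

lemma inverse_family_isCont:
  fixes M N :: "'a::real_normed_vector \<Rightarrow> 'b::euclidean_space \<Rightarrow> 'b"
  assumes "open S" "x \<in> S" "\<And>y. y \<in> S \<Longrightarrow> linear (M y)" "\<And>v. isCont (\<lambda>y. M y v) x"
    and inv: "\<And>y v. y \<in> S \<Longrightarrow> N y (M y v) = v" "\<And>y v. y \<in> S \<Longrightarrow> M y (N y v) = v"
  shows "isCont (\<lambda>y. N y w) x"
proof -
  have lin: "linear (N y)" if "y \<in> S" for y
    by (rule inverse_family_linear[OF assms(3)[OF that]]) (use that inv in auto)
  obtain C where C: "\<forall>\<^sub>F y in at x. \<forall>w. norm (N y w) \<le> C * norm w"
    using inverse_family_bound[OF assms] .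
  define u where "u = N x w"
  have evS: "\<forall>\<^sub>F y in at x. y \<in> S" using assms(1,2) by (simp add: eventually_at_in_open')
  have "((\<lambda>y. C * norm (w - M y u)) \<longlongrightarrow> C * norm (w - M x u)) (at x)"
    using assms(4)[of u] by (intro tendsto_intros) (simp add: isCont_def)
  then have lim: "((\<lambda>y. C * norm (w - M y u)) \<longlongrightarrow> 0) (at x)"
    using inv assms(2) by (simp add: u_def)
  have "((\<lambda>y. N y w - u) \<longlongrightarrow> 0) (at x)"
  proof (rule Lim_null_comparison[OF _ lim])
    show "\<forall>\<^sub>F y in at x. norm (N y w - u) \<le> C * norm (w - M y u)"
      using C evS
    proof eventually_elim
      case (elim y)
      then show ?case using inverse_family_diff[OF lin[OF elim(2)], of "M y" w u] inv by simp
    qed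
  qed
  then show ?thesis by (simp add: isCont_def LIM_zero_iff u_def)
qed

text \<open>In \<open>N y w = u + N y (h y)\<close> with \<open>h y = w - M y u\<close> the argument
  \<open>h\<close> vanishes at \<open>x\<close>, so only its derivative contributes and continuity
  of \<open>N\<close> suffices.\<close>

lemma inverse_family_has_derivative:
  fixes M N :: "'a::real_normed_vector \<Rightarrow> 'b::euclidean_space \<Rightarrow> 'b"
  assumes "open S" "x \<in> S" "\<And>y. y \<in> S \<Longrightarrow> linear (M y)"
    and M': "\<And>v. ((\<lambda>y. M y v) has_derivative M' v) (at x)"
    and inv: "\<And>y v. y \<in> S \<Longrightarrow> N y (M y v) = v" "\<And>y v. y \<in> S \<Longrightarrow> M y (N y v) = v"
  shows "((\<lambda>y. N y w) has_derivative (\<lambda>v. - N x (M' (N x w) v))) (at x)"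
proof -
  define u where "u = N x w"
  define h where "h y = w - M y u" for y
  have contM: "isCont (\<lambda>y. M y v) x" for v
    using has_derivative_continuous[OF M'] .
  have lin: "linear (N y)" if "y \<in> S" for y
    by (rule inverse_family_linear[OF assms(3)[OF that]]) (use that inv in auto)
  have hd: "(h has_derivative (\<lambda>v. - M' u v)) (at x)"
    using has_derivative_diff[OF has_derivative_const M'[of u]] by (simp add: h_def [abs_def])
  have h0: "h x = 0" using inv assms(2) by (simp add: h_def u_def)
  have exp: "(\<Sum>b\<in>Basis. (z \<bullet> b) *\<^sub>R N y b) = N y z" if "y \<in> S" for y z
    using linear_Basis_expansion[OF lin[OF that]] by (rule sym)
  have "((\<lambda>y. (h y \<bullet> b) *\<^sub>R N y b) has_derivative (\<lambda>v. ((- M' u v) \<bullet> b) *\<^sub>R N x b)) (at x)" for b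
    using inverse_family_isCont[OF assms(1,2,3) contM inv]
    by (intro has_derivative_scaleR_vanishing has_derivative_inner_left[OF hd]) (simp_all add: h0)
  then have "((\<lambda>y. \<Sum>b\<in>Basis. (h y \<bullet> b) *\<^sub>R N y b) has_derivative
     (\<lambda>v. \<Sum>b\<in>Basis. ((- M' u v) \<bullet> b) *\<^sub>R N x b)) (at x)"
    by (intro has_derivative_sum)
  from has_derivative_add[OF has_derivative_const[of u] this]
  have "((\<lambda>y. u + (\<Sum>b\<in>Basis. (h y \<bullet> b) *\<^sub>R N y b)) has_derivative (\<lambda>v. N x (- M' u v))) (at x)"
    unfolding exp[OF assms(2)] by simp
  then have "((\<lambda>y. N y w) has_derivative (\<lambda>v. N x (- M' u v))) (at x)"
  proof (rule has_derivative_transform_within_open[OF _ assms(1,2)])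
    show "u + (\<Sum>b\<in>Basis. (h y \<bullet> b) *\<^sub>R N y b) = N y w" if "y \<in> S" for y
      using inverse_family_diff[OF lin[OF that], of "M y" w u] inv that by (simp add: h_def exp)
  qed
  then show ?thesis using linear_neg[OF lin[OF assms(2)]] by (simp add: u_def)
qed

text \<open>The derivative of \<open>N\<close> involves only \<open>N\<close> itself and one
  derivative of \<open>M\<close>, so each order of regularity of \<open>N\<close> yields the next.
  The vector \<open>w\<close> is generalised because \<open>N\<close> is applied to new
  arguments.\<close>

lemma smooth_on_inverse_family:
  fixes M N :: "'a::real_normed_vector \<Rightarrow> 'b::euclidean_space \<Rightarrow> 'b"
  assumes "open S" "\<And>x. x \<in> S \<Longrightarrow> linear (M x)" and sm: "\<And>v. smooth_on S (\<lambda>x. M x v)"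
    and inv: "\<And>y v. y \<in> S \<Longrightarrow> N y (M y v) = v" "\<And>y v. y \<in> S \<Longrightarrow> M y (N y v) = v"
  shows "smooth_on S (\<lambda>x. N x w)"
proof -
  have lin: "linear (N y)" if "y \<in> S" for y
    by (rule inverse_family_linear[OF assms(2)[OF that]]) (use that inv in auto)
  have D: "((\<lambda>y. M y v) has_derivative frechet_derivative (\<lambda>y. M y v) (at x)) (at x)" if "x \<in> S" for x v
    using smooth_on_imp_has_derivative[OF sm that] .
  \<comment> \<open>Linearity in the vector survives differentiation in the point, by uniqueness of
    derivatives. It is needed because the differentiated family is applied to the varying vector
    \<open>N x w\<close>.\<close>
  have linD: "linear (\<lambda>v. frechet_derivative (\<lambda>y. M y v) (at x) u)" if "x \<in> S" for x u
  proof (rule linearI)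
    fix a b :: 'b
    have "((\<lambda>y. M y (a + b)) has_derivative
        (\<lambda>u. frechet_derivative (\<lambda>y. M y a) (at x) u + frechet_derivative (\<lambda>y. M y b) (at x) u)) (at x)"
      by (rule has_derivative_transform_within_open[OF has_derivative_add[OF D[OF that] D[OF that]] assms(1) that])
        (simp add: linear_add assms(2))
    from has_derivative_unique[OF D[OF that] this]
    show "frechet_derivative (\<lambda>y. M y (a + b)) (at x) u =
       frechet_derivative (\<lambda>y. M y a) (at x) u + frechet_derivative (\<lambda>y. M y b) (at x) u"
      by (rule fun_cong)
  next
    fix r :: real and b :: 'b
    have "((\<lambda>y. M y (r *\<^sub>R b)) has_derivative
        (\<lambda>u. r *\<^sub>R frechet_derivative (\<lambda>y. M y b) (at x) u)) (at x)"
      by (rule has_derivative_transform_within_open[OF has_derivative_scaleR_right[OF D[OF that]] assms(1) that])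
        (simp add: linear_scale assms(2))
    from has_derivative_unique[OF D[OF that] this]
    show "frechet_derivative (\<lambda>y. M y (r *\<^sub>R b)) (at x) u = r *\<^sub>R frechet_derivative (\<lambda>y. M y b) (at x) u"
      by (rule fun_cong)
  qed
  have "times_differentiable_on n S (\<lambda>x. N x w)" for n w
  proof (induction n arbitrary: w)
    case 0
    have "isCont (\<lambda>y. N y w) x" if "x \<in> S" for x
      by (rule inverse_family_isCont[OF assms(1) that assms(2) has_derivative_continuous[OF D[OF that]] inv])
    then show ?case by (simp add: continuous_at_imp_continuous_on)
  next
    case (Suc n)
    show ?case
    proof (rule times_differentiable_on_SucI[OF assms(1)])
      show "((\<lambda>y. N y w) has_derivative (\<lambda>v. - N x (frechet_derivative (\<lambda>y. M y (N x w)) (at x) v))) (at x)"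
        if "x \<in> S" for x
        by (rule inverse_family_has_derivative[OF assms(1) that assms(2) D[OF that] inv])
      have neg: "bounded_linear (uminus :: 'b \<Rightarrow> 'b)" by (rule bounded_linear_minus[OF bounded_linear_ident])
      show "times_differentiable_on n S (\<lambda>x. - N x (frechet_derivative (\<lambda>y. M y (N x w)) (at x) v))" for v
      proof (rule times_differentiable_on_compose[OF assms(1) times_differentiable_on_bounded_linear[OF open_UNIV neg]])
        show "times_differentiable_on n S (\<lambda>x. N x (frechet_derivative (\<lambda>y. M y (N x w)) (at x) v))"
        proof (rule times_differentiable_on_linear_family[OF assms(1) lin Suc])
          show "times_differentiable_on n S (\<lambda>x. frechet_derivative (\<lambda>y. M y (N x w)) (at x) v)"
          proof (rule times_differentiable_on_linear_family[OF assms(1) linD _ Suc])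
            show "times_differentiable_on n S (\<lambda>x. frechet_derivative (\<lambda>y. M y u) (at x) v)" for u
              using smooth_on_derivative[OF sm] by (simp add: smooth_on_def)
          qed
        qed
      qed auto
    qed
  qed
  then show ?thesis by (simp add: smooth_on_def)
qed

text \<open>The derivative of \<open>\<Psi>\<close> at \<open>y\<close> is
  \<open>N (\<Psi> y)\<close>, and \<open>N\<close> is smooth as an inverse family; so each order of
  regularity of \<open>\<Psi>\<close> gives the next one, starting from continuity.\<close>

lemma smooth_on_inverse_map:
  fixes \<Phi> \<Psi> :: "'a::euclidean_space \<Rightarrow> 'a"
  assumes "open S" "open T" "smooth_on S \<Phi>" "continuous_on T \<Psi>" "\<Psi> ` T \<subseteq> S"
    and right: "\<And>y. y \<in> T \<Longrightarrow> \<Phi> (\<Psi> y) = y"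
    and inv: "\<And>x v. x \<in> S \<Longrightarrow> N x (frechet_derivative \<Phi> (at x) v) = v"
      "\<And>x v. x \<in> S \<Longrightarrow> frechet_derivative \<Phi> (at x) (N x v) = v"
  shows "smooth_on T \<Psi>"
proof -
  have lin: "linear (N x)" if "x \<in> S" for x
    by (rule inverse_family_linear[OF smooth_on_imp_linear[OF assms(3) that]]) (use that inv in auto)
  have smN: "smooth_on S (\<lambda>x. N x w)" for w
    by (rule smooth_on_inverse_family[OF assms(1) smooth_on_imp_linear[OF assms(3)] smooth_on_derivative[OF assms(3)] inv])
  have "times_differentiable_on n T \<Psi>" for n
  proof (induction n)
    case 0
    then show ?case using assms(4) by simp
  next
    case (Suc n)
    show ?case
    proof (rule times_differentiable_on_SucI[OF assms(2)])
      fix y assume y: "y \<in> T"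
      then have x: "\<Psi> y \<in> S" using assms(5) by blast
      show "(\<Psi> has_derivative N (\<Psi> y)) (at y)"
      proof (rule has_derivative_inverse_basic[OF smooth_on_imp_has_derivative[OF assms(3) x] _ _ _ assms(2) y right])
        show "bounded_linear (N (\<Psi> y))" using lin[OF x] by (simp add: linear_conv_bounded_linear)
        show "N (\<Psi> y) \<circ> frechet_derivative \<Phi> (at (\<Psi> y)) = id" using inv(1)[OF x] by auto
        show "isCont \<Psi> y" using assms(2,4) y by (simp add: continuous_on_eq_continuous_at)
      qed
    next
      show "times_differentiable_on n T (\<lambda>y. N (\<Psi> y) w)" for w
        by (rule times_differentiable_on_compose[OF assms(2) _ Suc assms(5)])
          (use smN in \<open>simp add: smooth_on_def\<close>)
    qed
  qed
  then show ?thesis by (simp add: smooth_on_def)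
qed

section \<open>Symmetry of second derivatives and the Poincare lemma\<close>

text \<open>Two mean value theorems: along \<open>u\<close> for the difference of \<open>f\<close>
  across the side \<open>h *\<^sub>R v\<close>, then along \<open>v\<close> for the derivative of
  \<open>f\<close> in direction \<open>u\<close>. The second difference is symmetric in
  \<open>u\<close> and \<open>v\<close>, which is what forces the second derivatives to
  agree.\<close>

lemma second_difference_mean_value:
  fixes f :: "'a::euclidean_space \<Rightarrow> real"
  assumes sm: "smooth_on S f" and h: "h > 0"
    and S: "\<And>s t. 0 \<le> s \<Longrightarrow> s \<le> h \<Longrightarrow> 0 \<le> t \<Longrightarrow> t \<le> h \<Longrightarrow> x + s *\<^sub>R u + t *\<^sub>R v \<in> S"
  shows "\<exists>s t. 0 \<le> s \<and> s \<le> h \<and> 0 \<le> t \<and> t \<le> h \<and>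
    f (x + h *\<^sub>R u + h *\<^sub>R v) - f (x + h *\<^sub>R u) - f (x + h *\<^sub>R v) + f x =
    h * (h * frechet_derivative (\<lambda>y. frechet_derivative f (at y) u) (at (x + s *\<^sub>R u + t *\<^sub>R v)) v)"
proof -
  have D: "((\<lambda>s. F (p + s *\<^sub>R u)) has_real_derivative frechet_derivative F (at (p + s *\<^sub>R u)) u) (at s)"
    if F: "smooth_on S F" and p: "p + s *\<^sub>R u \<in> S" for F :: "'a \<Rightarrow> real" and p s u
  proof -
    have "((\<lambda>s. p + s *\<^sub>R u) has_derivative (\<lambda>r. r *\<^sub>R u)) (at s)"
      by (auto intro!: derivative_eq_intros)
    from has_derivative_compose[OF this smooth_on_imp_has_derivative[OF F p]]
    have "((\<lambda>s. F (p + s *\<^sub>R u)) has_derivative (\<lambda>r. frechet_derivative F (at (p + s *\<^sub>R u)) (r *\<^sub>R u))) (at s)" .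
    then show ?thesis
      by (simp add: has_field_derivative_def linear_scale[OF smooth_on_imp_linear[OF F p]] mult_commute_abs)
  qed
  define \<phi> where "\<phi> s = f ((x + h *\<^sub>R v) + s *\<^sub>R u) - f (x + s *\<^sub>R u)" for s
  define \<phi>' where "\<phi>' s = frechet_derivative f (at ((x + h *\<^sub>R v) + s *\<^sub>R u)) u
      - frechet_derivative f (at (x + s *\<^sub>R u)) u" for s
  have "\<exists>s>0. s < h \<and> \<phi> h - \<phi> 0 = (h - 0) * \<phi>' s"
  proof (rule MVT2[OF h])
    fix s assume s: "0 \<le> s" "s \<le> h"
    have "x + h *\<^sub>R v + s *\<^sub>R u \<in> S" "x + s *\<^sub>R u \<in> S"
      using S[of s h] S[of s 0] s h by (simp_all add: algebra_simps)
    then show "(\<phi> has_real_derivative \<phi>' s) (at s)"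
      unfolding \<phi>_def [abs_def] \<phi>'_def by (intro DERIV_diff D sm)
  qed
  then obtain s where s: "0 < s" "s < h" "\<phi> h - \<phi> 0 = h * \<phi>' s" by auto
  define \<psi> where "\<psi> t = frechet_derivative f (at ((x + s *\<^sub>R u) + t *\<^sub>R v)) u" for t
  define \<psi>' where "\<psi>' t = frechet_derivative (\<lambda>y. frechet_derivative f (at y) u) (at ((x + s *\<^sub>R u) + t *\<^sub>R v)) v" for t
  have "\<exists>t>0. t < h \<and> \<psi> h - \<psi> 0 = (h - 0) * \<psi>' t"
  proof (rule MVT2[OF h])
    fix t assume t: "0 \<le> t" "t \<le> h"
    have "x + s *\<^sub>R u + t *\<^sub>R v \<in> S" using S[of s t] s t by simp
    from D[OF smooth_on_derivative[OF sm] this]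
    show "(\<psi> has_real_derivative \<psi>' t) (at t)"
      unfolding \<psi>_def [abs_def] \<psi>'_def .
  qed
  then obtain t where t: "0 < t" "t < h" "\<psi> h - \<psi> 0 = h * \<psi>' t" by auto
  have "\<phi>' s = \<psi> h - \<psi> 0" by (simp add: \<phi>'_def \<psi>_def algebra_simps)
  with s t have "\<phi> h - \<phi> 0 = h * (h * \<psi>' t)" by simp
  moreover have "\<phi> h - \<phi> 0 = f (x + h *\<^sub>R u + h *\<^sub>R v) - f (x + h *\<^sub>R u) - f (x + h *\<^sub>R v) + f x"
    by (simp add: \<phi>_def algebra_simps)
  ultimately show ?thesis using s t unfolding \<psi>'_def by (intro exI[of _ s] exI[of _ t]) auto
qed

lemma second_derivative_symmetric_real:
  fixes f :: "'a::euclidean_space \<Rightarrow> real"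
  assumes "open S" and sm: "smooth_on S f" and x: "x \<in> S"
  shows "frechet_derivative (\<lambda>y. frechet_derivative f (at y) u) (at x) v =
    frechet_derivative (\<lambda>y. frechet_derivative f (at y) v) (at x) u"
proof -
  define H where "H u v y = frechet_derivative (\<lambda>y. frechet_derivative f (at y) u) (at y) v" for u v y
  have cont: "continuous_on S (H u v)" for u v
    unfolding H_def [abs_def]
    by (intro smooth_on_imp_continuous_on smooth_on_derivative sm)
  \<comment> \<open>One and the same second difference equals \<open>h * h\<close> times
    \<open>H u v\<close> at one point of a small parallelogram and \<open>h * h\<close> times
    \<open>H v u\<close> at another; each of these values is within \<open>e / 2\<close> of the one
    at \<open>x\<close>.\<close>
  have "\<bar>H u v x - H v u x\<bar> \<le> e" if e: "e > 0" for e
  proof -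
    have near: "\<exists>r>0. \<forall>y. dist y x < r \<longrightarrow> y \<in> S \<and> dist (H u v y) (H u v x) < e / 2" for u v
    proof -
      have "isCont (H u v) x" using cont assms(1) x by (simp add: continuous_on_eq_continuous_at)
      then obtain d where d: "d > 0" "\<And>y. dist y x < d \<Longrightarrow> dist (H u v y) (H u v x) < e / 2"
        unfolding continuous_at_eps_delta using e half_gt_zero by blast
      obtain d' where d': "d' > 0" "\<And>y. dist y x < d' \<Longrightarrow> y \<in> S" using assms(1) x open_dist by blast
      show ?thesis using d d' by (intro exI[of _ "min d d'"]) auto
    qed
    obtain r1 where r1: "r1 > 0" "\<And>y. dist y x < r1 \<Longrightarrow> y \<in> S \<and> dist (H u v y) (H u v x) < e / 2" using near by blast
    obtain r2 where r2: "r2 > 0" "\<And>y. dist y x < r2 \<Longrightarrow> y \<in> S \<and> dist (H v u y) (H v u x) < e / 2" using near by blast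
    define r where "r = min r1 r2"
    \<comment> \<open>The summand 1 keeps \<open>n\<close> positive when \<open>u\<close> and
      \<open>v\<close> are both 0; with the resulting \<open>h\<close> the whole parallelogram stays
      within distance \<open>r\<close> of \<open>x\<close>.\<close>
    define n where "n = norm u + norm v + 1"
    define h where "h = r / (2 * n)"
    have np: "n > 0" by (simp add: n_def add_nonneg_pos)
    have r: "r > 0" using r1 r2 by (simp add: r_def)
    have h: "h > 0" using r np by (simp add: h_def)
    have hb: "h * (norm u + norm v) < r"
    proof -
      have "h * (norm u + norm v) \<le> h * n" using h by (simp add: n_def)
      also have "\<dots> = r / 2" using np by (simp add: h_def)
      also have "\<dots> < r" using r by simp
      finally show ?thesis .
    qed
    have dd: "dist (x + s *\<^sub>R u + t *\<^sub>R v) x < r" if "0 \<le> s" "s \<le> h" "0 \<le> t" "t \<le> h" for s t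
    proof -
      have "dist (x + s *\<^sub>R u + t *\<^sub>R v) x = norm (s *\<^sub>R u + t *\<^sub>R v)" by (simp add: dist_norm)
      also have "\<dots> \<le> s * norm u + t * norm v" using norm_triangle_ineq[of "s *\<^sub>R u" "t *\<^sub>R v"] that by simp
      also have "\<dots> \<le> h * norm u + h * norm v" using that by (intro add_mono mult_right_mono) auto
      also have "\<dots> < r" using hb by (simp add: algebra_simps)
      finally show ?thesis .
    qed
    have inS: "x + s *\<^sub>R u + t *\<^sub>R v \<in> S" if "0 \<le> s" "s \<le> h" "0 \<le> t" "t \<le> h" for s t
      using dd[OF that] r1(2) by (simp add: r_def)
    have inS': "x + s *\<^sub>R v + t *\<^sub>R u \<in> S" if "0 \<le> s" "s \<le> h" "0 \<le> t" "t \<le> h" for s t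
      using inS[of t s] that by (simp add: algebra_simps)
    obtain s t where st: "0 \<le> s" "s \<le> h" "0 \<le> t" "t \<le> h"
      "f (x + h *\<^sub>R u + h *\<^sub>R v) - f (x + h *\<^sub>R u) - f (x + h *\<^sub>R v) + f x = h * (h * H u v (x + s *\<^sub>R u + t *\<^sub>R v))"
      using second_difference_mean_value[OF sm h inS] unfolding H_def by blast
    obtain s' t' where st': "0 \<le> s'" "s' \<le> h" "0 \<le> t'" "t' \<le> h"
      "f (x + h *\<^sub>R v + h *\<^sub>R u) - f (x + h *\<^sub>R v) - f (x + h *\<^sub>R u) + f x = h * (h * H v u (x + s' *\<^sub>R v + t' *\<^sub>R u))"
      using second_difference_mean_value[OF sm h inS'] unfolding H_def by blast
    have "h * (h * H u v (x + s *\<^sub>R u + t *\<^sub>R v)) = h * (h * H v u (x + s' *\<^sub>R v + t' *\<^sub>R u))"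
      using st(5) st'(5) by (simp add: algebra_simps)
    then have eq: "H u v (x + s *\<^sub>R u + t *\<^sub>R v) = H v u (x + s' *\<^sub>R v + t' *\<^sub>R u)" using h by simp
    have 1: "dist (H u v (x + s *\<^sub>R u + t *\<^sub>R v)) (H u v x) < e / 2"
      using dd[OF st(1-4)] r1(2) by (simp add: r_def)
    have "dist (x + s' *\<^sub>R v + t' *\<^sub>R u) x < r" using dd[OF st'(3,4,1,2)] by (simp add: algebra_simps)
    then have 2: "dist (H v u (x + s' *\<^sub>R v + t' *\<^sub>R u)) (H v u x) < e / 2"
      using r2(2) by (simp add: r_def)
    show ?thesis using 1 2 eq unfolding dist_real_def by linarith
  qed
  then have "\<bar>H u v x - H v u x\<bar> \<le> 0" using field_le_epsilon[of "\<bar>H u v x - H v u x\<bar>" 0] by simp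
  then show ?thesis by (simp add: H_def)
qed

lemma frechet_derivative_inner_left:
  assumes "f differentiable (at x)"
  shows "frechet_derivative (\<lambda>y. f y \<bullet> b) (at x) v = frechet_derivative f (at x) v \<bullet> b"
  using frechet_derivative_at[OF has_derivative_inner_left[OF iffD1[OF frechet_derivative_works assms], of b]]
  by (rule fun_cong[OF sym])

lemma second_derivative_symmetric:
  fixes f :: "'a::euclidean_space \<Rightarrow> 'b::euclidean_space"
  assumes "open S" and sm: "smooth_on S f" and x: "x \<in> S"
  shows "frechet_derivative (\<lambda>y. frechet_derivative f (at y) u) (at x) v =
    frechet_derivative (\<lambda>y. frechet_derivative f (at y) v) (at x) u"
proof (rule euclidean_eqI)
  fix b :: 'b
  have smb: "smooth_on S (\<lambda>y. f y \<bullet> b)" by (intro smooth_on_inner smooth_on_const assms)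
  have D: "frechet_derivative (\<lambda>y. frechet_derivative (\<lambda>y. f y \<bullet> b) (at y) u) (at x) v =
     frechet_derivative (\<lambda>y. frechet_derivative f (at y) u) (at x) v \<bullet> b" for u v
  proof -
    have "frechet_derivative (\<lambda>y. frechet_derivative (\<lambda>y. f y \<bullet> b) (at y) u) (at x) =
        frechet_derivative (\<lambda>y. frechet_derivative f (at y) u \<bullet> b) (at x)"
      by (rule frechet_derivative_cong_open[OF assms(1) x])
        (rule frechet_derivative_inner_left[OF smooth_on_imp_differentiable[OF sm]])
    then show ?thesis
      using frechet_derivative_inner_left[OF smooth_on_imp_differentiable[OF smooth_on_derivative[OF sm] x]] by simp
  qed
  show "frechet_derivative (\<lambda>y. frechet_derivative f (at y) u) (at x) v \<bullet> b =
    frechet_derivative (\<lambda>y. frechet_derivative f (at y) v) (at x) u \<bullet> b"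
    using second_derivative_symmetric_real[OF assms(1) smb x] unfolding D .
qed

text \<open>\<open>f x\<close> is the integral of \<alpha> along the segment from \<open>x0\<close>
  to \<open>x\<close>. By \<open>closed\<close> the vectors \<open>v\<close> and
  \<open>x - x0\<close> may change places in the gradient of the integrand, which thereby becomes
  \<open>g x t\<close>, the derivative in \<open>t\<close> of
  \<open>t *\<^sub>R \<alpha> (p x t)\<close>; its integral over the unit interval is
  \<open>\<alpha> x\<close>.\<close>

lemma Poincare_one_form:
  fixes \<alpha> :: "'a::euclidean_space \<Rightarrow> 'a"
  assumes "open S" "convex S" "x0 \<in> S" and sm: "smooth_on S \<alpha>"
    and closed: "\<And>x u v. x \<in> S \<Longrightarrow> frechet_derivative \<alpha> (at x) u \<bullet> v = frechet_derivative \<alpha> (at x) v \<bullet> u"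
  obtains f :: "'a \<Rightarrow> real" where "\<And>x. x \<in> S \<Longrightarrow> (f has_derivative (\<lambda>v. \<alpha> x \<bullet> v)) (at x)" "smooth_on S f"
proof -
  define p where "p x t = x0 + t *\<^sub>R (x - x0)" for x and t :: real
  define g where "g x t = t *\<^sub>R frechet_derivative \<alpha> (at (p x t)) (x - x0) + \<alpha> (p x t)" for x t
  define F where "F x t = \<alpha> (p x t) \<bullet> (x - x0)" for x t
  have pS: "p x t \<in> S" if "x \<in> S" "t \<in> {0..1}" for x t
  proof -
    have "p x t = (1 - t) *\<^sub>R x0 + t *\<^sub>R x" by (simp add: p_def algebra_simps)
    then show ?thesis using convexD[OF assms(2,3) that(1), of "1 - t" t] that(2) by simp
  qed
  have contp: "continuous_on (S \<times> {0..1}) (\<lambda>z. p (fst z) (snd z))"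
    unfolding p_def by (intro continuous_intros)
  have contD: "continuous_on (S \<times> {0..1}) (\<lambda>z. frechet_derivative \<alpha> (at (p (fst z) (snd z))) b)" for b
    by (rule continuous_on_compose2[OF smooth_on_imp_continuous_on[OF smooth_on_derivative[OF sm]] contp])
      (use pS in auto)
  have contg: "continuous_on (S \<times> {0..1}) (\<lambda>z. g (fst z) (snd z))"
  proof -
    have "g x t = t *\<^sub>R (\<Sum>b\<in>Basis. ((x - x0) \<bullet> b) *\<^sub>R frechet_derivative \<alpha> (at (p x t)) b) + \<alpha> (p x t)"
      if "x \<in> S" "t \<in> {0..1}" for x t
      unfolding g_def using linear_Basis_expansion[OF smooth_on_imp_linear[OF sm pS[OF that]], of "x - x0"] by simp
    then have "continuous_on (S \<times> {0..1}) (\<lambda>z. g (fst z) (snd z)) \<longleftrightarrow>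
      continuous_on (S \<times> {0..1}) (\<lambda>z. snd z *\<^sub>R (\<Sum>b\<in>Basis. ((fst z - x0) \<bullet> b) *\<^sub>R
         frechet_derivative \<alpha> (at (p (fst z) (snd z))) b) + \<alpha> (p (fst z) (snd z)))"
      by (intro continuous_on_cong) auto
    moreover have "continuous_on (S \<times> {0..1}) (\<lambda>z. \<alpha> (p (fst z) (snd z)))"
      by (rule continuous_on_compose2[OF smooth_on_imp_continuous_on[OF sm] contp]) (use pS in auto)
    ultimately show ?thesis using contD by (simp add: continuous_intros)
  qed
  have der: "((\<lambda>x. F x t) has_derivative blinfun_apply (blinfun_inner_left (g x t))) (at x within S)"
    if "x \<in> S" "t \<in> cbox 0 1" for x t
  proof -
    have pS': "p x t \<in> S" using pS that by simp
    have "((\<lambda>x. p x t) has_derivative (\<lambda>v. t *\<^sub>R v)) (at x)"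
      unfolding p_def by (auto intro!: derivative_eq_intros)
    from has_derivative_compose[OF this smooth_on_imp_has_derivative[OF sm pS']]
    have "((\<lambda>x. \<alpha> (p x t)) has_derivative (\<lambda>v. t *\<^sub>R frechet_derivative \<alpha> (at (p x t)) v)) (at x)"
      by (simp add: linear_scale[OF smooth_on_imp_linear[OF sm pS']])
    moreover have "((\<lambda>x. x - x0) has_derivative (\<lambda>v. v)) (at x)"
      by (auto intro!: derivative_eq_intros)
    ultimately have "((\<lambda>x. F x t) has_derivative (\<lambda>v. \<alpha> (p x t) \<bullet> v +
        t *\<^sub>R frechet_derivative \<alpha> (at (p x t)) v \<bullet> (x - x0))) (at x)"
      unfolding F_def by (rule has_derivative_inner)
    moreover have "\<alpha> (p x t) \<bullet> v + t *\<^sub>R frechet_derivative \<alpha> (at (p x t)) v \<bullet> (x - x0) =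
        blinfun_inner_left (g x t) v" for v
      using closed[OF pS', of v "x - x0"] by (simp add: g_def inner_commute inner_add_right)
    ultimately show ?thesis by (simp add: has_derivative_at_withinI)
  qed
  define f where "f x = integral (cbox 0 1) (F x)" for x
  have f': "(f has_derivative (\<lambda>v. \<alpha> x \<bullet> v)) (at x)" if x: "x \<in> S" for x
  proof -
    have "((\<lambda>x. integral (cbox 0 1) (F x)) has_derivative
        blinfun_apply (integral (cbox 0 1) (\<lambda>t. blinfun_inner_left (g x t)))) (at x within S)"
    proof (rule leibniz_rule[OF der _ _ x assms(2)])
      show "F y integrable_on cbox 0 1" if "y \<in> S" for y
      proof -
        have "continuous_on {0..1} (\<lambda>t. \<alpha> (p y t))"
          by (rule continuous_on_compose2[OF smooth_on_imp_continuous_on[OF sm]])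
            (use pS that in \<open>auto simp: p_def intro!: continuous_intros\<close>)
        then show ?thesis unfolding F_def [abs_def]
          by (intro integrable_continuous) (simp add: continuous_intros)
      qed
      show "continuous_on (S \<times> cbox 0 1) (\<lambda>(x, t). blinfun_inner_left (g x t))"
        using bounded_linear.continuous_on[OF bounded_linear_blinfun_inner_left contg]
        by (simp add: case_prod_beta)
    qed
    also have "integral (cbox 0 1) (\<lambda>t. blinfun_inner_left (g x t)) = blinfun_inner_left (\<alpha> x)"
    proof -
      have "((\<lambda>t. blinfun_inner_left (g x t)) has_integral
         (blinfun_inner_left (1 *\<^sub>R \<alpha> (p x 1)) - blinfun_inner_left (0 *\<^sub>R \<alpha> (p x 0)))) {0..1}"
      proof (rule fundamental_theorem_of_calculus)
        fix t :: real assume t: "t \<in> {0..1}"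
        have "((\<lambda>t. p x t) has_derivative (\<lambda>r. r *\<^sub>R (x - x0))) (at t)"
          unfolding p_def by (auto intro!: derivative_eq_intros)
        from has_derivative_compose[OF this smooth_on_imp_has_derivative[OF sm pS[OF x t]]]
        have "((\<lambda>t. \<alpha> (p x t)) has_vector_derivative frechet_derivative \<alpha> (at (p x t)) (x - x0)) (at t)"
          by (simp add: has_vector_derivative_def linear_scale[OF smooth_on_imp_linear[OF sm pS[OF x t]]])
        from has_vector_derivative_scaleR[OF DERIV_ident this]
        have "((\<lambda>t. t *\<^sub>R \<alpha> (p x t)) has_vector_derivative g x t) (at t)"
          by (simp add: g_def)
        from bounded_linear.has_vector_derivative[OF bounded_linear_blinfun_inner_left this]
        show "((\<lambda>t. blinfun_inner_left (t *\<^sub>R \<alpha> (p x t))) has_vector_derivative blinfun_inner_left (g x t))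
            (at t within {0..1})"
          by (rule has_vector_derivative_at_within)
      qed simp
      then have "((\<lambda>t. blinfun_inner_left (g x t)) has_integral blinfun_inner_left (\<alpha> x)) (cbox 0 1)"
        by (simp add: p_def linear_0[OF bounded_linear.linear[OF bounded_linear_blinfun_inner_left]])
      then show ?thesis by (rule integral_unique)
    qed
    finally have "(f has_derivative (\<lambda>v. v \<bullet> \<alpha> x)) (at x within S)"
      by (simp add: f_def [abs_def] blinfun_inner_left.rep_eq [abs_def])
    then show ?thesis using at_within_open[OF x assms(1)] by (simp add: inner_commute)
  qed
  have "smooth_on S f"
  proof (rule smooth_onI[OF assms(1) f'])
    show "smooth_on S (\<lambda>x. \<alpha> x \<bullet> v)" for v
      by (rule smooth_on_inner[OF assms(1) sm smooth_on_const[OF assms(1)]])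
  qed
  with f' show ?thesis using that by blast
qed

section \<open>Frames that commute up to a conformal factor\<close>

lemma inner_enumerated_Basis:
  fixes B :: "nat \<Rightarrow> 'a::euclidean_space"
  assumes "bij_betw B {..k} Basis" "i \<le> k" "j \<le> k"
  shows "B i \<bullet> B j = (if i = j then 1 else 0)"
proof -
  have "B i \<in> Basis" "B j \<in> Basis" "B i = B j \<longleftrightarrow> i = j"
    using assms by (auto simp: bij_betw_def inj_on_eq_iff)
  then show ?thesis by (simp add: inner_Basis)
qed

lemma bilinear_eq_on_frame:
  fixes e :: "nat \<Rightarrow> 'a::real_vector" and G H :: "'a \<Rightarrow> 'a \<Rightarrow> real"
  assumes "bilinear G" "bilinear H" "span (e ` I) = UNIV"
    "\<And>i j. i \<in> I \<Longrightarrow> j \<in> I \<Longrightarrow> G (e i) (e j) = H (e i) (e j)"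
  shows "G u v = H u v"
  by (rule bilinear_eq[OF assms(1,2), of UNIV "e ` I" UNIV "e ` I"]) (use assms(3,4) in auto)

lemma bilinearI:
  assumes "\<And>u. linear (\<lambda>v. G u v)" "\<And>v. linear (\<lambda>u. G u v)"
  shows "bilinear G"
  using assms by (simp add: bilinear_def)

lemma span_frame:
  fixes \<theta> e :: "nat \<Rightarrow> 'a::real_inner"
  assumes "\<And>v. v = (\<Sum>i\<le>k. (\<theta> i \<bullet> v) *\<^sub>R e i)"
  shows "span (e ` {..k}) = UNIV"
proof -
  have "v \<in> span (e ` {..k})" for v
    by (subst assms) (intro span_sum span_scale span_base imageI)
  then show ?thesis by auto
qed

text \<open>\<open>\<theta>\<close> is the coframe dual to the frame \<open>e\<close>, with covectors represented by means of the inner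
  product, and \<open>[e\<^sub>i, e\<^sub>j] = a\<^sub>i e\<^sub>j - a\<^sub>j e\<^sub>i\<close>.\<close>

locale conformally_commuting_frame =
  fixes S :: "'a::euclidean_space set" and k :: nat
    and \<theta> e :: "nat \<Rightarrow> 'a \<Rightarrow> 'a" and a :: "nat \<Rightarrow> 'a \<Rightarrow> real"
  assumes S: "open S" and k: "k \<ge> 2"
    and sm\<theta>: "i \<le> k \<Longrightarrow> smooth_on S (\<theta> i)"
    and sme: "i \<le> k \<Longrightarrow> smooth_on S (e i)"
    and sma: "i \<le> k \<Longrightarrow> smooth_on S (a i)"
    and dual: "x \<in> S \<Longrightarrow> i \<le> k \<Longrightarrow> j \<le> k \<Longrightarrow> \<theta> i x \<bullet> e j x = (if i = j then 1 else 0)"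
    and expand: "x \<in> S \<Longrightarrow> v = (\<Sum>i\<le>k. (\<theta> i x \<bullet> v) *\<^sub>R e i x)"
    and bracket: "x \<in> S \<Longrightarrow> i \<le> k \<Longrightarrow> j \<le> k \<Longrightarrow>
      frechet_derivative (e j) (at x) (e i x) - frechet_derivative (e i) (at x) (e j x) =
      a i x *\<^sub>R e j x - a j x *\<^sub>R e i x"
begin

definition \<alpha> :: "'a \<Rightarrow> 'a" where "\<alpha> x = (\<Sum>i\<le>k. a i x *\<^sub>R \<theta> i x)"

lemma smooth_\<alpha>: "smooth_on S \<alpha>"
  unfolding \<alpha>_def [abs_def] by (intro smooth_on_sum smooth_on_scaleR S sma sm\<theta>) auto

lemma \<alpha>_e: assumes "x \<in> S" "j \<le> k" shows "\<alpha> x \<bullet> e j x = a j x"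
proof -
  have "\<alpha> x \<bullet> e j x = (\<Sum>i\<le>k. if j = i then a i x else 0)"
    unfolding \<alpha>_def inner_sum_left by (rule sum.cong) (use assms dual in auto)
  then show ?thesis using assms(2) by simp
qed

text \<open>Since \<open>\<theta> m x \<bullet> e j x\<close> is constant,
  \<open>d\<theta>\<^sub>m(e\<^sub>i, e\<^sub>j) = -
  \<theta>\<^sub>m([e\<^sub>i, e\<^sub>j])\<close>, and the bracket relation turns this into the
  value of \<open>- \<alpha> \<and> \<theta>\<^sub>m\<close>. Both sides are bilinear, so the frame
  vectors suffice.\<close>

lemma d\<theta>:
  assumes x: "x \<in> S" and m: "m \<le> k"
  shows "frechet_derivative (\<theta> m) (at x) u \<bullet> v - frechet_derivative (\<theta> m) (at x) v \<bullet> u =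
     (\<alpha> x \<bullet> v) * (\<theta> m x \<bullet> u) - (\<alpha> x \<bullet> u) * (\<theta> m x \<bullet> v)"
proof -
  define D where "D = frechet_derivative (\<theta> m) (at x)"
  have lin: "linear D" unfolding D_def by (rule smooth_on_imp_linear[OF sm\<theta>[OF m] x])
  have dp: "D w \<bullet> e j x = - (\<theta> m x \<bullet> frechet_derivative (e j) (at x) w)" if j: "j \<le> k" for w j
  proof -
    have "((\<lambda>y. \<theta> m y \<bullet> e j y) has_derivative
        (\<lambda>w. \<theta> m x \<bullet> frechet_derivative (e j) (at x) w + D w \<bullet> e j x)) (at x)"
      unfolding D_def
      by (rule has_derivative_inner[OF smooth_on_imp_has_derivative[OF sm\<theta>[OF m] x]
            smooth_on_imp_has_derivative[OF sme[OF j] x]])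
    moreover have "((\<lambda>y. \<theta> m y \<bullet> e j y) has_derivative (\<lambda>w. 0)) (at x)"
      by (rule has_derivative_transform_within_open[OF has_derivative_const S x])
        (use dual[OF _ m j] in simp)
    ultimately have "(\<lambda>w. \<theta> m x \<bullet> frechet_derivative (e j) (at x) w + D w \<bullet> e j x) = (\<lambda>w. 0)"
      by (rule has_derivative_unique)
    from fun_cong[OF this, of w] show ?thesis by simp
  qed
  have "D u \<bullet> v - D v \<bullet> u = (\<alpha> x \<bullet> v) * (\<theta> m x \<bullet> u) - (\<alpha> x \<bullet> u) * (\<theta> m x \<bullet> v)"
  proof (rule bilinear_eq_on_frame[OF _ _ span_frame[OF expand[OF x]],
        where G = "\<lambda>u v. D u \<bullet> v - D v \<bullet> u"
          and H = "\<lambda>u v. (\<alpha> x \<bullet> v) * (\<theta> m x \<bullet> u) - (\<alpha> x \<bullet> u) * (\<theta> m x \<bullet> v)"])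
    show "bilinear (\<lambda>u v. D u \<bullet> v - D v \<bullet> u)"
      by (intro bilinearI linearI) (simp_all add: linear_add[OF lin] linear_scale[OF lin] algebra_simps inner_simps)
    show "bilinear (\<lambda>u v. (\<alpha> x \<bullet> v) * (\<theta> m x \<bullet> u) - (\<alpha> x \<bullet> u) * (\<theta> m x \<bullet> v))"
      by (intro bilinearI linearI) (simp_all add: algebra_simps inner_simps)
    show "D (e i x) \<bullet> e j x - D (e j x) \<bullet> e i x =
        (\<alpha> x \<bullet> e j x) * (\<theta> m x \<bullet> e i x) - (\<alpha> x \<bullet> e i x) * (\<theta> m x \<bullet> e j x)"
      if "i \<in> {..k}" "j \<in> {..k}" for i j
    proof -
      have ij: "i \<le> k" "j \<le> k" using that by auto
      have "D (e i x) \<bullet> e j x - D (e j x) \<bullet> e i x = - (\<theta> m x \<bullet>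
          (frechet_derivative (e j) (at x) (e i x) - frechet_derivative (e i) (at x) (e j x)))"
        by (simp add: dp ij inner_diff_right)
      also have "\<dots> = a j x * (\<theta> m x \<bullet> e i x) - a i x * (\<theta> m x \<bullet> e j x)"
        unfolding bracket[OF x ij] by (simp add: inner_diff_right)
      finally show ?thesis using \<alpha>_e[OF x] ij by simp
    qed
  qed
  then show ?thesis by (simp add: D_def)
qed

lemma \<alpha>_closed:
  assumes x: "x \<in> S"
  shows "frechet_derivative \<alpha> (at x) u \<bullet> v = frechet_derivative \<alpha> (at x) v \<bullet> u"
proof -
  define A where "A = frechet_derivative \<alpha> (at x)"
  have linA: "linear A" unfolding A_def by (rule smooth_on_imp_linear[OF smooth_\<alpha> x])
  \<comment> \<open>Up to sign this is \<open>d\<alpha> \<and> \<theta>\<^sub>m\<close> on three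
    vectors. It comes from differentiating \<open>d\<theta>\<close> once more.\<close>
  have key: "(A w \<bullet> v - A v \<bullet> w) * (\<theta> m x \<bullet> u) + (A u \<bullet> w - A w \<bullet> u) * (\<theta> m x \<bullet> v)
      + (A v \<bullet> u - A u \<bullet> v) * (\<theta> m x \<bullet> w) = 0" if m: "m \<le> k" for m u v w
  proof -
    define D where "D = frechet_derivative (\<theta> m) (at x)"
    define H where "H w u = frechet_derivative (\<lambda>y. frechet_derivative (\<theta> m) (at y) u) (at x) w" for w u
    have Hsym: "H w u = H u w" for u w
      unfolding H_def by (rule second_derivative_symmetric[OF S sm\<theta>[OF m] x])
    have E: "H w u \<bullet> v - H w v \<bullet> u = (A w \<bullet> v) * (\<theta> m x \<bullet> u) + (\<alpha> x \<bullet> v) * (D w \<bullet> u)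
        - (A w \<bullet> u) * (\<theta> m x \<bullet> v) - (\<alpha> x \<bullet> u) * (D w \<bullet> v)" for u v w
    proof -
      have "((\<lambda>y. frechet_derivative (\<theta> m) (at y) u \<bullet> v - frechet_derivative (\<theta> m) (at y) v \<bullet> u)
          has_derivative (\<lambda>w. H w u \<bullet> v - H w v \<bullet> u)) (at x)"
        unfolding H_def
        by (intro has_derivative_diff has_derivative_inner_left
            smooth_on_imp_has_derivative[OF smooth_on_derivative[OF sm\<theta>[OF m]] x])
      moreover have "((\<lambda>y. frechet_derivative (\<theta> m) (at y) u \<bullet> v - frechet_derivative (\<theta> m) (at y) v \<bullet> u)
          has_derivative (\<lambda>w. ((\<alpha> x \<bullet> v) * (D w \<bullet> u) + (A w \<bullet> v) * (\<theta> m x \<bullet> u))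
           - ((\<alpha> x \<bullet> u) * (D w \<bullet> v) + (A w \<bullet> u) * (\<theta> m x \<bullet> v)))) (at x)"
      proof (rule has_derivative_transform_within_open[OF _ S x])
        show "((\<lambda>y. (\<alpha> y \<bullet> v) * (\<theta> m y \<bullet> u) - (\<alpha> y \<bullet> u) * (\<theta> m y \<bullet> v)) has_derivative
           (\<lambda>w. ((\<alpha> x \<bullet> v) * (D w \<bullet> u) + (A w \<bullet> v) * (\<theta> m x \<bullet> u))
           - ((\<alpha> x \<bullet> u) * (D w \<bullet> v) + (A w \<bullet> u) * (\<theta> m x \<bullet> v)))) (at x)"
          unfolding D_def A_def
          by (intro has_derivative_diff has_derivative_mult has_derivative_inner_left
              smooth_on_imp_has_derivative[OF sm\<theta>[OF m] x] smooth_on_imp_has_derivative[OF smooth_\<alpha> x])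
      qed (use d\<theta>[OF _ m] in simp)
      ultimately have "(\<lambda>w. H w u \<bullet> v - H w v \<bullet> u) = (\<lambda>w. ((\<alpha> x \<bullet> v) * (D w \<bullet> u) + (A w \<bullet> v) * (\<theta> m x \<bullet> u))
           - ((\<alpha> x \<bullet> u) * (D w \<bullet> v) + (A w \<bullet> u) * (\<theta> m x \<bullet> v)))"
        by (rule has_derivative_unique)
      from fun_cong[OF this, of w] show ?thesis by simp
    qed
    have d: "D u \<bullet> v = D v \<bullet> u + ((\<alpha> x \<bullet> v) * (\<theta> m x \<bullet> u) - (\<alpha> x \<bullet> u) * (\<theta> m x \<bullet> v))" for u v
      using d\<theta>[OF x m, of u v] by (simp add: D_def)
    \<comment> \<open>Symmetry of second derivatives in the form
      \<open>d\<^sup>2 \<theta>\<^sub>m = 0\<close>. Once \<open>d\<close> is substituted, the terms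
      without \<open>A\<close> cancel because they form
      \<open>\<alpha> \<and> \<alpha> \<and> \<theta>\<^sub>m\<close>.\<close>
    have "(H w u \<bullet> v - H w v \<bullet> u) + (H u v \<bullet> w - H u w \<bullet> v) + (H v w \<bullet> u - H v u \<bullet> w) = 0"
      by (simp add: Hsym[of u w] Hsym[of v w] Hsym[of v u])
    then show ?thesis
      unfolding E d[of w u] d[of w v] d[of u v] by (simp add: algebra_simps)
  qed
  have "A u \<bullet> v - A v \<bullet> u = 0"
  proof (rule bilinear_eq_on_frame[OF _ _ span_frame[OF expand[OF x]],
        where G = "\<lambda>u v. A u \<bullet> v - A v \<bullet> u" and H = "\<lambda>_ _. 0"])
    show "bilinear (\<lambda>u v. A u \<bullet> v - A v \<bullet> u)"
      by (intro bilinearI linearI) (simp_all add: linear_add[OF linA] linear_scale[OF linA] algebra_simps inner_simps)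
    show "bilinear (\<lambda>_ _ :: 'a. 0 :: real)" by (intro bilinearI linearI) simp_all
    show "A (e i x) \<bullet> e j x - A (e j x) \<bullet> e i x = 0" if "i \<in> {..k}" "j \<in> {..k}" for i j
    proof -
      \<comment> \<open>There are \<open>k + 1 \<ge> 3\<close> indices, so some \<open>m\<close>
        differs from both; evaluated on \<open>e i\<close>, \<open>e j\<close>, \<open>e m\<close>,
        only the term with \<open>\<theta> m x \<bullet> e m x = 1\<close> survives in
        \<open>key\<close>.\<close>
      have "card {i, j} < card {..k}" using k card_insert_le_m1[of 2 "{j}" i] by simp
      then obtain m where m: "m \<in> {..k}" "m \<notin> {i, j}"
        by (metis card_mono finite.emptyI finite.insertI not_le subsetI)
      show ?thesis using key[of m "e i x" "e j x" "e m x"] dual[OF x] m that by simp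
    qed
  qed
  then show ?thesis by (simp add: A_def)
qed

lemma potential:
  assumes "convex S" "S \<noteq> {}"
  obtains g where "smooth_on S g" "\<And>x. x \<in> S \<Longrightarrow> g x > (0::real)"
    "\<And>x. x \<in> S \<Longrightarrow> (g has_derivative (\<lambda>v. g x * (\<alpha> x \<bullet> v))) (at x)"
proof -
  obtain x0 where "x0 \<in> S" using assms by blast
  from Poincare_one_form[OF S assms(1) this smooth_\<alpha> \<alpha>_closed] obtain f where
    f: "\<And>x. x \<in> S \<Longrightarrow> (f has_derivative (\<lambda>v. \<alpha> x \<bullet> v)) (at x)" "smooth_on S f" by blast
  show ?thesis
  proof (rule that)
    show "smooth_on S (\<lambda>x. exp (f x))" by (rule smooth_on_exp[OF S f(2)])
    show "((\<lambda>x. exp (f x)) has_derivative (\<lambda>v. exp (f x) * (\<alpha> x \<bullet> v))) (at x)" if "x \<in> S" for x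
      using has_derivative_exp[OF f(1)[OF that]] by (simp add: mult.commute)
  qed simp
qed

text \<open>\<open>d(g \<theta>\<^sub>m) = dg \<and> \<theta>\<^sub>m + g d\<theta>\<^sub>m\<close>
  vanishes because \<open>dg = g \<alpha>\<close> and
  \<open>d\<theta>\<^sub>m = - \<alpha> \<and> \<theta>\<^sub>m\<close>; each primitive serves as
  one coordinate.\<close>

lemma coordinates:
  assumes "convex S" "S \<noteq> {}"
  obtains g X where "smooth_on S g" "\<And>x. x \<in> S \<Longrightarrow> g x > (0::real)"
    "\<And>m. m \<le> k \<Longrightarrow> smooth_on S (X m)"
    "\<And>x m. x \<in> S \<Longrightarrow> m \<le> k \<Longrightarrow> (X m has_derivative (\<lambda>v. g x * (\<theta> m x \<bullet> v))) (at x)"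
proof -
  obtain g where g: "smooth_on S g" "\<And>x. x \<in> S \<Longrightarrow> g x > (0::real)"
    "\<And>x. x \<in> S \<Longrightarrow> (g has_derivative (\<lambda>v. g x * (\<alpha> x \<bullet> v))) (at x)"
    using potential[OF assms] by blast
  obtain x0 where x0: "x0 \<in> S" using assms by blast
  have "\<exists>X. smooth_on S X \<and> (\<forall>x\<in>S. (X has_derivative (\<lambda>v. g x * (\<theta> m x \<bullet> v))) (at x))" if m: "m \<le> k" for m
  proof -
    have sm: "smooth_on S (\<lambda>x. g x *\<^sub>R \<theta> m x)" by (rule smooth_on_scaleR[OF S g(1) sm\<theta>[OF m]])
    have D: "frechet_derivative (\<lambda>x. g x *\<^sub>R \<theta> m x) (at x) =
       (\<lambda>v. g x *\<^sub>R frechet_derivative (\<theta> m) (at x) v + (g x * (\<alpha> x \<bullet> v)) *\<^sub>R \<theta> m x)" if "x \<in> S" for x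
      by (rule sym, rule frechet_derivative_at, rule has_derivative_scaleR[OF g(3)[OF that]])
        (rule smooth_on_imp_has_derivative[OF sm\<theta>[OF m] that])
    have "frechet_derivative (\<lambda>x. g x *\<^sub>R \<theta> m x) (at x) u \<bullet> v = frechet_derivative (\<lambda>x. g x *\<^sub>R \<theta> m x) (at x) v \<bullet> u"
      if x: "x \<in> S" for x u v
    proof -
      have eq: "frechet_derivative (\<theta> m) (at x) u \<bullet> v = frechet_derivative (\<theta> m) (at x) v \<bullet> u
          + ((\<alpha> x \<bullet> v) * (\<theta> m x \<bullet> u) - (\<alpha> x \<bullet> u) * (\<theta> m x \<bullet> v))"
        using d\<theta>[OF x m, of u v] by simp
      show ?thesis unfolding D[OF x] inner_add_left inner_scaleR_left eq by (simp add: algebra_simps)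
    qed
    from Poincare_one_form[OF S assms(1) x0 sm this] obtain X where
      "\<And>x. x \<in> S \<Longrightarrow> (X has_derivative (\<lambda>v. (g x *\<^sub>R \<theta> m x) \<bullet> v)) (at x)" "smooth_on S X" by blast
    then show ?thesis by (intro exI[of _ X]) simp
  qed
  then obtain X where "\<And>m. m \<le> k \<Longrightarrow> smooth_on S (X m) \<and>
     (\<forall>x\<in>S. (X m has_derivative (\<lambda>v. g x * (\<theta> m x \<bullet> v))) (at x))" by metis
  then show ?thesis by (intro that[OF g(1,2), of X]) auto
qed

text \<open>The derivative of \<open>\<Phi>\<close> is inverted explicitly by \<open>N\<close>,
  because \<open>e\<close> is dual to \<open>\<theta>\<close>. From the inverse function theorem
  only the local homeomorphism is taken; smoothness of \<open>\<Psi>\<close> is then derived from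
  \<open>N\<close>.\<close>

lemma flat_coordinates:
  fixes B :: "nat \<Rightarrow> 'a"
  assumes "convex S" and x0: "x0 \<in> S" and B: "bij_betw B {..k} Basis"
  obtains g \<Phi> \<Psi> S' T where "open S'" "S' \<subseteq> S" "x0 \<in> S'" "open T" "homeomorphism S' T \<Phi> \<Psi>"
    "smooth_on S' \<Phi>" "smooth_on T \<Psi>" "smooth_on S g" "\<And>x. x \<in> S \<Longrightarrow> g x > (0::real)"
    "\<And>x v i. x \<in> S' \<Longrightarrow> i \<le> k \<Longrightarrow> frechet_derivative \<Phi> (at x) v \<bullet> B i = g x * (\<theta> i x \<bullet> v)"
proof -
  obtain g X where g: "smooth_on S g" "\<And>x. x \<in> S \<Longrightarrow> g x > (0::real)"
    and X: "\<And>m. m \<le> k \<Longrightarrow> smooth_on S (X m)"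
    "\<And>x m. x \<in> S \<Longrightarrow> m \<le> k \<Longrightarrow> (X m has_derivative (\<lambda>v. g x * (\<theta> m x \<bullet> v))) (at x)"
    using coordinates[OF assms(1)] x0 by blast
  define \<Phi> where "\<Phi> x = (\<Sum>m\<le>k. X m x *\<^sub>R B m)" for x
  define \<Phi>' where "\<Phi>' x v = (\<Sum>m\<le>k. (g x * (\<theta> m x \<bullet> v)) *\<^sub>R B m)" for x v
  define N where "N x w = (\<Sum>m\<le>k. (w \<bullet> B m / g x) *\<^sub>R e m x)" for x w
  have BB: "B i \<bullet> B j = (if i = j then 1 else 0)" if "i \<le> k" "j \<le> k" for i j
    by (rule inner_enumerated_Basis[OF B that])
  have Brep: "(\<Sum>m\<le>k. (w \<bullet> B m) *\<^sub>R B m) = w" for w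
    using sum.reindex_bij_betw[OF B, of "\<lambda>b. (w \<bullet> b) *\<^sub>R b"] by (simp add: euclidean_representation)
  have der: "(\<Phi> has_derivative \<Phi>' x) (at x)" if "x \<in> S" for x
    unfolding \<Phi>_def [abs_def] \<Phi>'_def [abs_def]
    by (intro has_derivative_sum has_derivative_scaleR_left X(2)[OF that]) auto
  then have fd: "frechet_derivative \<Phi> (at x) = \<Phi>' x" if "x \<in> S" for x
    using frechet_derivative_at[OF der[OF that]] by simp
  have sm\<Phi>: "smooth_on S \<Phi>"
    unfolding \<Phi>_def [abs_def] by (intro smooth_on_sum smooth_on_scaleR smooth_on_const S X(1)) auto
  have \<Phi>'B: "\<Phi>' x v \<bullet> B i = g x * (\<theta> i x \<bullet> v)" if "i \<le> k" for x v i
  proof -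
    have "\<Phi>' x v \<bullet> B i = (\<Sum>m\<le>k. if i = m then g x * (\<theta> m x \<bullet> v) else 0)"
      unfolding \<Phi>'_def inner_sum_left by (rule sum.cong) (use BB that in auto)
    then show ?thesis using that by simp
  qed
  have left: "N x (\<Phi>' x v) = v" if x: "x \<in> S" for x v
  proof -
    have "N x (\<Phi>' x v) = (\<Sum>m\<le>k. (\<theta> m x \<bullet> v) *\<^sub>R e m x)"
      unfolding N_def by (rule sum.cong) (use \<Phi>'B g(2)[OF x] in auto)
    then show ?thesis using expand[OF x] by simp
  qed
  have right: "\<Phi>' x (N x w) = w" if x: "x \<in> S" for x w
  proof -
    have "\<theta> m x \<bullet> N x w = w \<bullet> B m / g x" if "m \<le> k" for m
    proof -
      have "\<theta> m x \<bullet> N x w = (\<Sum>i\<le>k. if m = i then w \<bullet> B i / g x else 0)"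
        unfolding N_def inner_sum_right by (rule sum.cong) (use dual[OF x] that in auto)
      then show ?thesis using that by simp
    qed
    then have "\<Phi>' x (N x w) = (\<Sum>m\<le>k. (w \<bullet> B m) *\<^sub>R B m)"
      unfolding \<Phi>'_def by (intro sum.cong) (use g(2)[OF x] in auto)
    then show ?thesis by (simp add: Brep)
  qed
  have bl: "bounded_linear (\<Phi>' x)" if "x \<in> S" for x using has_derivative_bounded_linear[OF der[OF that]] .
  have linN: "bounded_linear (N x)" for x
    unfolding N_def [abs_def]
    by (intro bounded_linear_sum bounded_linear_scaleR_const bounded_linear_divide[THEN bounded_linear_compose] bounded_linear_inner_left)
  have app: "blinfun_apply (Blinfun (\<Phi>' x)) = \<Phi>' x" if "x \<in> S" for x
    by (rule bounded_linear_Blinfun_apply[OF bl[OF that]])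
  \<comment> \<open>The inverse function theorem asks for a derivative continuous in operator norm;
    in finite dimension this may be checked on basis vectors.\<close>
  have "continuous_on S (\<lambda>x. Blinfun (\<Phi>' x))"
  proof (rule continuous_on_blinfun_componentwise)
    fix b :: 'a
    have "continuous_on S (\<lambda>x. frechet_derivative \<Phi> (at x) b)"
      by (rule smooth_on_imp_continuous_on[OF smooth_on_derivative[OF sm\<Phi>]])
    then show "continuous_on S (\<lambda>x. blinfun_apply (Blinfun (\<Phi>' x)) b)"
      by (rule continuous_on_eq) (simp add: fd app)
  qed
  moreover have "Blinfun (N x0) o\<^sub>L Blinfun (\<Phi>' x0) = id_blinfun"
    by (rule blinfun_eqI) (simp add: app x0 bounded_linear_Blinfun_apply[OF linN] left)
  ultimately obtain S' T \<Psi> where inv: "open S'" "S' \<subseteq> S" "x0 \<in> S'" "open T" "homeomorphism S' T \<Phi> \<Psi>"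
    using inverse_function_theorem[OF S, of \<Phi> "\<lambda>x. Blinfun (\<Phi>' x)" x0 "Blinfun (N x0)"] der app x0
    by (metis (no_types, lifting))
  show ?thesis
  proof (rule that[OF inv _ _ g])
    show "smooth_on S' \<Phi>" by (rule smooth_on_subset[OF sm\<Phi> inv(2)])
    show "smooth_on T \<Psi>"
    proof (rule smooth_on_inverse_map[OF inv(1,4) \<open>smooth_on S' \<Phi>\<close>])
      show "continuous_on T \<Psi>" "\<Psi> ` T \<subseteq> S'" "\<And>y. y \<in> T \<Longrightarrow> \<Phi> (\<Psi> y) = y"
        using inv(5) by (auto simp: homeomorphism_def)
      show "N x (frechet_derivative \<Phi> (at x) v) = v" if "x \<in> S'" for x v
        using that inv(2) fd left by auto
      show "frechet_derivative \<Phi> (at x) (N x v) = v" if "x \<in> S'" for x v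
        using that inv(2) fd right by auto
    qed
    show "frechet_derivative \<Phi> (at x) v \<bullet> B i = g x * (\<theta> i x \<bullet> v)" if "x \<in> S'" "i \<le> k" for x v i
      using that inv(2) fd \<Phi>'B by auto
  qed
qed

end

section \<open>Calculus in charts\<close>

text \<open>Product rule for a vector field pushed forward by \<open>\<tau>\<close>. Its first term
  is a second derivative of \<open>\<tau>\<close>, whose symmetry will make the Lie bracket
  independent of the chart.\<close>

lemma has_derivative_derivative_apply:
  fixes \<tau> :: "'a::euclidean_space \<Rightarrow> 'a" and g :: "'a \<Rightarrow> 'a"
  assumes "open S" "smooth_on S \<tau>" "smooth_on S g" "x \<in> S"
  shows "((\<lambda>y. frechet_derivative \<tau> (at y) (g y)) has_derivative
    (\<lambda>u. frechet_derivative (\<lambda>y. frechet_derivative \<tau> (at y) (g x)) (at x) u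
       + frechet_derivative \<tau> (at x) (frechet_derivative g (at x) u))) (at x)"
proof -
  define H where "H w u = frechet_derivative (\<lambda>y. frechet_derivative \<tau> (at y) w) (at x) u" for w u
  have lin: "linear (frechet_derivative \<tau> (at y))" if "y \<in> S" for y
    by (rule smooth_on_imp_linear[OF assms(2) that])
  \<comment> \<open>\<open>H w u\<close> is a derivative in direction \<open>u\<close>, hence linear
    in \<open>u\<close>; symmetry transfers the linearity to \<open>w\<close>.\<close>
  have linH: "linear (\<lambda>w. H w u)" for u
  proof -
    have "H w u = H u w" for w
      unfolding H_def by (rule second_derivative_symmetric[OF assms(1,2,4)])
    moreover have "linear (H u)"
      unfolding H_def by (rule smooth_on_imp_linear[OF smooth_on_derivative[OF assms(2)] assms(4)])
    ultimately show ?thesis by simp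
  qed
  have "((\<lambda>y. \<Sum>b\<in>Basis. (g y \<bullet> b) *\<^sub>R frechet_derivative \<tau> (at y) b) has_derivative
     (\<lambda>u. \<Sum>b\<in>Basis. (g x \<bullet> b) *\<^sub>R H b u + (frechet_derivative g (at x) u \<bullet> b) *\<^sub>R frechet_derivative \<tau> (at x) b)) (at x)"
    unfolding H_def
    by (intro has_derivative_sum has_derivative_scaleR has_derivative_inner_left
        smooth_on_imp_has_derivative[OF assms(3,4)]
        smooth_on_imp_has_derivative[OF smooth_on_derivative[OF assms(2)] assms(4)])
  moreover have "(\<Sum>b\<in>Basis. (g x \<bullet> b) *\<^sub>R H b u + (frechet_derivative g (at x) u \<bullet> b) *\<^sub>R frechet_derivative \<tau> (at x) b)
      = H (g x) u + frechet_derivative \<tau> (at x) (frechet_derivative g (at x) u)" for u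
    unfolding sum.distrib linear_Basis_expansion[OF linH, of "g x" u, symmetric]
      linear_Basis_expansion[OF lin[OF assms(4)], symmetric] ..
  ultimately have "((\<lambda>y. \<Sum>b\<in>Basis. (g y \<bullet> b) *\<^sub>R frechet_derivative \<tau> (at y) b) has_derivative
     (\<lambda>u. H (g x) u + frechet_derivative \<tau> (at x) (frechet_derivative g (at x) u))) (at x)" by simp
  then have "((\<lambda>y. frechet_derivative \<tau> (at y) (g y)) has_derivative
     (\<lambda>u. H (g x) u + frechet_derivative \<tau> (at x) (frechet_derivative g (at x) u))) (at x)"
    by (rule has_derivative_transform_within_open[OF _ assms(1,4)])
      (rule linear_Basis_expansion[OF lin, symmetric])
  then show ?thesis by (simp add: H_def)
qed

lemma chart_inv_left: "is_chart c \<Longrightarrow> q \<in> fst c \<Longrightarrow> chart_inv c (snd c q) = q"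
  by (simp add: is_chart_def homeomorphism_def)

lemma chart_image_cases:
  assumes "is_chart c" "x \<in> chart_image c U"
  obtains q where "q \<in> U" "q \<in> fst c" "x = snd c q" "chart_inv c x = q"
  using assms chart_inv_left by blast

lemma open_chart_image:
  assumes "is_chart c" "open U"
  shows "open (chart_image c U)"
proof -
  have "openin (top_of_set (snd c ` fst c)) (snd c ` (U \<inter> fst c))"
    by (rule homeomorphism_imp_open_map[where g = "chart_inv c"])
      (use assms in \<open>auto simp: is_chart_def openin_open\<close>)
  then show ?thesis using assms(1) by (auto simp: is_chart_def intro: openin_open_trans)
qed

lemma derivative_change_chart:
  fixes f :: "'m::topological_space \<Rightarrow> 'b::real_normed_vector"
    and r d :: "('m, 'e::euclidean_space) chart"
  assumes r: "is_chart r" and d: "is_chart d" and tr: "smooth_transition r d"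
    and q: "q \<in> fst r" "q \<in> fst d"
    and f: "(f \<circ> chart_inv d) differentiable (at (snd d q))"
  shows "((f \<circ> chart_inv r) has_derivative (\<lambda>v. frechet_derivative (f \<circ> chart_inv d) (at (snd d q))
      (frechet_derivative (snd d \<circ> chart_inv r) (at (snd r q)) v))) (at (snd r q))"
proof -
  let ?S = "chart_image r (fst d)"
  have S: "open ?S" by (rule open_chart_image[OF r]) (use d in \<open>simp add: is_chart_def\<close>)
  have x: "snd r q \<in> ?S" using q by auto
  have h: "((snd d \<circ> chart_inv r) has_derivative frechet_derivative (snd d \<circ> chart_inv r) (at (snd r q))) (at (snd r q))"
    using smooth_on_imp_has_derivative[OF _ x] tr by (simp add: smooth_transition_def)
  have "(snd d \<circ> chart_inv r) (snd r q) = snd d q" by (simp add: chart_inv_left[OF r q(1)])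
  then have "((f \<circ> chart_inv d) has_derivative frechet_derivative (f \<circ> chart_inv d) (at (snd d q)))
      (at ((snd d \<circ> chart_inv r) (snd r q)))"
    using f frechet_derivative_works by metis
  from has_derivative_compose[OF h this]
  show ?thesis
  proof (rule has_derivative_transform_within_open[OF _ S x])
    fix y assume "y \<in> ?S"
    then obtain q' where "q' \<in> fst d" "q' \<in> fst r" "y = snd r q'" "chart_inv r y = q'"
      using chart_image_cases[OF r] by blast
    then show "(f \<circ> chart_inv d) ((snd d \<circ> chart_inv r) y) = (f \<circ> chart_inv r) y"
      by (simp add: chart_inv_left[OF d])
  qed
qed

lemma derivative_chart_identity:
  assumes "is_chart c" "q \<in> fst c"
  shows "frechet_derivative (snd c \<circ> chart_inv c) (at (snd c q)) v = v"
proof -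
  have "frechet_derivative (snd c \<circ> chart_inv c) (at (snd c q)) = frechet_derivative (\<lambda>x. x) (at (snd c q))"
    by (rule frechet_derivative_cong_open[of "snd c ` fst c"])
      (use assms in \<open>auto simp: is_chart_def homeomorphism_def\<close>)
  then show ?thesis by (simp add: frechet_derivative_ident)
qed

lemma smooth_fun_change_chart:
  fixes f :: "'m::topological_space \<Rightarrow> real" and c d :: "('m, 'e::euclidean_space) chart"
  assumes c: "is_chart c" and d: "is_chart d" and tr: "smooth_transition c d" and U: "open U"
    and f: "smooth_on (chart_image d U) (f \<circ> chart_inv d)"
  shows "smooth_on (chart_image c (U \<inter> fst d)) (f \<circ> chart_inv c)"
proof -
  have S: "open (chart_image c (U \<inter> fst d))"
    by (rule open_chart_image[OF c]) (use d U in \<open>simp add: is_chart_def open_Int\<close>)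
  have sub: "smooth_on (chart_image c (U \<inter> fst d)) (snd d \<circ> chart_inv c)"
    using tr unfolding smooth_transition_def by (rule smooth_on_subset) auto
  have *: "(snd d \<circ> chart_inv c) x \<in> chart_image d U \<and> chart_inv d (snd d (chart_inv c x)) = chart_inv c x"
    if "x \<in> chart_image c (U \<inter> fst d)" for x
  proof -
    obtain q where "q \<in> U \<inter> fst d" "q \<in> fst c" "x = snd c q" "chart_inv c x = q"
      using chart_image_cases[OF c \<open>x \<in> _\<close>] by blast
    then show ?thesis by (auto simp: chart_inv_left[OF d])
  qed
  have "smooth_on (chart_image c (U \<inter> fst d)) (\<lambda>x. (f \<circ> chart_inv d) ((snd d \<circ> chart_inv c) x))"
    by (rule smooth_on_compose[OF S f sub]) (use * in auto)
  then show ?thesis by (rule smooth_on_eqI[OF S]) (use * in auto)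
qed

section \<open>Tangent vectors, smoothness and brackets in one fixed chart\<close>

locale manifold =
  fixes A :: "('m::{t2_space, second_countable_topology}, 'e::euclidean_space) chart set"
  assumes smooth_manifold: "smooth_manifold A"
begin

lemma atlas_local_coordinates: "c \<in> A \<Longrightarrow> local_coordinates A c"
  using smooth_manifold by (simp add: smooth_manifold_def local_coordinates_def)

lemma atlas_is_chart: "c \<in> A \<Longrightarrow> is_chart c"
  using smooth_manifold by (simp add: smooth_manifold_def)

lemma local_coordinatesD:
  "local_coordinates A c \<Longrightarrow> is_chart c"
  "local_coordinates A c \<Longrightarrow> d \<in> A \<Longrightarrow> smooth_transition c d"
  "local_coordinates A c \<Longrightarrow> d \<in> A \<Longrightarrow> smooth_transition d c"
  by (simp_all add: local_coordinates_def)

lemma open_domain: "local_coordinates A c \<Longrightarrow> open (fst c)"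
  by (simp add: local_coordinates_def is_chart_def)

lemma chart_at: "chart_at A q \<in> A" "q \<in> fst (chart_at A q)"
proof -
  have "(\<Union>c\<in>A. fst c) = UNIV" using smooth_manifold by (simp add: smooth_manifold_def)
  then have "\<exists>c. c \<in> A \<and> q \<in> fst c" by blast
  then have "chart_at A q \<in> A \<and> q \<in> fst (chart_at A q)" unfolding chart_at_def by (rule someI_ex)
  then show "chart_at A q \<in> A" "q \<in> fst (chart_at A q)" by auto
qed

text \<open>The chain rule through the transition map frees \<open>differential\<close> from the
  arbitrary chart \<open>chart_at A q\<close> in which it is defined.\<close>

lemma differential_in_chart:
  fixes f :: "'m \<Rightarrow> 'b::real_normed_vector"
  assumes c: "local_coordinates A c" "q \<in> fst c" and f: "(f \<circ> chart_inv c) differentiable (at (snd c q))"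
  shows "differential A f q v = frechet_derivative (f \<circ> chart_inv c) (at (snd c q)) (components A c q v)"
proof -
  have "frechet_derivative (f \<circ> chart_inv (chart_at A q)) (at (snd (chart_at A q) q)) =
    (\<lambda>v. frechet_derivative (f \<circ> chart_inv c) (at (snd c q)) (frechet_derivative (snd c \<circ> chart_inv (chart_at A q)) (at (snd (chart_at A q) q)) v))"
    by (rule sym, rule frechet_derivative_at, rule derivative_change_chart[OF atlas_is_chart local_coordinatesD(1) local_coordinatesD(3)])
      (use assms chart_at in auto)
  then show ?thesis by (simp add: differential_def)
qed

lemma transition_differentiable:
  assumes "smooth_transition c d" "q \<in> fst c" "q \<in> fst d"
  shows "(snd d \<circ> chart_inv c) differentiable (at (snd c q))"
  by (rule smooth_on_imp_differentiable[of "chart_image c (fst d)"])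
    (use assms in \<open>auto simp: smooth_transition_def\<close>)

lemma components_change_chart:
  assumes "local_coordinates A c" "is_chart d" "smooth_transition c d" "q \<in> fst c" "q \<in> fst d"
  shows "components A d q v = frechet_derivative (snd d \<circ> chart_inv c) (at (snd c q)) (components A c q v)"
  by (rule differential_in_chart[OF assms(1,4) transition_differentiable[OF assms(3-5)]])

lemma components_chart_at: "components A (chart_at A q) q v = v"
  unfolding differential_def by (rule derivative_chart_identity[OF atlas_is_chart]) (rule chart_at)+

text \<open>The inverse of \<open>components A c q\<close>. A tangent vector at \<open>q\<close> is
  by convention its components in \<open>chart_at A q\<close>, so this inverse is the derivative of
  the transition map from \<open>c\<close> to that chart.\<close>

definition lift :: "('m, 'e) chart \<Rightarrow> 'm \<Rightarrow> 'e \<Rightarrow> 'e" where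
  "lift c q = frechet_derivative (snd (chart_at A q) \<circ> chart_inv c) (at (snd c q))"

lemma lift_components:
  assumes "local_coordinates A c" "q \<in> fst c"
  shows "lift c q (components A c q v) = v"
  using components_change_chart[OF assms(1) atlas_is_chart local_coordinatesD(2), of "chart_at A q" q v]
    assms chart_at components_chart_at by (simp add: lift_def)

lemma components_lift:
  assumes "local_coordinates A c" "q \<in> fst c"
  shows "components A c q (lift c q v) = v"
proof -
  let ?r = "chart_at A q"
  have "((snd c \<circ> chart_inv c) has_derivative (\<lambda>v. frechet_derivative (snd c \<circ> chart_inv ?r) (at (snd ?r q))
      (frechet_derivative (snd ?r \<circ> chart_inv c) (at (snd c q)) v))) (at (snd c q))"
    using assms chart_at
    by (intro derivative_change_chart local_coordinatesD atlas_is_chart transition_differentiable) auto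
  from frechet_derivative_at[OF this] derivative_chart_identity[OF local_coordinatesD(1)[OF assms(1)] assms(2), of v]
  show ?thesis by (simp add: lift_def differential_def fun_eq_iff)
qed

lemma linear_components:
  assumes "local_coordinates A c" "q \<in> fst c"
  shows "linear (components A c q)"
  unfolding differential_def
  by (rule linear_frechet_derivative, rule transition_differentiable)
    (use assms chart_at local_coordinatesD in auto)

lemma linear_lift:
  assumes "local_coordinates A c" "q \<in> fst c"
  shows "linear (lift c q)"
  unfolding lift_def
  by (rule linear_frechet_derivative, rule transition_differentiable)
    (use assms chart_at local_coordinatesD in auto)

lemma in_chart_at: "local_coordinates A c \<Longrightarrow> q \<in> fst c \<Longrightarrow> in_chart A c X (snd c q) = components A c q (X q)"
  by (simp add: in_chart_def chart_inv_left local_coordinatesD(1))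

text \<open>Transition maps preserve smoothness, so a single coordinate system covering
  \<open>U\<close> decides it, even one outside \<open>A\<close> such as the flat coordinates of a
  web.\<close>

lemma smooth_fun_iff:
  assumes c: "local_coordinates A c" and U: "open U" "U \<subseteq> fst c"
  shows "smooth_fun A U f \<longleftrightarrow> smooth_on (chart_image c U) (f \<circ> chart_inv c)"
proof
  assume f: "smooth_fun A U f"
  show "smooth_on (chart_image c U) (f \<circ> chart_inv c)"
  proof (rule smooth_on_local)
    fix x assume "x \<in> chart_image c U"
    then obtain q where q: "q \<in> U" "q \<in> fst c" "x = snd c q" by auto
    let ?d = "chart_at A q"
    have "smooth_on (chart_image c (U \<inter> fst ?d)) (f \<circ> chart_inv c)"
      using f chart_at
      by (intro smooth_fun_change_chart local_coordinatesD[OF c] atlas_is_chart U) (auto simp: smooth_fun_def)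
    moreover have "open (chart_image c (U \<inter> fst ?d))"
      by (intro open_chart_image local_coordinatesD[OF c] open_Int U open_domain atlas_local_coordinates chart_at)
    ultimately show "\<exists>T. open T \<and> x \<in> T \<and> smooth_on T (f \<circ> chart_inv c)"
      using q chart_at by blast
  qed
next
  assume f: "smooth_on (chart_image c U) (f \<circ> chart_inv c)"
  show "smooth_fun A U f" unfolding smooth_fun_def
  proof
    fix d assume d: "d \<in> A"
    have "smooth_on (chart_image d (U \<inter> fst c)) (f \<circ> chart_inv d)"
      by (intro smooth_fun_change_chart atlas_is_chart local_coordinatesD[OF c] U f d)
    then show "smooth_on (chart_image d U) (f \<circ> chart_inv d)" using U(2) by (simp add: Int_absorb2)
  qed
qed

lemma smooth_vector_field_change_chart:
  assumes c: "local_coordinates A c" and d: "local_coordinates A d"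
    and tr: "smooth_transition c d" "smooth_transition d c" and U: "open U"
    and X: "smooth_on (chart_image d U) (in_chart A d X)"
  shows "smooth_on (chart_image c (U \<inter> fst d)) (in_chart A c X)"
proof -
  note cc = local_coordinatesD(1)[OF c] and dd = local_coordinatesD(1)[OF d]
  let ?S = "chart_image c (U \<inter> fst d)"
  have S: "open ?S" by (intro open_chart_image cc open_Int U open_domain[OF d])
  have sub: "smooth_on ?S (snd d \<circ> chart_inv c)"
    using tr(1) unfolding smooth_transition_def by (rule smooth_on_subset) auto
  have *: "(snd d \<circ> chart_inv c) x \<in> chart_image d U \<and> (snd d \<circ> chart_inv c) x \<in> chart_image d (fst c) \<and>
      in_chart A c X x = frechet_derivative (snd c \<circ> chart_inv d) (at ((snd d \<circ> chart_inv c) x)) (in_chart A d X ((snd d \<circ> chart_inv c) x))"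
    if x: "x \<in> ?S" for x
  proof -
    obtain q where "q \<in> U \<inter> fst d" "q \<in> fst c" "x = snd c q" "chart_inv c x = q"
      using chart_image_cases[OF cc x] by blast
    then show ?thesis
      using components_change_chart[OF d cc tr(2), of q "X q"] by (auto simp: in_chart_at[OF c] in_chart_at[OF d])
  qed
  have "smooth_on ?S (\<lambda>x. in_chart A d X ((snd d \<circ> chart_inv c) x))"
    by (rule smooth_on_compose[OF S X sub]) (use * in auto)
  from smooth_on_derivative_apply[OF S _ sub _ this, of "chart_image d (fst c)" "snd c \<circ> chart_inv d"]
  have "smooth_on ?S (\<lambda>x. frechet_derivative (snd c \<circ> chart_inv d) (at ((snd d \<circ> chart_inv c) x)) (in_chart A d X ((snd d \<circ> chart_inv c) x)))"
    using tr(2) * unfolding smooth_transition_def by blast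
  then show ?thesis by (rule smooth_on_eqI[OF S]) (use * in auto)
qed

lemma smooth_vector_field_iff:
  assumes c: "local_coordinates A c" and U: "open U" "U \<subseteq> fst c"
  shows "smooth_vector_field A U X \<longleftrightarrow> smooth_on (chart_image c U) (in_chart A c X)"
proof
  assume X: "smooth_vector_field A U X"
  show "smooth_on (chart_image c U) (in_chart A c X)"
  proof (rule smooth_on_local)
    fix x assume "x \<in> chart_image c U"
    then obtain q where q: "q \<in> U" "q \<in> fst c" "x = snd c q" by auto
    let ?d = "chart_at A q"
    have "smooth_on (chart_image c (U \<inter> fst ?d)) (in_chart A c X)"
      using X chart_at
      by (intro smooth_vector_field_change_chart local_coordinatesD[OF c] c atlas_local_coordinates U)
        (auto simp: smooth_vector_field_def)
    moreover have "open (chart_image c (U \<inter> fst ?d))"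
      by (intro open_chart_image local_coordinatesD[OF c] open_Int U open_domain atlas_local_coordinates chart_at)
    ultimately show "\<exists>T. open T \<and> x \<in> T \<and> smooth_on T (in_chart A c X)"
      using q chart_at by blast
  qed
next
  assume X: "smooth_on (chart_image c U) (in_chart A c X)"
  show "smooth_vector_field A U X" unfolding smooth_vector_field_def
  proof
    fix d assume d: "d \<in> A"
    have "smooth_on (chart_image d (U \<inter> fst c)) (in_chart A d X)"
      by (intro smooth_vector_field_change_chart atlas_local_coordinates local_coordinatesD[OF c] c U X d)
    then show "smooth_on (chart_image d U) (in_chart A d X)" using U(2) by (simp add: Int_absorb2)
  qed
qed

lemma smooth_fun_subset: "smooth_fun A U f \<Longrightarrow> W \<subseteq> U \<Longrightarrow> smooth_fun A W f"
  unfolding smooth_fun_def by (blast intro: smooth_on_subset)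

lemma smooth_vector_field_subset: "smooth_vector_field A U X \<Longrightarrow> W \<subseteq> U \<Longrightarrow> smooth_vector_field A W X"
  unfolding smooth_vector_field_def by (blast intro: smooth_on_subset)

text \<open>\<open>lie_bracket\<close> is computed in \<open>chart_at A p\<close>. In
  \<open>c\<close> each of its two derivatives acquires a second derivative of the transition map,
  on \<open>X p\<close> and \<open>Y p\<close> in opposite orders; by symmetry these cancel in the
  difference.\<close>

lemma lie_bracket_in_chart:
  assumes c: "local_coordinates A c" and p: "p \<in> fst c" "p \<in> U" and U: "open U"
    and X: "smooth_vector_field A U X" and Y: "smooth_vector_field A U Y"
  shows "components A c p (lie_bracket A X Y p) =
    frechet_derivative (in_chart A c Y) (at (snd c p)) (in_chart A c X (snd c p)) -
    frechet_derivative (in_chart A c X) (at (snd c p)) (in_chart A c Y (snd c p))"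
proof -
  define r where "r = chart_at A p"
  have rA: "r \<in> A" "p \<in> fst r" using chart_at by (auto simp: r_def)
  have r: "local_coordinates A r" by (rule atlas_local_coordinates[OF rA(1)])
  define W where "W = U \<inter> fst c"
  have W: "open W" "W \<subseteq> fst c" "W \<subseteq> U" "p \<in> W" using U p open_domain[OF c] by (auto simp: W_def)
  define R where "R = chart_image r W"
  have R: "open R" unfolding R_def by (rule open_chart_image[OF local_coordinatesD(1)[OF r] W(1)])
  have x: "snd r p \<in> R" using W(4) rA(2) by (auto simp: R_def)
  define \<tau> where "\<tau> = snd c \<circ> chart_inv r"
  have sm\<tau>: "smooth_on R \<tau>" unfolding \<tau>_def R_def
    using local_coordinatesD(3)[OF c rA(1)] unfolding smooth_transition_def
    by (rule smooth_on_subset) (use W in auto)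
  have \<tau>x: "\<tau> (snd r p) = snd c p"
    using chart_inv_left[OF local_coordinatesD(1)[OF r] rA(2)] by (simp add: \<tau>_def)
  \<comment> \<open>Differentiates the transformation rule for components: those in
    \<open>c\<close>, taken at \<open>\<tau> y\<close>, are the derivative of \<open>\<tau>\<close>
    at \<open>y\<close> applied to those in \<open>r\<close>.\<close>
  have main: "frechet_derivative (in_chart A c Z) (at (snd c p)) (frechet_derivative \<tau> (at (snd r p)) u) =
      frechet_derivative (\<lambda>y. frechet_derivative \<tau> (at y) (Z p)) (at (snd r p)) u
       + frechet_derivative \<tau> (at (snd r p)) (frechet_derivative (in_chart A r Z) (at (snd r p)) u)"
    if Z: "smooth_vector_field A U Z" for Z u
  proof -
    have smr: "smooth_on R (in_chart A r Z)"
      using smooth_vector_field_subset[OF Z W(3)] rA(1) unfolding smooth_vector_field_def R_def by blast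
    have smc: "smooth_on (chart_image c W) (in_chart A c Z)"
      using smooth_vector_field_subset[OF Z W(3)] smooth_vector_field_iff[OF c W(1,2)] by blast
    have "\<tau> (snd r p) \<in> chart_image c W" unfolding \<tau>x using W p by auto
    from has_derivative_compose[OF smooth_on_imp_has_derivative[OF sm\<tau> x] smooth_on_imp_has_derivative[OF smc this]]
    have "((\<lambda>y. in_chart A c Z (\<tau> y)) has_derivative
       (\<lambda>u. frechet_derivative (in_chart A c Z) (at (snd c p)) (frechet_derivative \<tau> (at (snd r p)) u))) (at (snd r p))"
      by (simp add: \<tau>x)
    moreover have "((\<lambda>y. in_chart A c Z (\<tau> y)) has_derivative
       (\<lambda>u. frechet_derivative (\<lambda>y. frechet_derivative \<tau> (at y) (in_chart A r Z (snd r p))) (at (snd r p)) u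
       + frechet_derivative \<tau> (at (snd r p)) (frechet_derivative (in_chart A r Z) (at (snd r p)) u))) (at (snd r p))"
    proof (rule has_derivative_transform_within_open[OF has_derivative_derivative_apply[OF R sm\<tau> smr x] R x])
      fix y assume "y \<in> R"
      then obtain q where q: "q \<in> W" "q \<in> fst r" "y = snd r q" "chart_inv r y = q"
        using chart_image_cases[OF local_coordinatesD(1)[OF r]] unfolding R_def by metis
      then show "frechet_derivative \<tau> (at y) (in_chart A r Z y) = in_chart A c Z (\<tau> y)"
        using components_change_chart[OF r local_coordinatesD(1)[OF c] local_coordinatesD(3)[OF c rA(1)], of q "Z q"] W(2)
        by (auto simp: \<tau>_def in_chart_at[OF c] in_chart_at[OF r])
    qed
    ultimately have "(\<lambda>u. frechet_derivative (in_chart A c Z) (at (snd c p)) (frechet_derivative \<tau> (at (snd r p)) u)) =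
       (\<lambda>u. frechet_derivative (\<lambda>y. frechet_derivative \<tau> (at y) (in_chart A r Z (snd r p))) (at (snd r p)) u
       + frechet_derivative \<tau> (at (snd r p)) (frechet_derivative (in_chart A r Z) (at (snd r p)) u))"
      by (rule has_derivative_unique)
    moreover have "in_chart A r Z (snd r p) = Z p"
      unfolding in_chart_at[OF r rA(2)] unfolding r_def by (rule components_chart_at)
    ultimately show ?thesis by (simp add: fun_eq_iff)
  qed
  have comp: "components A c p v = frechet_derivative \<tau> (at (snd r p)) v" for v
    by (simp add: differential_def r_def \<tau>_def)
  have sym: "frechet_derivative (\<lambda>y. frechet_derivative \<tau> (at y) (X p)) (at (snd r p)) (Y p) =
      frechet_derivative (\<lambda>y. frechet_derivative \<tau> (at y) (Y p)) (at (snd r p)) (X p)"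
    by (rule second_derivative_symmetric[OF R sm\<tau> x])
  have "components A c p (lie_bracket A X Y p) =
      frechet_derivative \<tau> (at (snd r p)) (frechet_derivative (in_chart A r Y) (at (snd r p)) (X p)) -
      frechet_derivative \<tau> (at (snd r p)) (frechet_derivative (in_chart A r X) (at (snd r p)) (Y p))"
    unfolding comp lie_bracket_def r_def[symmetric]
    by (rule linear_diff[OF smooth_on_imp_linear[OF sm\<tau> x]])
  also have "\<dots> = frechet_derivative (in_chart A c Y) (at (snd c p)) (frechet_derivative \<tau> (at (snd r p)) (X p))
      - frechet_derivative (in_chart A c X) (at (snd c p)) (frechet_derivative \<tau> (at (snd r p)) (Y p))"
    unfolding main[OF X] main[OF Y] sym by simp
  finally show ?thesis by (simp add: in_chart_at[OF c p(1)] comp)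
qed

lemma local_coordinates_compose:
  assumes c: "local_coordinates A c" and S: "open S" "S \<subseteq> snd c ` fst c" and T: "open T"
    and hom: "homeomorphism S T \<Phi> \<Psi>" and sm: "smooth_on S \<Phi>" "smooth_on T \<Psi>"
  shows "local_coordinates A (chart_inv c ` S, \<Phi> \<circ> snd c)"
    and "q \<in> chart_inv c ` S \<Longrightarrow> components A (chart_inv c ` S, \<Phi> \<circ> snd c) q v =
           frechet_derivative \<Phi> (at (snd c q)) (components A c q v)"
proof -
  define c' where "c' = (chart_inv c ` S, \<Phi> \<circ> snd c)"
  note cc = local_coordinatesD(1)[OF c]
  have homc: "homeomorphism (fst c) (snd c ` fst c) (snd c) (chart_inv c)"
    using cc by (simp add: is_chart_def)
  have homS: "homeomorphism (chart_inv c ` S) S (snd c) (chart_inv c)"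
  proof (rule homeomorphism_of_subsets[OF homc _ S(2)])
    show "chart_inv c ` S \<subseteq> fst c"
      using image_mono[OF S(2), of "chart_inv c"] homeomorphism_image2[OF homc] by simp
    have "snd c (chart_inv c y) = y" if "y \<in> S" for y
      using homeomorphism_apply2[OF homc] that S(2) by (meson subsetD)
    then show "snd c ` chart_inv c ` S = S" by (simp add: image_image)
  qed
  have hom': "homeomorphism (chart_inv c ` S) T (\<Phi> \<circ> snd c) (chart_inv c \<circ> \<Psi>)"
    by (rule homeomorphism_compose[OF homS hom])
  \<comment> \<open>\<open>chart_inv\<close> is an \<open>inv_into\<close> and is controlled only on
    the image of the chart, so it is compared with the composite inverse on \<open>T\<close>
    alone.\<close>
  have inv': "chart_inv c' y = chart_inv c (\<Psi> y)" if "y \<in> T" for y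
    unfolding c'_def fst_conv snd_conv
  proof (rule inv_into_f_eq)
    show "inj_on (\<Phi> \<circ> snd c) (chart_inv c ` S)"
      by (rule inj_on_inverseI[of _ "chart_inv c \<circ> \<Psi>"]) (rule homeomorphism_apply1[OF hom'])
    show "chart_inv c (\<Psi> y) \<in> chart_inv c ` S" using hom that by (auto simp: homeomorphism_def)
    show "(\<Phi> \<circ> snd c) (chart_inv c (\<Psi> y)) = y" using hom' that by (simp add: homeomorphism_def)
  qed
  have fst': "fst c' \<subseteq> fst c" using S(2) homc by (auto simp: c'_def homeomorphism_def)
  have sndS: "snd c q \<in> S" if "q \<in> fst c'" for q
    using homS that by (auto simp: c'_def homeomorphism_def)
  have op: "open (fst c')"
  proof -
    have "openin (top_of_set (fst c)) (chart_inv c ` S)"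
      by (rule homeomorphism_imp_open_map[OF homeomorphism_symD[OF homc]]) (intro open_subset S)
    then show ?thesis using open_domain[OF c] by (auto simp: c'_def intro: openin_open_trans)
  qed
  have im: "snd c' ` fst c' = T" using hom' by (simp add: c'_def homeomorphism_def)
  have c': "is_chart c'"
    unfolding is_chart_def im
  proof (intro conjI op T)
    show "homeomorphism (fst c') T (snd c') (chart_inv c')"
      using homeomorphism_cong[OF hom'] inv' by (auto simp: c'_def)
  qed
  show "local_coordinates A (chart_inv c ` S, \<Phi> \<circ> snd c)"
    unfolding c'_def[symmetric] local_coordinates_def
  proof (intro conjI ballI c')
    fix d assume d: "d \<in> A"
    note dd = atlas_is_chart[OF d]
    have opd: "open (fst d)" by (rule open_domain[OF atlas_local_coordinates[OF d]])
    show "smooth_transition c' d" unfolding smooth_transition_def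
    proof (rule smooth_on_eqI)
      show "open (chart_image c' (fst d))" by (rule open_chart_image[OF c' opd])
      have sub: "chart_image c' (fst d) \<subseteq> T" using im by auto
      show "smooth_on (chart_image c' (fst d)) (\<lambda>y. (snd d \<circ> chart_inv c) (\<Psi> y))"
      proof (rule smooth_on_compose[OF open_chart_image[OF c' opd] _ smooth_on_subset[OF sm(2) sub]])
        show "smooth_on (chart_image c (fst d)) (snd d \<circ> chart_inv c)"
          using local_coordinatesD(2)[OF c d] by (simp add: smooth_transition_def)
        show "\<Psi> ` chart_image c' (fst d) \<subseteq> chart_image c (fst d)"
        proof safe
          fix q assume q: "q \<in> fst d" "q \<in> fst c'"
          have "\<Psi> (snd c' q) = snd c q" using sndS[OF q(2)] hom by (simp add: c'_def homeomorphism_def)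
          then show "\<Psi> (snd c' q) \<in> chart_image c (fst d)" using q fst' by auto
        qed
      qed
      show "(snd d \<circ> chart_inv c') y = (snd d \<circ> chart_inv c) (\<Psi> y)" if "y \<in> chart_image c' (fst d)" for y
        using inv' sub that by auto
    qed
    show "smooth_transition d c'" unfolding smooth_transition_def
    proof (rule smooth_on_eqI)
      show op': "open (chart_image d (fst c'))" by (rule open_chart_image[OF dd op])
      show "smooth_on (chart_image d (fst c')) (\<lambda>y. \<Phi> ((snd c \<circ> chart_inv d) y))"
      proof (rule smooth_on_compose[OF op' sm(1)])
        show "smooth_on (chart_image d (fst c')) (snd c \<circ> chart_inv d)"
          using local_coordinatesD(3)[OF c d] unfolding smooth_transition_def
          by (rule smooth_on_subset) (use fst' in auto)
        show "(snd c \<circ> chart_inv d) ` chart_image d (fst c') \<subseteq> S"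
          using sndS by (auto simp: chart_inv_left[OF dd])
      qed
    qed (simp add: c'_def)
  qed
  show "components A (chart_inv c ` S, \<Phi> \<circ> snd c) q v =
           frechet_derivative \<Phi> (at (snd c q)) (components A c q v)" if q: "q \<in> chart_inv c ` S"
  proof -
    have q': "q \<in> fst c" "snd c q \<in> S" using q fst' sndS by (auto simp: c'_def)
    have eq: "((\<Phi> \<circ> snd c) \<circ> chart_inv c) y = \<Phi> y" if "y \<in> S" for y
      using homS that by (simp add: homeomorphism_def)
    have "((\<Phi> \<circ> snd c) \<circ> chart_inv c) differentiable (at (snd c q))"
      using differentiable_cong_open[OF S(1) q'(2), of "(\<Phi> \<circ> snd c) \<circ> chart_inv c" \<Phi>] eq
        smooth_on_imp_differentiable[OF sm(1) q'(2)] by blast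
    from differential_in_chart[OF c q'(1) this]
      frechet_derivative_cong_open[OF S(1) q'(2), of "(\<Phi> \<circ> snd c) \<circ> chart_inv c" \<Phi>] eq
    show ?thesis by simp
  qed
qed

end

section \<open>Polynomial curves and the Veronese frame\<close>

text \<open>Coefficients of the derivative in t. The top one is set to 0 so that the result is again
  a \<open>poly_curve k\<close> and the operation can be iterated.\<close>

definition poly_curve_deriv :: "nat \<Rightarrow> (nat \<Rightarrow> 'v::real_vector) \<Rightarrow> nat \<Rightarrow> 'v" where
  "poly_curve_deriv k b i = (if i < k then real (Suc i) *\<^sub>R b (Suc i) else 0)"

lemma poly_curve_has_vector_derivative:
  "(poly_curve k b has_vector_derivative poly_curve k (poly_curve_deriv k b) t) (at t)"
proof -
  have "poly_curve k (poly_curve_deriv k b) t = (\<Sum>i<k. t ^ i *\<^sub>R (real (Suc i) *\<^sub>R b (Suc i)))"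
    unfolding poly_curve_def by (simp add: lessThan_Suc_atMost[symmetric] poly_curve_deriv_def)
  also have "\<dots> = (\<Sum>i\<le>k. (real i * t ^ (i - 1)) *\<^sub>R b i)"
    by (simp add: sum.atMost_shift mult.commute)
  finally have eq: "poly_curve k (poly_curve_deriv k b) t = (\<Sum>i\<le>k. (real i * t ^ (i - 1)) *\<^sub>R b i)" .
  show ?thesis
    unfolding eq unfolding poly_curve_def [abs_def] has_vector_derivative_def
    by (auto intro!: derivative_eq_intros simp: scaleR_sum_right mult_ac)
qed

lemma nth_derivative_Suc: "nth_derivative (Suc j) c t = vector_derivative (nth_derivative j c) (at t)"
  by (simp add: nth_derivative_def)

lemma nth_derivative_poly_curve:
  "nth_derivative j (poly_curve k b) = poly_curve k ((poly_curve_deriv k ^^ j) b)"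
proof (induction j)
  case 0
  then show ?case by (simp add: nth_derivative_def)
next
  case (Suc j)
  then show ?case
    using vector_derivative_at[OF poly_curve_has_vector_derivative] by (auto simp: nth_derivative_Suc)
qed

lemma linear_poly_curve: "linear h \<Longrightarrow> h (poly_curve k b t) = poly_curve k (\<lambda>i. h (b i)) t"
  by (simp add: poly_curve_def linear_sum linear_scale)

lemma linear_poly_curve_deriv: "linear h \<Longrightarrow> h (poly_curve_deriv k b i) = poly_curve_deriv k (\<lambda>i. h (b i)) i"
  by (simp add: poly_curve_deriv_def linear_scale linear_0)

text \<open>Differentiation acts on the coefficients of the curve, so it commutes with a linear
  \<open>h\<close> by pure algebra.\<close>

lemma linear_nth_derivative:
  assumes "linear h"
  shows "h (nth_derivative j (poly_curve k b) t) = nth_derivative j (poly_curve k (\<lambda>i. h (b i))) t"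
proof -
  have "h ((poly_curve_deriv k ^^ j) b i) = (poly_curve_deriv k ^^ j) (\<lambda>i. h (b i)) i" for i
  proof (induction j arbitrary: i)
    case (Suc j)
    then show ?case by (simp add: linear_poly_curve_deriv[OF assms])
  qed simp
  then show ?thesis by (simp add: nth_derivative_poly_curve linear_poly_curve[OF assms])
qed

text \<open>Only the surviving power matters: for \<open>j < k\<close> the derivative vanishes at
  \<open>s = t\<close> whatever \<open>c\<close> is, and these are the conditions that define the
  dual curve.\<close>

lemma nth_derivative_power:
  "j \<le> k \<Longrightarrow> \<exists>c. nth_derivative j (\<lambda>s. (s - t) ^ k) = (\<lambda>s::real. c * (s - t) ^ (k - j))"
proof (induction j)
  case 0
  show ?case by (rule exI[of _ 1]) (simp add: nth_derivative_def)
next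
  case (Suc j)
  then obtain c where c: "nth_derivative j (\<lambda>s. (s - t) ^ k) = (\<lambda>s::real. c * (s - t) ^ (k - j))" by auto
  have "((\<lambda>s. c * (s - t) ^ (k - j)) has_real_derivative c * real (k - j) * (s - t) ^ (k - Suc j)) (at s)" for s
    by (auto intro!: derivative_eq_intros)
  then have "vector_derivative (\<lambda>s. c * (s - t) ^ (k - j)) (at s) = c * real (k - j) * (s - t) ^ (k - Suc j)" for s
    unfolding has_real_derivative_iff_has_vector_derivative by (rule vector_derivative_at)
  then show ?case by (intro exI[of _ "c * real (k - j)"]) (simp add: fun_eq_iff nth_derivative_Suc c)
qed

text \<open>If \<open>b\<close> is the frame dual to \<open>\<omega>\<close>, then \<open>veronese k b\<close> is the frame \<open>V\<close> with
  \<open>\<omega>(s)(V(t)) = (s - t)\<^sup>k\<close>.\<close>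

definition veronese :: "nat \<Rightarrow> (nat \<Rightarrow> 'v::real_vector) \<Rightarrow> nat \<Rightarrow> 'v" where
  "veronese k b j = ((- 1) ^ j * real (k choose j)) *\<^sub>R b (k - j)"

lemma veronese_reverse: "j \<le> k \<Longrightarrow> b j = ((- 1) ^ (k - j) / real (k choose j)) *\<^sub>R veronese k b (k - j)"
  by (simp add: veronese_def binomial_symmetric[symmetric] power_mult_distrib[symmetric])

lemma poly_curve_veronese:
  "poly_curve k (veronese k b) t = (\<Sum>i\<le>k. (real (k choose i) * (- t) ^ (k - i)) *\<^sub>R b i)"
  unfolding poly_curve_def
  by (rule sum.reindex_bij_witness[of _ "\<lambda>i. k - i" "\<lambda>i. k - i"])
    (auto simp: veronese_def binomial_symmetric[symmetric] power_minus[of t] mult_ac)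

text \<open>The binomial theorem: \<open>\<omega> i\<close> reads the coefficient
  \<open>(k choose i) (- t)^(k - i)\<close> off V(t).\<close>

lemma veronese_pairing:
  assumes lin: "\<And>i. i \<le> k \<Longrightarrow> linear (\<omega> i)"
    and dual: "\<And>i j. i \<le> k \<Longrightarrow> j \<le> k \<Longrightarrow> \<omega> i (b j) = (if i = j then 1 else 0 :: real)"
  shows "poly_curve k (\<lambda>i. \<omega> i (poly_curve k (veronese k b) t)) s = (s - t) ^ k"
proof -
  have "\<omega> i (poly_curve k (veronese k b) t) = real (k choose i) * (- t) ^ (k - i)" if i: "i \<le> k" for i
  proof -
    have "\<omega> i (poly_curve k (veronese k b) t) = (\<Sum>j\<le>k. if i = j then real (k choose j) * (- t) ^ (k - j) else 0)"
      unfolding poly_curve_veronese linear_sum[OF lin[OF i]]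
      by (rule sum.cong) (use dual i in \<open>auto simp: linear_scale[OF lin[OF i]]\<close>)
    then show ?thesis using i by simp
  qed
  then have "poly_curve k (\<lambda>i. \<omega> i (poly_curve k (veronese k b) t)) s =
      (\<Sum>i\<le>k. real (k choose i) * s ^ i * (- t) ^ (k - i))"
    unfolding poly_curve_def by (intro sum.cong) auto
  also have "\<dots> = (s + - t) ^ k" by (rule binomial_ring[symmetric])
  finally show ?thesis by simp
qed

lemma veronese_pairing_derivative:
  assumes "linear h" "\<And>s. h (poly_curve k V s) = (t - s) ^ k"
  shows "h (nth_derivative 1 (poly_curve k V) s) = - (real k * (t - s) ^ (k - 1))"
proof -
  have "poly_curve k (\<lambda>i. h (V i)) = (\<lambda>s. (t - s) ^ k)"
    using assms(2) by (simp add: fun_eq_iff linear_poly_curve[OF assms(1), symmetric])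
  moreover have "((\<lambda>s. (t - s) ^ k) has_real_derivative - (real k * (t - s) ^ (k - 1))) (at s)"
    by (auto intro!: derivative_eq_intros)
  ultimately show ?thesis
    unfolding linear_nth_derivative[OF assms(1)]
    by (simp add: nth_derivative_def has_real_derivative_iff_has_vector_derivative vector_derivative_at)
qed

text \<open>\<open>\<psi>\<close> is dual to \<open>V\<close>, so V(t) has coordinates
  \<open>t^j\<close> and V'(t) has \<open>j t^(j - 1)\<close>. Coordinates 0 and 1 of W(t) then give
  the two coefficients as \<open>p 0\<close> and \<open>p 1 - t p 0\<close>, so they are polynomials
  and not mere functions of t; coordinates \<open>k - 1\<close> and \<open>k\<close> bound the
  degree of the second.\<close>

lemma paraconformal_polynomials:
  fixes W V :: "nat \<Rightarrow> 'v::real_normed_vector"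
  assumes k: "k \<ge> 2" and lin: "\<And>j. j \<le> k \<Longrightarrow> linear (\<psi> j)"
    and dual: "\<And>i j. i \<le> k \<Longrightarrow> j \<le> k \<Longrightarrow> \<psi> i (V j) = (if i = j then 1 else 0 :: real)"
    and pc: "\<And>t. poly_curve k W t \<in> span {poly_curve k V t, nth_derivative 1 (poly_curve k V) t}"
  obtains P Q where "degree Q \<le> 2"
    "\<And>t. poly_curve k W t = poly P t *\<^sub>R poly_curve k V t + poly Q t *\<^sub>R nth_derivative 1 (poly_curve k V) t"
    "\<And>t. poly Q t = \<psi> 1 (poly_curve k W t) - t * \<psi> 0 (poly_curve k W t)"
    "Q = 0 \<Longrightarrow> \<exists>a. \<forall>i\<le>k. \<forall>j\<le>k. \<psi> j (W i) = (if i = j then a else 0)"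
proof -
  define p where "p j = (\<Sum>i\<le>k. monom (\<psi> j (W i)) i)" for j
  define P where "P = p 0"
  define Q where "Q = p 1 - [:0, 1:] * P"
  have p: "poly (p j) t = \<psi> j (poly_curve k W t)" if "j \<le> k" for j t
    unfolding linear_poly_curve[OF lin[OF that]] by (simp add: p_def poly_curve_def poly_sum poly_monom mult.commute)
  have deg: "degree (p j) \<le> k" for j
    unfolding p_def by (rule degree_sum_le) (auto intro: order_trans[OF degree_monom_le])
  have coeff: "coeff (p j) i = \<psi> j (W i)" if "i \<le> k" for i j
    using that by (simp add: p_def coeff_sum)
  have \<psi>V: "\<psi> j (poly_curve k V t) = t ^ j" if j: "j \<le> k" for j t
  proof -
    have "\<psi> j (poly_curve k V t) = (\<Sum>i\<le>k. if j = i then t ^ i else 0)"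
      unfolding linear_poly_curve[OF lin[OF j]] unfolding poly_curve_def
      by (rule sum.cong) (use dual j in auto)
    then show ?thesis using j by simp
  qed
  have \<psi>V': "\<psi> j (nth_derivative 1 (poly_curve k V) t) = real j * t ^ (j - 1)" if j: "j \<le> k" for j t
  proof -
    have "(poly_curve k (\<lambda>i. \<psi> j (V i))) = (\<lambda>t. t ^ j)"
      using \<psi>V[OF j] by (simp add: fun_eq_iff linear_poly_curve[OF lin[OF j], symmetric])
    moreover have "((\<lambda>t. t ^ j) has_real_derivative real j * t ^ (j - 1)) (at t)"
      by (auto intro!: derivative_eq_intros)
    ultimately show ?thesis
      unfolding linear_nth_derivative[OF lin[OF j]]
      by (simp add: nth_derivative_def has_real_derivative_iff_has_vector_derivative vector_derivative_at)
  qed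
  have Q: "poly Q t = \<psi> 1 (poly_curve k W t) - t * \<psi> 0 (poly_curve k W t)" for t
    using k by (simp add: Q_def P_def p)
  have W: "poly_curve k W t = poly P t *\<^sub>R poly_curve k V t + poly Q t *\<^sub>R nth_derivative 1 (poly_curve k V) t" for t
  proof -
    obtain \<alpha> \<beta> where ab: "poly_curve k W t = \<alpha> *\<^sub>R poly_curve k V t + \<beta> *\<^sub>R nth_derivative 1 (poly_curve k V) t"
      using pc[of t] by (auto simp: span_insert span_singleton algebra_simps)
    have "\<psi> j (poly_curve k W t) = \<alpha> * t ^ j + \<beta> * (real j * t ^ (j - 1))" if "j \<le> k" for j
      unfolding ab
      by (simp add: linear_add[OF lin[OF that]] linear_scale[OF lin[OF that]] \<psi>V[OF that] \<psi>V'[OF that]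
          del: One_nat_def)
    from this[of 0] this[of 1] have "\<alpha> = poly P t" "\<beta> = poly Q t"
      using k by (simp_all add: Q P_def p)
    then show ?thesis using ab by simp
  qed
  have pj: "poly (p j) t = poly P t * t ^ j + poly Q t * (real j * t ^ (j - 1))" if "j \<le> k" for j t
    unfolding p[OF that] W
    by (simp add: linear_add[OF lin[OF that]] linear_scale[OF lin[OF that]] \<psi>V[OF that] \<psi>V'[OF that]
        del: One_nat_def)
  have "degree Q \<le> 2"
  proof (cases "Q = 0")
    case False
    obtain m where m: "k = Suc (Suc m)" using k by (metis Suc_le_D numeral_2_eq_2 Suc_le_mono)
    \<comment> \<open>The terms with \<open>P\<close> cancel and \<open>k - (k - 1) = 1\<close> copy
      of \<open>t^(k - 1) Q\<close> remains. The left side has degree at most \<open>k + 1\<close>,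
      which leaves at most 2 for \<open>Q\<close>.\<close>
    have "p k - [:0, 1:] * p (k - 1) = monom 1 (k - 1) * Q"
    proof (rule poly_ext)
      show "poly (p k - [:0, 1:] * p (k - 1)) t = poly (monom 1 (k - 1) * Q) t" for t
        using pj[of k t] pj[of "k - 1" t] by (simp add: m poly_monom algebra_simps)
    qed
    moreover have "degree ([:0, 1:] * p (k - 1)) \<le> k + 1"
      using degree_mult_le[of "[:0, 1:]" "p (k - 1)"] deg[of "k - 1"] by simp
    then have "degree (p k - [:0, 1:] * p (k - 1)) \<le> k + 1"
      using deg[of k] by (intro degree_diff_le) auto
    moreover have "degree (monom 1 (k - 1) * Q) = k - 1 + degree Q"
      using False by (simp add: degree_mult_eq degree_monom_eq)
    ultimately show ?thesis using m by simp
  qed simp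
  moreover have "\<exists>a. \<forall>i\<le>k. \<forall>j\<le>k. \<psi> j (W i) = (if i = j then a else 0)" if Q0: "Q = 0"
  proof -
    \<comment> \<open>In particular \<open>p k\<close> is \<open>t^k P\<close> and has degree at
      most \<open>k\<close>, so \<open>P\<close> is constant.\<close>
    have pj': "p j = monom 1 j * P" if "j \<le> k" for j
      by (rule poly_ext) (use pj[OF that] Q0 in \<open>simp add: poly_monom\<close>)
    have "degree P = 0"
    proof (cases "P = 0")
      case False
      then have "degree (p k) = k + degree P" by (simp add: pj' degree_mult_eq degree_monom_eq)
      then show ?thesis using deg[of k] by simp
    qed simp
    then obtain a where a: "P = [:a:]" using degree_eq_zeroE by blast
    have "\<psi> j (W i) = (if i = j then a else 0)" if "i \<le> k" "j \<le> k" for i j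
      using coeff[OF that(1), of j] pj'[OF that(2)] by (simp add: a coeff_monom_mult split: if_splits)
    then show ?thesis by blast
  qed
  ultimately show ?thesis using that W Q by blast
qed

text \<open>In the application, \<open>G v i\<close> is the derivative of the \<open>i\<close>-th frame field in the direction \<open>v\<close>. In
  \<open>tg\<close>, the direction \<open>E\<^sub>i - t\<^sup>i E\<^sub>0\<close> and the field \<open>V(s) - (t - s)\<^sup>k E\<^sub>0\<close> lie in \<open>ker \<omega>(t)\<close>.\<close>

lemma adapted_connection_is_scalar:
  fixes E :: "nat \<Rightarrow> 'v::real_normed_vector" and \<omega> :: "nat \<Rightarrow> 'v \<Rightarrow> real" and G :: "'v \<Rightarrow> nat \<Rightarrow> 'v"
  assumes k: "k > 2" and lin: "\<And>i. i \<le> k \<Longrightarrow> linear (\<omega> i)"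
    and dual: "\<And>i j. i \<le> k \<Longrightarrow> j \<le> k \<Longrightarrow> \<omega> i (E j) = (if i = j then 1 else 0)"
    and expand: "\<And>v. v = (\<Sum>i\<le>k. \<omega> i v *\<^sub>R E i)"
    and linG: "\<And>i. i \<le> k \<Longrightarrow> linear (\<lambda>v. G v i)"
    and pc: "\<And>v t. poly_curve k (veronese k (G v)) t \<in>
      span {poly_curve k (veronese k E) t, nth_derivative 1 (poly_curve k (veronese k E)) t}"
    and tg: "\<And>i s t. i \<le> k \<Longrightarrow> poly_curve k (\<lambda>j. \<omega> j (poly_curve k (veronese k (G (E i - t ^ i *\<^sub>R E 0))) s
       - (t - s) ^ k *\<^sub>R G (E i - t ^ i *\<^sub>R E 0) 0)) t = 0"
    and i: "i \<le> k"
  shows "G v i = \<omega> 0 (G v 0) *\<^sub>R E i"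
proof -
  define V where "V = veronese k E"
  \<comment> \<open>\<open>veronese\<close> reverses the frame and rescales it;
    \<open>\<psi>\<close> reverses and rescales the coframe accordingly, so that it is dual to
    \<open>V\<close>.\<close>
  define \<psi> where "\<psi> j w = \<omega> (k - j) w / ((- 1) ^ j * real (k choose j))" for j w
  have lin\<psi>: "linear (\<psi> j)" if "j \<le> k" for j
    unfolding \<psi>_def using lin[of "k - j"]
    by (intro linearI) (simp_all add: linear_add linear_scale add_divide_distrib)
  have dual\<psi>: "\<psi> i (V j) = (if i = j then 1 else 0)" if "i \<le> k" "j \<le> k" for i j
    using that dual[of "k - i" "k - j"] lin[of "k - i"] by (auto simp: \<psi>_def V_def veronese_def linear_scale)
  \<comment> \<open>The coefficient of V'(t), written through coordinates and not through the choice
    of a polynomial, so that it is visibly linear in \<open>v\<close>.\<close>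
  define \<beta> where "\<beta> v t = \<psi> 1 (poly_curve k (veronese k (G v)) t) - t * \<psi> 0 (poly_curve k (veronese k (G v)) t)" for v t
  have lin\<beta>: "linear (\<lambda>v. \<beta> v t)" for t
  proof -
    have linc: "linear (\<lambda>v. poly_curve k (veronese k (G v)) t)"
      unfolding poly_curve_veronese
      by (intro linear_compose_sum ballI linear_compose_scale_right linG) auto
    have "linear (\<lambda>v. \<psi> j (poly_curve k (veronese k (G v)) t))" if "j \<le> k" for j
      using linear_compose[OF linc lin\<psi>[OF that]] by (simp add: o_def)
    from linear_compose_sub[OF this[of 1] linear_compose_scale_right[OF this[of 0], of t]] show ?thesis
      using k by (simp add: \<beta>_def)
  qed
  have ex: "\<exists>P Q. degree Q \<le> 2 \<and>
    (\<forall>t. poly_curve k (veronese k (G v)) t = poly P t *\<^sub>R poly_curve k V t + poly Q t *\<^sub>R nth_derivative 1 (poly_curve k V) t) \<and>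
    (\<forall>t. poly Q t = \<beta> v t) \<and>
    (Q = 0 \<longrightarrow> (\<exists>a. \<forall>i\<le>k. \<forall>j\<le>k. \<psi> j (veronese k (G v) i) = (if i = j then a else 0)))" for v
  proof -
    have k2: "2 \<le> k" using k by simp
    show ?thesis
    proof (rule paraconformal_polynomials[OF k2 lin\<psi> dual\<psi> pc[of v, folded V_def]])
      fix P Q
      assume *: "degree Q \<le> 2"
        "\<And>t. poly_curve k (veronese k (G v)) t = poly P t *\<^sub>R poly_curve k V t + poly Q t *\<^sub>R nth_derivative 1 (poly_curve k V) t"
        "\<And>t. poly Q t = \<psi> 1 (poly_curve k (veronese k (G v)) t) - t * \<psi> 0 (poly_curve k (veronese k (G v)) t)"
        "Q = 0 \<Longrightarrow> \<exists>a. \<forall>i\<le>k. \<forall>j\<le>k. \<psi> j (veronese k (G v) i) = (if i = j then a else 0)"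
      show ?thesis
        unfolding \<beta>_def by (rule exI[of _ P], rule exI[of _ Q], intro conjI allI impI) (fact *)+
    qed
  qed
  then obtain P Q where degQ: "\<And>v. degree (Q v) \<le> 2"
    and W: "\<And>v t. poly_curve k (veronese k (G v)) t = poly (P v) t *\<^sub>R poly_curve k V t + poly (Q v) t *\<^sub>R nth_derivative 1 (poly_curve k V) t"
    and Q: "\<And>v t. poly (Q v) t = \<beta> v t"
    and Q0: "\<And>v. Q v = 0 \<Longrightarrow> \<exists>a. \<forall>i\<le>k. \<forall>j\<le>k. \<psi> j (veronese k (G v) i) = (if i = j then a else 0)"
    by metis
  \<comment> \<open>\<open>h\<close> is \<omega>(t), applied to the derivative of V(s) along the
    direction \<open>X\<close> in its kernel. By \<open>tg\<close> the result is
    \<open>(t - s)^k * z\<close>; the paraconformal form of the derivative gives another expression,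
    also divisible by \<open>(t - s)^(k - 1)\<close>.\<close>
  have van: "\<beta> (E i - t ^ i *\<^sub>R E 0) t = 0" if i: "i \<le> k" for i t
  proof -
    define X where "X = E i - t ^ i *\<^sub>R E 0"
    define h where "h w = poly_curve k (\<lambda>j. \<omega> j w) t" for w
    have linh: "linear h"
      unfolding h_def poly_curve_def
      by (intro linear_compose_sum ballI linear_compose_scale_right lin) auto
    have hV: "h (poly_curve k V s) = (t - s) ^ k" for s
      unfolding h_def V_def by (rule veronese_pairing[OF lin dual])
    have hV': "h (nth_derivative 1 (poly_curve k V) s) = - (real k * (t - s) ^ (k - 1))" for s
      by (rule veronese_pairing_derivative[OF linh hV])
    define z where "z = h (G X 0)"
    \<comment> \<open>The difference of the two expressions, as a polynomial in \<open>s\<close>,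
      after division by \<open>(t - s)^(k - 1)\<close>. It vanishes for all
      \<open>s \<noteq> t\<close>, hence identically, and at \<open>s = t\<close> only the multiple
      of \<open>Q X\<close> is left.\<close>
    define R where "R = [:t, -1:] * ([:z:] - P X) + Polynomial.smult (real k) (Q X)"
    have "poly R s = 0" if "s \<noteq> t" for s
    proof -
      have "h (poly_curve k (veronese k (G X)) s) = (t - s) ^ k * z"
        using tg[OF i, of t s] linear_diff[OF linh] linear_scale[OF linh] by (simp add: h_def X_def z_def)
      then have "(t - s) ^ k * z = poly (P X) s * (t - s) ^ k - poly (Q X) s * (real k * (t - s) ^ (k - 1))"
        unfolding W by (simp add: linear_add[OF linh] linear_scale[OF linh] hV hV' del: One_nat_def)
      moreover have "(t - s) ^ k = (t - s) ^ (k - 1) * (t - s)"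
        using k by (simp add: power_eq_if mult.commute)
      ultimately have "(t - s) ^ (k - 1) * ((t - s) * (z - poly (P X) s) + real k * poly (Q X) s) = 0"
        by (simp add: algebra_simps)
      then have "(t - s) * (z - poly (P X) s) + real k * poly (Q X) s = 0" using that by simp
      then show ?thesis by (simp add: R_def algebra_simps)
    qed
    then have "UNIV - {t} \<subseteq> {s. poly R s = 0}" by auto
    moreover have "infinite (UNIV - {t})" by (simp add: infinite_UNIV_char_0)
    ultimately have "R = 0" using poly_roots_finite finite_subset by blast
    moreover have "poly R t = real k * poly (Q X) t" by (simp add: R_def algebra_simps)
    ultimately have "poly (Q X) t = 0" using k by simp
    then show ?thesis by (simp add: Q X_def)
  qed
  \<comment> \<open>By linearity \<open>van\<close> reads \<beta>(E i,t) = \<open>t^i\<close>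
    \<beta>(E 0,t). For \<open>i = k\<close> the degree would be at least \<open>k\<close>, against
    the bound 2, unless \<beta>(E 0,t) is zero.\<close>
  have mult: "Q (E i) = monom 1 i * Q (E 0)" if "i \<le> k" for i
  proof (rule poly_ext)
    show "poly (Q (E i)) t = poly (monom 1 i * Q (E 0)) t" for t
      using van[OF that, of t] linear_diff[OF lin\<beta>[of t]] linear_scale[OF lin\<beta>[of t]] by (simp add: Q poly_monom)
  qed
  have "Q (E 0) = 0"
  proof (rule ccontr)
    assume "Q (E 0) \<noteq> 0"
    then have "degree (Q (E k)) = k + degree (Q (E 0))"
      unfolding mult[OF order_refl] by (simp add: degree_mult_eq degree_monom_eq)
    then show False using degQ[of "E k"] k by simp
  qed
  then have QE: "\<beta> (E i) t = 0" if "i \<le> k" for i t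
    using mult[OF that] by (simp add: Q[symmetric])
  have "\<beta> v t = 0" for v t
    by (subst expand[of v]) (simp add: linear_sum[OF lin\<beta>] linear_scale[OF lin\<beta>] QE)
  then have "Q v = 0" by (intro poly_ext) (simp add: Q)
  then obtain a where a: "\<And>i j. i \<le> k \<Longrightarrow> j \<le> k \<Longrightarrow> \<psi> j (veronese k (G v) i) = (if i = j then a else 0)"
    using Q0 by blast
  have G: "\<omega> j (G v i) = (if i = j then a else 0)" if ij: "i \<le> k" "j \<le> k" for i j
  proof -
    have "\<psi> (k - j) (veronese k (G v) (k - i)) = (if i = j then a else 0)"
      using a[of "k - i" "k - j"] ij by auto
    moreover have "\<psi> (k - j) (veronese k (G v) (k - i)) =
        ((- 1) ^ (k - i) * real (k choose i)) / ((- 1) ^ (k - j) * real (k choose j)) * \<omega> j (G v i)"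
      using ij linear_scale[OF lin[OF ij(2)]] by (simp add: \<psi>_def veronese_def binomial_symmetric[symmetric])
    ultimately show ?thesis using ij by (auto split: if_splits)
  qed
  have "G v i = (\<Sum>j\<le>k. (if i = j then a else 0) *\<^sub>R E j)"
    by (subst expand[of "G v i"], rule sum.cong) (use G i in auto)
  also have "\<dots> = (\<Sum>j\<le>k. if i = j then a *\<^sub>R E j else 0)" by (rule sum.cong) auto
  finally show ?thesis using i G[of 0 0] by simp
qed

section \<open>Vector fields and connections\<close>

lemma is_basis_if_spanning:
  fixes b :: "nat \<Rightarrow> 'e::euclidean_space"
  assumes "DIM('e) = k + 1" "span (b ` {..k}) = UNIV"
  shows "is_basis k b"
proof -
  have "DIM('e) \<le> card (b ` {..k})"
    using dim_le_card[of UNIV "b ` {..k}"] assms(2) by simp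
  moreover have "card (b ` {..k}) \<le> k + 1" using card_image_le[of "{..k}" b] by simp
  ultimately have card: "card (b ` {..k}) = k + 1" using assms(1) by simp
  then have "inj_on b {..k}" by (intro eq_card_imp_inj_on) auto
  moreover have "independent (b ` {..k})"
    by (rule card_le_dim_spanning[of _ UNIV]) (use assms card in auto)
  ultimately show ?thesis using assms(2) by (simp add: is_basis_def)
qed

lemma is_basis_scaleR:
  fixes b :: "nat \<Rightarrow> 'v::real_normed_vector"
  assumes "is_basis k b" "r \<noteq> 0"
  shows "is_basis k (\<lambda>i. r *\<^sub>R b i)"
proof -
  have lin: "linear (\<lambda>x::'v. r *\<^sub>R x)" by (simp add: linear_scaleR)
  have inj: "inj (\<lambda>x::'v. r *\<^sub>R x)" using assms(2) by (auto simp: inj_on_def)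
  have im: "(\<lambda>i. r *\<^sub>R b i) ` {..k} = (\<lambda>x. r *\<^sub>R x) ` (b ` {..k})" by auto
  have "span ((\<lambda>x. r *\<^sub>R x) ` (b ` {..k})) = (\<lambda>x. r *\<^sub>R x) ` UNIV"
    using assms(1) linear_span_image[OF lin] by (simp add: is_basis_def)
  also have "\<dots> = UNIV"
  proof -
    have "y \<in> range (\<lambda>x. r *\<^sub>R x)" for y :: 'v
      by (rule range_eqI[of _ _ "inverse r *\<^sub>R y"]) (use assms(2) in simp)
    then show ?thesis by auto
  qed
  moreover have "independent ((\<lambda>x. r *\<^sub>R x) ` (b ` {..k}))"
    using assms(1) inj
    by (intro linear_independent_injective_image[OF lin]) (auto simp: is_basis_def)
  moreover have "inj_on (\<lambda>i. r *\<^sub>R b i) {..k}" using assms by (auto simp: is_basis_def inj_on_def)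
  ultimately show ?thesis by (simp add: is_basis_def im)
qed

text \<open>The functional "inner product with \<open>v\<close>" is a combination of the
  \<open>\<omega> i\<close>, so it vanishes at \<open>v\<close> itself, that is,
  \<open>v \<bullet> v = 0\<close>.\<close>

lemma coframe_separates:
  fixes \<omega> :: "nat \<Rightarrow> 'e::euclidean_space \<Rightarrow>\<^sub>L real"
  assumes "is_basis k \<omega>" "\<And>i. i \<le> k \<Longrightarrow> blinfun_apply (\<omega> i) v = 0"
  shows "v = 0"
proof -
  have "blinfun_inner_left v \<in> span (\<omega> ` {..k})" using assms(1) by (simp add: is_basis_def)
  then have "blinfun_apply (blinfun_inner_left v) v = 0"
  proof (induction rule: span_induct)
    case base
    show ?case by (rule subspaceI) (auto simp: blinfun.add_left blinfun.scaleR_left)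
  next
    case (step x)
    then show ?case using assms(2) by auto
  qed
  then show ?thesis by simp
qed

lemma coframe_expansion:
  fixes \<omega> :: "nat \<Rightarrow> 'e::euclidean_space \<Rightarrow>\<^sub>L real"
  assumes "is_basis k \<omega>" "\<And>i j. i \<le> k \<Longrightarrow> j \<le> k \<Longrightarrow> blinfun_apply (\<omega> i) (e j) = (if i = j then 1 else 0)"
  shows "v = (\<Sum>i\<le>k. blinfun_apply (\<omega> i) v *\<^sub>R e i)"
proof -
  have "v - (\<Sum>i\<le>k. blinfun_apply (\<omega> i) v *\<^sub>R e i) = 0"
  proof (rule coframe_separates[OF assms(1)])
    fix j assume j: "j \<le> k"
    have "blinfun_apply (\<omega> j) (\<Sum>i\<le>k. blinfun_apply (\<omega> i) v *\<^sub>R e i) = (\<Sum>i\<le>k. if j = i then blinfun_apply (\<omega> i) v else 0)"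
      unfolding blinfun.sum_right by (rule sum.cong) (use assms(2) j in \<open>auto simp: blinfun.scaleR_right\<close>)
    then show "blinfun_apply (\<omega> j) (v - (\<Sum>i\<le>k. blinfun_apply (\<omega> i) v *\<^sub>R e i)) = 0"
      using j by (simp add: blinfun.diff_right)
  qed
  then show ?thesis by simp
qed

text \<open>Packs the coframe into one linear map of the model space. The preimage of
  \<open>B j\<close> is the j-th vector of the dual frame, so inverting this map as the point varies
  produces smooth dual frames.\<close>

lemma coframe_bij:
  fixes \<omega> :: "nat \<Rightarrow> 'e::euclidean_space \<Rightarrow>\<^sub>L real" and B :: "nat \<Rightarrow> 'e"
  assumes "is_basis k \<omega>" and B: "bij_betw B {..k} Basis"
  shows "linear (\<lambda>v. \<Sum>i\<le>k. blinfun_apply (\<omega> i) v *\<^sub>R B i)" "bij (\<lambda>v. \<Sum>i\<le>k. blinfun_apply (\<omega> i) v *\<^sub>R B i)"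
    "(\<Sum>i\<le>k. blinfun_apply (\<omega> i) v *\<^sub>R B i) = w \<Longrightarrow> j \<le> k \<Longrightarrow> blinfun_apply (\<omega> j) v = w \<bullet> B j"
proof -
  let ?M = "\<lambda>v. \<Sum>i\<le>k. blinfun_apply (\<omega> i) v *\<^sub>R B i"
  show lin: "linear ?M"
    by (rule linearI) (simp_all add: blinfun.add_right blinfun.scaleR_right scaleR_add_left sum.distrib scaleR_sum_right)
  have BB: "B i \<bullet> B j = (if i = j then 1 else 0)" if "i \<le> k" "j \<le> k" for i j
    by (rule inner_enumerated_Basis[OF B that])
  have M: "?M v \<bullet> B j = blinfun_apply (\<omega> j) v" if "j \<le> k" for j v
  proof -
    have "?M v \<bullet> B j = (\<Sum>i\<le>k. if j = i then blinfun_apply (\<omega> i) v else 0)"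
      unfolding inner_sum_left by (rule sum.cong) (use BB that in auto)
    then show ?thesis using that by simp
  qed
  have inj: "inj ?M"
    unfolding linear_injective_0[OF lin]
  proof (intro allI impI)
    show "v = 0" if "?M v = 0" for v
      by (rule coframe_separates[OF assms(1)]) (use M[of _ v] that in simp)
  qed
  then show "bij ?M" using linear_injective_imp_surjective[OF lin inj] by (simp add: bij_def)
  show "blinfun_apply (\<omega> j) v = w \<bullet> B j" if "?M v = w" "j \<le> k"
    using M[OF that(2), of v] that(1) by simp
qed

lemma ex_basis_enumeration:
  assumes "DIM('e::euclidean_space) = k + 1"
  shows "\<exists>B. bij_betw B {..k} (Basis :: 'e set)"
  using ex_bij_betw_nat_finite[of "Basis :: 'e set"] assms
  by (simp add: atLeast0LessThan lessThan_Suc_atMost)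

lemma linear_blinfun_apply_left: "linear (\<lambda>w. blinfun_apply w v)"
  by (rule linearI) (simp_all add: blinfun.add_left blinfun.scaleR_left)

lemma linear_blinfun_apply: "linear (blinfun_apply w)"
  by (rule linearI) (simp_all add: blinfun.add_right blinfun.scaleR_right)

lemma blinfun_apply_poly_curve:
  "blinfun_apply (poly_curve k \<omega> t) v = poly_curve k (\<lambda>i. blinfun_apply (\<omega> i) v) t"
  by (rule linear_poly_curve[OF linear_blinfun_apply_left])

lemma web_coframe_subset: "web_coframe A k F U \<omega> \<Longrightarrow> W \<subseteq> U \<Longrightarrow> web_coframe A k F W \<omega>"
  unfolding web_coframe_def smooth_one_form_def by (meson order_trans subsetD)

section \<open>Linear operations on smooth vector fields\<close>

context manifold begin

lemma smooth_fun_const: "open U \<Longrightarrow> smooth_fun A U (\<lambda>_. r)"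
  by (simp add: smooth_fun_def o_def smooth_on_const open_chart_image atlas_is_chart)

lemma smooth_fun_mult: "open U \<Longrightarrow> smooth_fun A U f \<Longrightarrow> smooth_fun A U g \<Longrightarrow> smooth_fun A U (\<lambda>q. f q * g q)"
  unfolding smooth_fun_def
proof
  fix d assume *: "open U" "\<forall>c\<in>A. smooth_on (chart_image c U) (f \<circ> chart_inv c)"
    "\<forall>c\<in>A. smooth_on (chart_image c U) (g \<circ> chart_inv c)" "d \<in> A"
  show "smooth_on (chart_image d U) ((\<lambda>q. f q * g q) \<circ> chart_inv d)"
    using smooth_on_mult[OF open_chart_image[OF atlas_is_chart[OF *(4)] *(1)] bspec[OF *(2,4)] bspec[OF *(3,4)]]
    by (simp add: o_def)
qed

lemma linear_in_chart:
  assumes "d \<in> A" "x \<in> chart_image d U"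
  shows "linear (components A d (chart_inv d x))"
  by (rule chart_image_cases[OF atlas_is_chart[OF assms(1)] assms(2)])
    (auto intro: linear_components atlas_local_coordinates assms(1))

lemma smooth_vector_field_add:
  assumes "open U" "smooth_vector_field A U X" "smooth_vector_field A U Y"
  shows "smooth_vector_field A U (\<lambda>q. X q + Y q)"
  unfolding smooth_vector_field_def
proof
  fix d assume d: "d \<in> A"
  have op: "open (chart_image d U)" by (rule open_chart_image[OF atlas_is_chart[OF d] assms(1)])
  have "smooth_on (chart_image d U) (\<lambda>x. in_chart A d X x + in_chart A d Y x)"
    using assms(2,3) d by (intro smooth_on_add op) (auto simp: smooth_vector_field_def)
  then show "smooth_on (chart_image d U) (in_chart A d (\<lambda>q. X q + Y q))"
    by (rule smooth_on_eqI[OF op]) (simp add: in_chart_def linear_add[OF linear_in_chart[OF d]])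
qed

lemma smooth_vector_field_scaleR:
  assumes "open U" "smooth_fun A U f" "smooth_vector_field A U X"
  shows "smooth_vector_field A U (\<lambda>q. f q *\<^sub>R X q)"
  unfolding smooth_vector_field_def
proof
  fix d assume d: "d \<in> A"
  have op: "open (chart_image d U)" by (rule open_chart_image[OF atlas_is_chart[OF d] assms(1)])
  have "smooth_on (chart_image d U) (\<lambda>x. (f \<circ> chart_inv d) x *\<^sub>R in_chart A d X x)"
    using smooth_on_scaleR[OF op bspec[OF assms(2)[unfolded smooth_fun_def] d]
        bspec[OF assms(3)[unfolded smooth_vector_field_def] d]] .
  then show "smooth_on (chart_image d U) (in_chart A d (\<lambda>q. f q *\<^sub>R X q))"
    by (rule smooth_on_eqI[OF op]) (simp add: in_chart_def linear_scale[OF linear_in_chart[OF d]])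
qed

lemma smooth_vector_field_const_scaleR:
  "open U \<Longrightarrow> smooth_vector_field A U X \<Longrightarrow> smooth_vector_field A U (\<lambda>q. r *\<^sub>R X q)"
  by (rule smooth_vector_field_scaleR[OF _ smooth_fun_const])

lemma smooth_vector_field_zero:
  assumes "open U"
  shows "smooth_vector_field A U (\<lambda>_. 0)"
  unfolding smooth_vector_field_def
proof
  fix d assume d: "d \<in> A"
  have op: "open (chart_image d U)" by (rule open_chart_image[OF atlas_is_chart[OF d] assms(1)])
  show "smooth_on (chart_image d U) (in_chart A d (\<lambda>_. 0))"
    by (rule smooth_on_eqI[OF op smooth_on_const[OF op, of 0]]) (simp add: in_chart_def linear_0[OF linear_in_chart[OF d]])
qed

lemma smooth_vector_field_sum:
  assumes "open U" "\<And>i. i \<in> I \<Longrightarrow> smooth_vector_field A U (X i)"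
  shows "smooth_vector_field A U (\<lambda>q. \<Sum>i\<in>I. X i q)"
  using assms(2)
  by (induction I rule: infinite_finite_induct)
    (auto intro: smooth_vector_field_add smooth_vector_field_zero assms(1))

lemma smooth_vector_field_lift:
  assumes c: "local_coordinates A c" and U: "open U" "U \<subseteq> fst c" and e: "smooth_on (chart_image c U) e"
  shows "smooth_vector_field A U (\<lambda>q. lift c q (e (snd c q)))"
  unfolding smooth_vector_field_iff[OF c U]
proof (rule smooth_on_eqI[OF open_chart_image[OF local_coordinatesD(1)[OF c] U(1)] e])
  fix x assume "x \<in> chart_image c U"
  then obtain q where "q \<in> U" "q \<in> fst c" "x = snd c q" by blast
  then show "in_chart A c (\<lambda>q. lift c q (e (snd c q))) x = e x"
    by (simp add: in_chart_at[OF c] components_lift[OF c])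
qed

end

section \<open>Consequences of the connection axioms\<close>

locale manifold_with_connection = manifold A
  for A :: "('m::{t2_space, second_countable_topology}, 'e::euclidean_space) chart set" +
  fixes D :: "('m, 'e) conn"
  assumes affine: "affine_connection A D"
begin

lemma connection_smooth:
  assumes "open U" "smooth_vector_field A U X" "smooth_vector_field A U Y"
  shows "smooth_vector_field A U (\<lambda>p. D p (X p) Y)"
  using affine[unfolded affine_connection_def, THEN conjunct1, rule_format,
      OF conjI[OF assms(1) conjI[OF assms(2,3)]]] .

lemma connection_linear:
  assumes "open U" "smooth_vector_field A U Y" "p \<in> U"
  shows "linear (\<lambda>v. D p v Y)"
  using affine[unfolded affine_connection_def, THEN conjunct2, THEN conjunct1, rule_format,
      OF conjI[OF assms(1,2)] assms(3)] .

lemma connection_add: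
  assumes "open U" "smooth_vector_field A U Y" "smooth_vector_field A U Z" "p \<in> U"
  shows "D p v (\<lambda>q. Y q + Z q) = D p v Y + D p v Z"
  using affine[unfolded affine_connection_def, THEN conjunct2, THEN conjunct2, THEN conjunct1, rule_format,
      OF conjI[OF assms(1) conjI[OF assms(2,3)]] assms(4)] .

lemma connection_Leibniz:
  assumes "open U" "smooth_fun A U f" "smooth_vector_field A U Y" "p \<in> U"
  shows "D p v (\<lambda>q. f q *\<^sub>R Y q) = differential A f p v *\<^sub>R Y p + f p *\<^sub>R D p v Y"
  using affine[unfolded affine_connection_def, THEN conjunct2, THEN conjunct2, THEN conjunct2, rule_format,
      OF conjI[OF assms(1) conjI[OF assms(2,3)]] assms(4)] .

lemma connection_scaleR:
  assumes "open U" "smooth_vector_field A U Y" "p \<in> U"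
  shows "D p v (\<lambda>q. r *\<^sub>R Y q) = r *\<^sub>R D p v Y"
  using connection_Leibniz[OF assms(1) smooth_fun_const[OF assms(1)] assms(2,3), of v r]
  by (simp add: differential_def o_def frechet_derivative_const)

lemma connection_zero: "D p v (\<lambda>_. 0) = 0"
  using connection_scaleR[OF open_UNIV smooth_vector_field_zero[OF open_UNIV], of p v 0] by simp

lemma connection_sum:
  assumes "open U" "p \<in> U" "\<And>i. i \<in> I \<Longrightarrow> smooth_vector_field A U (Y i)"
  shows "D p v (\<lambda>q. \<Sum>i\<in>I. Y i q) = (\<Sum>i\<in>I. D p v (Y i))"
  using assms(3)
proof (induction I rule: infinite_finite_induct)
  case (insert i I)
  have "D p v (\<lambda>q. Y i q + (\<Sum>i\<in>I. Y i q)) = D p v (Y i) + D p v (\<lambda>q. \<Sum>i\<in>I. Y i q)"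
    by (rule connection_add[OF assms(1) _ smooth_vector_field_sum[OF assms(1)] assms(2)])
      (use insert.prems in auto)
  then show ?case using insert by simp
qed (simp_all add: connection_zero)

text \<open>Leibniz rule for the indicator function of the complement of \<open>W\<close>, which is smooth on \<open>W\<close>.\<close>

lemma connection_local:
  assumes "open W" "smooth_vector_field A W Y" "smooth_vector_field A W Z" "p \<in> W"
    and eq: "\<And>q. q \<in> W \<Longrightarrow> Y q = Z q"
  shows "D p v Y = D p v Z"
proof -
  define f :: "'m \<Rightarrow> real" where "f q = (if q \<in> W then 0 else 1)" for q
  define h where "h q = Y q + (- 1) *\<^sub>R Z q" for q
  have Zm: "smooth_vector_field A W (\<lambda>q. (- 1) *\<^sub>R Z q)"
    by (rule smooth_vector_field_const_scaleR[OF assms(1,3)])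
  have h: "smooth_vector_field A W h"
    unfolding h_def [abs_def] by (rule smooth_vector_field_add[OF assms(1,2) Zm])
  have f: "smooth_fun A W f" unfolding smooth_fun_def
  proof
    fix d assume d: "d \<in> A"
    have op: "open (chart_image d W)" by (rule open_chart_image[OF atlas_is_chart[OF d] assms(1)])
    show "smooth_on (chart_image d W) (f \<circ> chart_inv d)"
    proof (rule smooth_on_eqI[OF op smooth_on_const[OF op, of 0]])
      fix x assume "x \<in> chart_image d W"
      then have "chart_inv d x \<in> W" using chart_image_cases[OF atlas_is_chart[OF d]] by metis
      then show "(f \<circ> chart_inv d) x = 0" by (simp add: f_def)
    qed
  qed
  have "h = (\<lambda>q. f q *\<^sub>R h q)" using eq by (auto simp: h_def f_def)
  then have "D p v h = D p v (\<lambda>q. f q *\<^sub>R h q)" by (rule arg_cong)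
  also have "\<dots> = 0"
    using connection_Leibniz[OF assms(1) f h assms(4), of v] assms(4) eq by (simp add: f_def h_def)
  finally have "D p v h = 0" .
  moreover have "D p v h = D p v Y + (- 1) *\<^sub>R D p v Z"
    unfolding h_def [abs_def] connection_add[OF assms(1,2) Zm assms(4)] connection_scaleR[OF assms(1,3,4)] ..
  ultimately show ?thesis by simp
qed

lemma connection_linear_combination:
  assumes "open U" "p \<in> U" "\<And>i. i \<in> I \<Longrightarrow> smooth_vector_field A U (Y i)"
  shows "D p v (\<lambda>q. \<Sum>i\<in>I. r i *\<^sub>R Y i q) = (\<Sum>i\<in>I. r i *\<^sub>R D p v (Y i))"
proof -
  have "D p v (\<lambda>q. \<Sum>i\<in>I. r i *\<^sub>R Y i q) = (\<Sum>i\<in>I. D p v (\<lambda>q. r i *\<^sub>R Y i q))"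
    by (rule connection_sum[OF assms(1,2)]) (use assms smooth_vector_field_const_scaleR in auto)
  also have "\<dots> = (\<Sum>i\<in>I. r i *\<^sub>R D p v (Y i))"
    by (rule sum.cong) (use assms connection_scaleR in auto)
  finally show ?thesis .
qed

end

section \<open>Totally geodesic paraconformal connections\<close>

lemma is_basis_veronese:
  fixes b :: "nat \<Rightarrow> 'e::euclidean_space"
  assumes "DIM('e) = k + 1" "span (b ` {..k}) = UNIV"
  shows "is_basis k (veronese k b)"
proof (rule is_basis_if_spanning[OF assms(1)])
  have "b ` {..k} \<subseteq> span (veronese k b ` {..k})"
  proof safe
    fix j assume "j \<le> k"
    then show "b j \<in> span (veronese k b ` {..k})"
      by (subst veronese_reverse[of j k b]) (assumption, intro span_scale span_base, auto)
  qed
  then have "span (b ` {..k}) \<subseteq> span (veronese k b ` {..k})" by (simp add: span_minimal)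
  then show "span (veronese k b ` {..k}) = UNIV" using assms(2) by auto
qed

text \<open>The local setting shared by both directions of the theorem. The dual frame
  \<open>E\<close> is a parameter: it is obtained by inverting a given coframe in one direction and
  is constant in flat coordinates in the other.\<close>

locale framed_web_connection = manifold_with_connection A D
  for A :: "('m::{t2_space, second_countable_topology}, 'e::euclidean_space) chart set"
    and D :: "('m, 'e) conn" +
  fixes k :: nat and F :: "real \<Rightarrow> 'm \<Rightarrow> 'e set" and U :: "'m set"
    and \<omega> :: "nat \<Rightarrow> 'm \<Rightarrow> 'e \<Rightarrow>\<^sub>L real" and E :: "nat \<Rightarrow> 'm \<Rightarrow> 'e"
  assumes k: "k > 2" and DIM: "DIM('e) = k + 1"
    and U: "open U" and coframe: "web_coframe A k F U \<omega>"
    and smooth_E: "i \<le> k \<Longrightarrow> smooth_vector_field A U (E i)"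
    and dual: "q \<in> U \<Longrightarrow> i \<le> k \<Longrightarrow> j \<le> k \<Longrightarrow> blinfun_apply (\<omega> i q) (E j q) = (if i = j then 1 else 0)"
begin

lemma basis_\<omega>: "q \<in> U \<Longrightarrow> is_basis k (\<lambda>i. \<omega> i q)"
  using coframe by (simp add: web_coframe_def)

lemma expand: "q \<in> U \<Longrightarrow> v = (\<Sum>i\<le>k. blinfun_apply (\<omega> i q) v *\<^sub>R E i q)"
  by (rule coframe_expansion[OF basis_\<omega>]) (use dual in auto)

lemma span_E: "q \<in> U \<Longrightarrow> span ((\<lambda>i. E i q) ` {..k}) = UNIV"
proof -
  assume q: "q \<in> U"
  have "v \<in> span ((\<lambda>i. E i q) ` {..k})" for v
    by (subst expand[OF q, of v]) (intro span_sum span_scale span_base, auto)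
  then show ?thesis by auto
qed

lemma tangent_iff: "q \<in> U \<Longrightarrow> v \<in> F t q \<longleftrightarrow> poly_curve k (\<lambda>i. blinfun_apply (\<omega> i q) v) t = 0"
  using coframe by (simp add: web_coframe_def blinfun_apply_poly_curve)

definition V :: "nat \<Rightarrow> 'm \<Rightarrow> 'e" where "V i q = veronese k (\<lambda>j. E j q) i"

lemma smooth_V: "i \<le> k \<Longrightarrow> smooth_vector_field A U (V i)"
  unfolding V_def [abs_def] veronese_def
  by (intro smooth_vector_field_const_scaleR U smooth_E) simp

lemma pairing_V: "q \<in> U \<Longrightarrow>
    poly_curve k (\<lambda>i. blinfun_apply (\<omega> i q) (poly_curve k (\<lambda>i. V i q) t)) s = (s - t) ^ k"
  unfolding V_def by (rule veronese_pairing[OF linear_blinfun_apply]) (use dual in auto)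

text \<open>\<open>paraconformal\<close> and \<open>canonical_connection\<close> speak of every dual
  frame, so they may be evaluated on this normalised one as soon as it qualifies. It does because
  \<omega>(s) pairs with V(t) to \<open>(s - t)^k\<close>, whose derivatives of order below
  \<open>k\<close> vanish at \<open>s = t\<close>.\<close>

lemma dual_frame_V: "dual_frame A k F U V"
  unfolding dual_frame_def
proof (intro conjI exI[of _ \<omega>] allI impI ballI coframe)
  show "smooth_vector_field A U (V i)" if "i \<le> k" for i by (rule smooth_V[OF that])
  show "is_basis k (\<lambda>i. V i q)" if "q \<in> U" for q
    unfolding V_def by (rule is_basis_veronese[OF DIM span_E[OF that]])
  show "blinfun_apply (nth_derivative j (poly_curve k (\<lambda>i. \<omega> i q)) t) (poly_curve k (\<lambda>i. V i q) t) = 0"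
    if q: "q \<in> U" and j: "j < k" for q t j
  proof -
    have "poly_curve k (\<lambda>i. blinfun_apply (\<omega> i q) (poly_curve k (\<lambda>i. V i q) t)) = (\<lambda>s. (s - t) ^ k)"
      using pairing_V[OF q] by auto
    moreover obtain c where "nth_derivative j (\<lambda>s. (s - t) ^ k) = (\<lambda>s::real. c * (s - t) ^ (k - j))"
      using nth_derivative_power[of j k t] j by auto
    ultimately show ?thesis
      unfolding linear_nth_derivative[OF linear_blinfun_apply_left] using j by simp
  qed
qed

lemma connection_constant_combination:
  assumes "q \<in> U" "\<And>i. i \<le> k \<Longrightarrow> D q v (E i) = r *\<^sub>R E i q"
  shows "D q v (\<lambda>q. \<Sum>i\<le>k. c i *\<^sub>R E i q) = r *\<^sub>R (\<Sum>i\<le>k. c i *\<^sub>R E i q)"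
proof -
  have "D q v (\<lambda>q. \<Sum>i\<le>k. c i *\<^sub>R E i q) = (\<Sum>i\<le>k. c i *\<^sub>R D q v (E i))"
    by (rule connection_linear_combination[OF U assms(1)]) (use smooth_E in auto)
  also have "\<dots> = (\<Sum>i\<le>k. r *\<^sub>R (c i *\<^sub>R E i q))" by (rule sum.cong) (use assms(2) in auto)
  finally show ?thesis by (simp add: scaleR_sum_right)
qed

lemma connection_dual_curve:
  assumes q: "q \<in> U"
  shows "D q v (dual_curve k V t) = poly_curve k (veronese k (\<lambda>i. D q v (E i))) t"
proof -
  have "D q v (V i) = veronese k (\<lambda>i. D q v (E i)) i" if "i \<le> k" for i
    unfolding V_def [abs_def] veronese_def by (rule connection_scaleR[OF U smooth_E q]) simp
  then show ?thesis
    unfolding poly_curve_def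
    using connection_linear_combination[OF U q, of "{..k}" V v "\<lambda>i. t ^ i"] smooth_V by simp
qed

lemma smooth_dual_curve: "smooth_vector_field A U (dual_curve k V t)"
  unfolding poly_curve_def
  by (intro smooth_vector_field_sum smooth_vector_field_const_scaleR U smooth_V) simp

text \<open>The dual curve has constant coefficients in the frame \<open>E\<close>, so at a fixed
  \<open>q\<close> both conditions on \<open>D\<close> become algebraic conditions on the values
  \<open>D q v (E i)\<close>, which \<open>adapted_connection_is_scalar\<close> resolves.\<close>

lemma adapted_connection_on_frame:
  assumes tg: "totally_geodesic A F D" and pc: "paraconformal A k F D"
    and q: "q \<in> U" and i: "i \<le> k"
  shows "D q v (E i) = blinfun_apply (\<omega> 0 q) (D q v (E 0)) *\<^sub>R E i q"
proof (rule adapted_connection_is_scalar[OF k linear_blinfun_apply _ _ _ _ _ i,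
      where G = "\<lambda>v i. D q v (E i)" and E = "\<lambda>i. E i q"])
  show "blinfun_apply (\<omega> i q) (E j q) = (if i = j then 1 else 0)" if "i \<le> k" "j \<le> k" for i j
    by (rule dual[OF q that])
  show "w = (\<Sum>i\<le>k. blinfun_apply (\<omega> i q) w *\<^sub>R E i q)" for w by (rule expand[OF q])
  show "linear (\<lambda>v. D q v (E j))" if "j \<le> k" for j by (rule connection_linear[OF U smooth_E[OF that] q])
  show "poly_curve k (veronese k (\<lambda>i. D q w (E i))) t \<in> span {poly_curve k (veronese k (\<lambda>i. E i q)) t,
      nth_derivative 1 (poly_curve k (veronese k (\<lambda>i. E i q))) t}" for w t
  proof -
    have "D q w (dual_curve k V t) \<in> span {dual_curve k V t q, dual_curve' k V t q}"
      by (rule pc[unfolded paraconformal_def, rule_format, OF conjI[OF U dual_frame_V] q])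
    then show ?thesis unfolding connection_dual_curve[OF q] by (simp add: V_def)
  qed
  show "poly_curve k (\<lambda>j. blinfun_apply (\<omega> j q)
      (poly_curve k (veronese k (\<lambda>l. D q (E i q - t ^ i *\<^sub>R E 0 q) (E l))) s -
       (t - s) ^ k *\<^sub>R D q (E i q - t ^ i *\<^sub>R E 0 q) (E 0))) t = 0" if i: "i \<le> k" for i s t
  proof -
    \<comment> \<open>\<omega>(t) is \<open>t^i\<close> on \<open>E i\<close>,
      \<open>(t - s)^k\<close> on V(s) and 1 on \<open>E 0\<close>; subtracting these multiples of
      \<open>E 0\<close> makes \<open>X\<close> and \<open>Y\<close> tangent to the leaves. The
      multiples are constant on \<open>U\<close>, so no derivative of a coefficient arises.\<close>
    define X where "X p = E i p + (- (t ^ i)) *\<^sub>R E 0 p" for p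
    define Z where "Z p = (- ((t - s) ^ k)) *\<^sub>R E 0 p" for p
    define Y where "Y p = dual_curve k V s p + Z p" for p
    have lin: "linear (\<lambda>v. poly_curve k (\<lambda>j. blinfun_apply (\<omega> j p) v) t)" for p
      unfolding poly_curve_def
      by (intro linear_compose_sum ballI linear_compose_scale_right linear_blinfun_apply)
    have smX: "smooth_vector_field A U X"
      unfolding X_def [abs_def]
      by (intro smooth_vector_field_add smooth_vector_field_const_scaleR U smooth_E i) simp
    have smZ: "smooth_vector_field A U Z"
      unfolding Z_def [abs_def] by (intro smooth_vector_field_const_scaleR U smooth_E) simp
    have smY: "smooth_vector_field A U Y"
      unfolding Y_def [abs_def] by (rule smooth_vector_field_add[OF U smooth_dual_curve smZ])
    have E: "poly_curve k (\<lambda>j. blinfun_apply (\<omega> j p) (E i p)) t = t ^ i" if "p \<in> U" "i \<le> k" for p i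
    proof -
      have "poly_curve k (\<lambda>j. blinfun_apply (\<omega> j p) (E i p)) t = (\<Sum>j\<le>k. if j = i then t ^ j else 0)"
        unfolding poly_curve_def by (rule sum.cong) (use dual that in auto)
      then show ?thesis using that by simp
    qed
    have "X p \<in> F t p \<and> Y p \<in> F t p" if p: "p \<in> U" for p
      unfolding tangent_iff[OF p] X_def Y_def Z_def linear_add[OF lin] linear_scale[OF lin] pairing_V[OF p]
      using E[OF p] i by simp
    then have "\<forall>p\<in>U. X p \<in> F t p \<and> Y p \<in> F t p" by blast
    from tg[unfolded totally_geodesic_def, rule_format, OF conjI[OF U conjI[OF smX conjI[OF smY this]]] q]
    have "D q (X q) Y \<in> F t q" .
    moreover have "D q (X q) Y = poly_curve k (veronese k (\<lambda>l. D q (X q) (E l))) s + (- ((t - s) ^ k)) *\<^sub>R D q (X q) (E 0)"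
      unfolding Y_def [abs_def] connection_add[OF U smooth_dual_curve smZ q] connection_dual_curve[OF q]
      unfolding Z_def [abs_def] connection_scaleR[OF U smooth_E[OF le0] q] ..
    ultimately show ?thesis unfolding tangent_iff[OF q] by (simp add: X_def)
  qed
qed

end

context manifold_with_connection begin

text \<open>The frame \<open>E\<close> is constant in the chart \<open>c\<close>, so that brackets of its constant combinations
  vanish.\<close>

lemma canonical_connection_flat_frame:
  assumes fw: "framed_web_connection A D k F (fst c) \<omega> (\<lambda>i q. lift c q (e i))"
    and c: "local_coordinates A c" and can: "canonical_connection A k F D"
    and p: "p \<in> fst c" and i: "i \<le> k"
  shows "D p v (\<lambda>q. lift c q (e i)) = 0"
proof -
  define E where "E i q = lift c q (e i)" for i q
  interpret framed_web_connection A D k F "fst c" \<omega> E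
    using fw by (simp add: E_def [abs_def])
  define a where "a v = blinfun_apply (\<omega> 0 p) (D p v (E 0))" for v
  have lina: "linear a"
    unfolding a_def using linear_compose[OF connection_linear[OF U smooth_E[OF le0] p] linear_blinfun_apply, of "\<omega> 0 p"]
    by (simp add: o_def)
  have DE: "D p v (E i) = a v *\<^sub>R E i p" if "i \<le> k" for v i
    unfolding a_def using adapted_connection_on_frame[OF _ _ p that] can by (simp add: canonical_connection_def)
  have aV: "a (poly_curve k (\<lambda>i. V i p) t) = 0" for t
  proof -
    define f where "f i = t ^ (k - i) * ((- 1) ^ (k - i) * real (k choose (k - i)))" for i
    have V: "dual_curve k V t q = (\<Sum>i\<le>k. f i *\<^sub>R E i q)" for q
      unfolding poly_curve_def V_def veronese_def f_def
      by (rule sum.reindex_bij_witness[of _ "\<lambda>i. k - i" "\<lambda>i. k - i"]) auto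
    \<comment> \<open>The coefficients themselves are irrelevant; what counts is that they do not
      depend on \<open>q\<close>.\<close>
    have "\<exists>h. \<forall>q. dual_curve' k V t q = (\<Sum>i\<le>k. h i *\<^sub>R E i q)"
    proof -
      have "dual_curve' k V t q = (\<Sum>i\<le>k. (real i * t ^ (i - 1) * ((- 1) ^ i * real (k choose i))) *\<^sub>R E (k - i) q)" for q
      proof -
        have "dual_curve' k V t q = (\<Sum>i<k. t ^ i *\<^sub>R (real (Suc i) *\<^sub>R V (Suc i) q))"
          unfolding nth_derivative_poly_curve
          by (simp add: poly_curve_def lessThan_Suc_atMost[symmetric] poly_curve_deriv_def)
        also have "\<dots> = (\<Sum>i\<le>k. (real i * t ^ (i - 1)) *\<^sub>R V i q)"
          by (simp add: sum.atMost_shift mult.commute)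
        finally show ?thesis by (simp add: V_def veronese_def)
      qed
      also have "\<dots> q = (\<Sum>i\<le>k. (real (k - i) * t ^ (k - i - 1) * ((- 1) ^ (k - i) * real (k choose (k - i)))) *\<^sub>R E i q)" for q
        by (rule sum.reindex_bij_witness[of _ "\<lambda>i. k - i" "\<lambda>i. k - i"]) auto
      finally show ?thesis by (intro exI allI)
    qed
    then obtain h where V': "\<And>q. dual_curve' k V t q = (\<Sum>i\<le>k. h i *\<^sub>R E i q)" by blast
    have const: "in_chart A c (\<lambda>q. \<Sum>i\<le>k. r i *\<^sub>R E i q) x = (\<Sum>i\<le>k. r i *\<^sub>R e i)"
      if "x \<in> snd c ` fst c" for r x
    proof -
      obtain q where q: "q \<in> fst c" "x = snd c q" using \<open>x \<in> _\<close> by blast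
      show ?thesis unfolding q(2) in_chart_at[OF c q(1)] E_def
        by (simp add: linear_sum[OF linear_components[OF c q(1)]] linear_scale[OF linear_components[OF c q(1)]]
            components_lift[OF c q(1)])
    qed
    have fd0: "frechet_derivative (in_chart A c (\<lambda>q. \<Sum>i\<le>k. r i *\<^sub>R E i q)) (at (snd c p)) w = 0" for r w
    proof -
      have "frechet_derivative (in_chart A c (\<lambda>q. \<Sum>i\<le>k. r i *\<^sub>R E i q)) (at (snd c p)) =
          frechet_derivative (\<lambda>_. \<Sum>i\<le>k. r i *\<^sub>R e i) (at (snd c p))"
        by (rule frechet_derivative_cong_open[of "snd c ` fst c"])
          (use const p local_coordinatesD(1)[OF c] in \<open>auto simp: is_chart_def\<close>)
      then show ?thesis by (simp add: frechet_derivative_const)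
    qed
    have sm: "smooth_vector_field A (fst c) (\<lambda>q. \<Sum>i\<le>k. r i *\<^sub>R E i q)" for r
      by (intro smooth_vector_field_sum smooth_vector_field_const_scaleR U smooth_E) simp
    \<comment> \<open>V(t) and V'(t) have constant components in \<open>c\<close>, so both
      derivatives in the bracket are zero.\<close>
    have "components A c p (lie_bracket A (dual_curve k V t) (dual_curve' k V t) p) = 0"
      unfolding V V' lie_bracket_in_chart[OF c p p U sm sm] fd0 by simp
    then have "lie_bracket A (dual_curve k V t) (dual_curve' k V t) p = 0"
      using lift_components[OF c p] linear_0[OF linear_lift[OF c p]] by metis
    moreover have "D p w (dual_curve k V t) = a w *\<^sub>R dual_curve k V t p" for w
      unfolding V using connection_constant_combination[OF p DE] by simp
    moreover have "D p w (dual_curve' k V t) = a w *\<^sub>R dual_curve' k V t p" for w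
      unfolding V' using connection_constant_combination[OF p DE] by simp
    ultimately have tor: "torsion A D (dual_curve k V t) (dual_curve' k V t) p =
        a (dual_curve k V t p) *\<^sub>R dual_curve' k V t p - a (dual_curve' k V t p) *\<^sub>R dual_curve k V t p"
      by (simp add: torsion_def)
    have "torsion A D (dual_curve k V t) (dual_curve' k V t) p \<in> span {dual_curve k V t p}"
      by (rule can[unfolded canonical_connection_def, THEN conjunct2, THEN conjunct2, THEN conjunct2,
            rule_format, OF conjI[OF U dual_frame_V] p])
    then obtain r where "torsion A D (dual_curve k V t) (dual_curve' k V t) p = r *\<^sub>R dual_curve k V t p"
      by (auto simp: span_singleton)
    then have "a (dual_curve k V t p) *\<^sub>R dual_curve' k V t p = (r + a (dual_curve' k V t p)) *\<^sub>R dual_curve k V t p"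
      unfolding tor by (simp add: algebra_simps)
    then obtain r where r: "a (dual_curve k V t p) *\<^sub>R dual_curve' k V t p = r *\<^sub>R dual_curve k V t p" by blast
    \<comment> \<open>Pairing with \<omega>(s) for a free \<open>s\<close> turns the proportionality
      of V'(t) and V(t) into one of \<open>(s - t)^(k - 1)\<close> and
      \<open>(s - t)^k\<close>.\<close>
    have rel: "a (dual_curve k V t p) * (- (real k * (s - t) ^ (k - 1))) = r * (s - t) ^ k" for s
    proof -
      define \<phi> where "\<phi> v = poly_curve k (\<lambda>j. blinfun_apply (\<omega> j p) v) s" for v
      have lin\<phi>: "linear \<phi>"
        unfolding \<phi>_def poly_curve_def
        by (intro linear_compose_sum ballI linear_compose_scale_right linear_blinfun_apply)
      have \<phi>V: "\<phi> (dual_curve k V u p) = (s - u) ^ k" for u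
        unfolding \<phi>_def by (rule pairing_V[OF p])
      have \<phi>V': "\<phi> (dual_curve' k V t p) = - (real k * (s - t) ^ (k - 1))"
        by (rule veronese_pairing_derivative[OF lin\<phi> \<phi>V])
      show ?thesis
        using arg_cong[OF r, of \<phi>] unfolding linear_scale[OF lin\<phi>] \<phi>V \<phi>V' by simp
    qed
    have kk: "k = Suc (k - 1)" using k by simp
    \<comment> \<open>The values \<open>s - t = 1\<close> and \<open>s - t = - 1\<close> give this
      quantity as \<open>- r\<close> and as \<open>r\<close>, so it is 0.\<close>
    have "a (dual_curve k V t p) * real k = 0"
      using rel[of "t + 1"] rel[of "t - 1"] by (subst (asm) (4) kk) (auto simp: minus_one_power_iff split: if_splits)
    then show "a (dual_curve k V t p) = 0" using k by simp
  qed
  \<comment> \<open>The value of \<open>a\<close> on V(t) is a polynomial in \<open>t\<close> that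
    vanishes everywhere, and its coefficients are the values of \<open>a\<close> on the
    \<open>V i\<close>.\<close>
  have "\<forall>i\<le>k. a (V i p) = 0"
  proof -
    have "(\<Sum>i\<le>k. a (V i p) * t ^ i) = 0" for t
      using aV[of t] by (simp add: poly_curve_def linear_sum[OF lina] linear_scale[OF lina] mult.commute)
    then show ?thesis using polyfun_eq_0[of "\<lambda>i. a (V i p)" k] by blast
  qed
  then have "a (E i p) = 0" if "i \<le> k" for i
    using veronese_reverse[OF that, of "\<lambda>j. E j p"] linear_scale[OF lina] that by (simp add: V_def)
  then have "a v = 0"
    by (subst expand[OF p, of v]) (simp add: linear_sum[OF lina] linear_scale[OF lina])
  moreover have "E i = (\<lambda>q. lift c q (e i))" by (simp add: E_def fun_eq_iff)
  ultimately show ?thesis using DE[OF i, of v] by simp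
qed

end

section \<open>Flatness and torsion\<close>

context manifold_with_connection begin

lemma torsion_free_if_flat:
  assumes k: "k > 2" and DIM: "DIM('e) = k + 1" and flat: "flat_web A k F"
    and can: "canonical_connection A k F D"
  shows "torsion_free A D"
  unfolding torsion_free_def
proof (intro allI impI ballI)
  fix U X Y p
  assume "open U \<and> smooth_vector_field A U X \<and> smooth_vector_field A U Y" and pU: "p \<in> U"
  then have oU: "open U" and X: "smooth_vector_field A U X" and Y: "smooth_vector_field A U Y" by auto
  obtain c \<omega> g \<alpha> where c: "local_coordinates A c" and p: "p \<in> fst c" and cof: "web_coframe A k F (fst c) \<omega>"
    and g: "smooth_fun A (fst c) g" and gnz: "\<And>q. q \<in> fst c \<Longrightarrow> g q \<noteq> 0"
    and \<alpha>: "\<And>q i v. q \<in> fst c \<Longrightarrow> i \<le> k \<Longrightarrow> g q * blinfun_apply (\<omega> i q) v = blinfun_apply (\<alpha> i) (components A c q v)"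
    using flat[unfolded flat_web_def, rule_format, of p] by (elim exE conjE) blast
  have oc: "open (fst c)" by (rule open_domain[OF c])
  \<comment> \<open>Absorbing \<open>g\<close> gives a coframe of the same web that has exactly the
    constant coefficients \<open>\<alpha> i\<close> in \<open>c\<close>; the kernels are unchanged
    because \<open>g\<close> has no zeros.\<close>
  define \<omega>' where "\<omega>' i q = g q *\<^sub>R \<omega> i q" for i q
  have \<omega>': "blinfun_apply (\<omega>' i q) v = blinfun_apply (\<alpha> i) (components A c q v)" if "q \<in> fst c" "i \<le> k" for i q v
    using \<alpha>[OF that] by (simp add: \<omega>'_def blinfun.scaleR_left)
  have cof': "web_coframe A k F (fst c) \<omega>'"
    unfolding web_coframe_def
  proof (intro conjI allI impI ballI)
    fix i assume i: "i \<le> k"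
    show "smooth_one_form A (fst c) (\<omega>' i)" unfolding smooth_one_form_def
    proof (intro allI impI)
      fix W X assume W: "open W \<and> W \<subseteq> fst c \<and> smooth_vector_field A W X"
      have "smooth_fun A W (\<lambda>p. blinfun_apply (\<omega> i p) (X p))"
        using cof i W by (simp add: web_coframe_def smooth_one_form_def)
      then have "smooth_fun A W (\<lambda>p. g p * blinfun_apply (\<omega> i p) (X p))"
        using W by (intro smooth_fun_mult smooth_fun_subset[OF g]) auto
      then show "smooth_fun A W (\<lambda>p. blinfun_apply (\<omega>' i p) (X p))"
        by (simp add: \<omega>'_def blinfun.scaleR_left)
    qed
  next
    fix q assume q: "q \<in> fst c"
    show "is_basis k (\<lambda>i. \<omega>' i q)"
      unfolding \<omega>'_def by (rule is_basis_scaleR) (use cof q gnz in \<open>auto simp: web_coframe_def\<close>)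
    fix t
    have "poly_curve k (\<lambda>i. \<omega>' i q) t = g q *\<^sub>R poly_curve k (\<lambda>i. \<omega> i q) t"
      by (simp add: poly_curve_def \<omega>'_def scaleR_sum_right mult.commute)
    then show "F t q = {v. blinfun_apply (poly_curve k (\<lambda>i. \<omega>' i q) t) v = 0}"
      using cof q gnz[OF q] by (simp add: web_coframe_def blinfun.scaleR_left)
  qed
  obtain B :: "nat \<Rightarrow> 'e" where B: "bij_betw B {..k} Basis" using ex_basis_enumeration[OF DIM] by blast
  have bas: "is_basis k (\<lambda>i. \<omega>' i p)" using cof' p by (simp add: web_coframe_def)
  \<comment> \<open>The basis dual to the constant forms \<open>\<alpha> i\<close>, found by
    inverting the coframe at the single point \<open>p\<close>; being constant, it serves on the
    whole chart.\<close>
  define e where "e j = components A c p (inv (\<lambda>v. \<Sum>i\<le>k. blinfun_apply (\<omega>' i p) v *\<^sub>R B i) (B j))" for j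
  have \<alpha>e: "blinfun_apply (\<alpha> i) (e j) = (if i = j then 1 else 0)" if "i \<le> k" "j \<le> k" for i j
  proof -
    have "blinfun_apply (\<alpha> i) (e j) = B j \<bullet> B i"
      unfolding e_def \<omega>'[OF p that(1), symmetric]
      by (rule coframe_bij(3)[OF bas B _ that(1)]) (rule surj_f_inv_f[OF bij_is_surj[OF coframe_bij(2)[OF bas B]]])
    then show ?thesis using inner_enumerated_Basis[OF B that(2,1)] by auto
  qed
  define E where "E i q = lift c q (e i)" for i q
  have fw: "framed_web_connection A D k F (fst c) \<omega>' E"
  proof unfold_locales
    show "smooth_vector_field A (fst c) (E i)" for i
      unfolding E_def [abs_def]
      by (rule smooth_vector_field_lift[OF c oc order_refl, of "\<lambda>_. e i"])
        (intro smooth_on_const open_chart_image local_coordinatesD[OF c] oc)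
    show "blinfun_apply (\<omega>' i q) (E j q) = (if i = j then 1 else 0)" if "q \<in> fst c" "i \<le> k" "j \<le> k" for i j q
      using that by (simp add: \<omega>' E_def components_lift[OF c] \<alpha>e)
  qed (rule k DIM oc cof')+
  interpret framed_web_connection A D k F "fst c" \<omega>' E by (rule fw)
  have DE: "D p v (E i) = 0" if "i \<le> k" for v i
    using canonical_connection_flat_frame[OF fw[unfolded E_def [abs_def]] c can p that] by (simp add: E_def [abs_def])
  define W where "W = U \<inter> fst c"
  have W: "open W" "W \<subseteq> fst c" "W \<subseteq> U" "p \<in> W" using oU oc p pU by (auto simp: W_def)
  \<comment> \<open>The frame is constant in \<open>c\<close> and its covariant derivative vanishes
    at \<open>p\<close>, so at \<open>p\<close> the connection differentiates the components in
    \<open>c\<close>: it is the flat connection of these coordinates.\<close>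
  have main: "components A c p (D p v Z) = frechet_derivative (in_chart A c Z) (at (snd c p)) (components A c p v)"
    if Z: "smooth_vector_field A U Z" for Z v
  proof -
    define f where "f i q = blinfun_apply (\<omega>' i q) (Z q)" for i q
    have ZW: "smooth_vector_field A W Z" by (rule smooth_vector_field_subset[OF Z W(3)])
    have EW: "smooth_vector_field A W (E i)" if "i \<le> k" for i
      by (rule smooth_vector_field_subset[OF smooth_E[OF that] W(2)])
    have f: "smooth_fun A W (f i)" if "i \<le> k" for i
      using cof' that W ZW unfolding web_coframe_def smooth_one_form_def f_def [abs_def] by blast
    have fE: "smooth_vector_field A W (\<lambda>q. f i q *\<^sub>R E i q)" if "i \<le> k" for i
      by (rule smooth_vector_field_scaleR[OF W(1) f[OF that] EW[OF that]])
    have sE: "smooth_vector_field A W (\<lambda>q. \<Sum>i\<le>k. f i q *\<^sub>R E i q)"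
      by (rule smooth_vector_field_sum[OF W(1)]) (use fE in auto)
    \<comment> \<open>The expansion in the frame holds only on \<open>W\<close>, while
      \<open>D\<close> takes fields defined on the whole type; locality of the connection bridges
      the gap.\<close>
    have "D p v Z = D p v (\<lambda>q. \<Sum>i\<le>k. f i q *\<^sub>R E i q)"
      by (rule connection_local[OF W(1) ZW sE W(4)]) (use expand W(2) in \<open>auto simp: f_def\<close>)
    also have "\<dots> = (\<Sum>i\<le>k. D p v (\<lambda>q. f i q *\<^sub>R E i q))"
      by (rule connection_sum[OF W(1,4)]) (use fE in auto)
    also have "\<dots> = (\<Sum>i\<le>k. differential A (f i) p v *\<^sub>R E i p)"
      by (rule sum.cong) (use connection_Leibniz[OF W(1) f EW W(4)] DE in auto)
    finally have DZ: "D p v Z = (\<Sum>i\<le>k. differential A (f i) p v *\<^sub>R E i p)" .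
    have x: "snd c p \<in> chart_image c W" using W p by auto
    have op: "open (chart_image c W)" by (rule open_chart_image[OF local_coordinatesD(1)[OF c] W(1)])
    have fs: "smooth_on (chart_image c W) (f i \<circ> chart_inv c)" if "i \<le> k" for i
      using f[OF that] smooth_fun_iff[OF c W(1,2)] by blast
    have "((\<lambda>x. \<Sum>i\<le>k. (f i \<circ> chart_inv c) x *\<^sub>R e i) has_derivative
       (\<lambda>w. \<Sum>i\<le>k. frechet_derivative (f i \<circ> chart_inv c) (at (snd c p)) w *\<^sub>R e i)) (at (snd c p))"
      by (intro has_derivative_sum has_derivative_scaleR_left smooth_on_imp_has_derivative[OF fs x]) auto
    then have "(in_chart A c Z has_derivative
       (\<lambda>w. \<Sum>i\<le>k. frechet_derivative (f i \<circ> chart_inv c) (at (snd c p)) w *\<^sub>R e i)) (at (snd c p))"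
    proof (rule has_derivative_transform_within_open[OF _ op x])
      fix x assume "x \<in> chart_image c W"
      then obtain q where q: "q \<in> fst c" "x = snd c q" "chart_inv c x = q"
        using chart_image_cases[OF local_coordinatesD(1)[OF c]] by metis
      have "in_chart A c Z x = components A c q (\<Sum>i\<le>k. f i q *\<^sub>R E i q)"
        using expand[OF q(1), of "Z q"] by (simp add: q(2) in_chart_at[OF c q(1)] f_def)
      also have "\<dots> = (\<Sum>i\<le>k. f i q *\<^sub>R e i)"
        by (simp add: linear_sum[OF linear_components[OF c q(1)]] linear_scale[OF linear_components[OF c q(1)]]
            E_def components_lift[OF c q(1)])
      finally show "(\<Sum>i\<le>k. (f i \<circ> chart_inv c) x *\<^sub>R e i) = in_chart A c Z x" using q(3) by simp
    qed
    then have "frechet_derivative (in_chart A c Z) (at (snd c p)) =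
       (\<lambda>w. \<Sum>i\<le>k. frechet_derivative (f i \<circ> chart_inv c) (at (snd c p)) w *\<^sub>R e i)"
      by (rule frechet_derivative_at[symmetric])
    moreover have "components A c p (D p v Z) = (\<Sum>i\<le>k. differential A (f i) p v *\<^sub>R e i)"
      unfolding DZ by (simp add: linear_sum[OF linear_components[OF c p]] linear_scale[OF linear_components[OF c p]]
            E_def components_lift[OF c p])
    ultimately show ?thesis
      using differential_in_chart[OF c p smooth_on_imp_differentiable[OF fs x]] by simp
  qed
  have "components A c p (torsion A D X Y p) = 0"
    unfolding torsion_def linear_diff[OF linear_components[OF c p]] main[OF X] main[OF Y]
      lie_bracket_in_chart[OF c p pU oU X Y] in_chart_at[OF c p] by simp
  then show "torsion A D X Y p = 0"
    using lift_components[OF c p, of "torsion A D X Y p"] linear_0[OF linear_lift[OF c p]] by simp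
qed

lemma flat_if_torsion_free:
  assumes k: "k > 2" and DIM: "DIM('e) = k + 1" and web: "veronese_web A k F"
    and tg: "totally_geodesic A F D" and pc: "paraconformal A k F D" and tf: "torsion_free A D"
  shows "flat_web A k F"
  unfolding flat_web_def
proof
  fix p
  obtain U0 \<omega> where U0: "open U0" "p \<in> U0" and cof0: "web_coframe A k F U0 \<omega>"
    using web unfolding veronese_web_def by blast
  define c where "c = chart_at A p"
  have cA: "c \<in> A" and pc': "p \<in> fst c" using chart_at by (auto simp: c_def)
  have c: "local_coordinates A c" by (rule atlas_local_coordinates[OF cA])
  note cc = local_coordinatesD(1)[OF c]
  define U where "U = U0 \<inter> fst c"
  have UU: "open U" "U \<subseteq> fst c" "p \<in> U" using U0 open_domain[OF c] pc' by (auto simp: U_def)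
  have cof: "web_coframe A k F U \<omega>" by (rule web_coframe_subset[OF cof0]) (simp add: U_def)
  have bas: "is_basis k (\<lambda>i. \<omega> i q)" if "q \<in> U" for q using cof that by (simp add: web_coframe_def)
  define S where "S = chart_image c U"
  have S: "open S" unfolding S_def by (rule open_chart_image[OF cc UU(1)])
  have Sq: "chart_inv c x \<in> U" "chart_inv c x \<in> fst c" "snd c (chart_inv c x) = x" if "x \<in> S" for x
    using chart_image_cases[OF cc that[unfolded S_def]] by metis+
  have qS: "snd c q \<in> S" "chart_inv c (snd c q) = q" if "q \<in> U" for q
    using that UU(2) chart_inv_left[OF cc] by (auto simp: S_def)
  obtain B :: "nat \<Rightarrow> 'e" where B: "bij_betw B {..k} Basis" using ex_basis_enumeration[OF DIM] by blast
  have BB: "B i \<bullet> B j = (if i = j then 1 else 0)" if "i \<le> k" "j \<le> k" for i j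
    by (rule inner_enumerated_Basis[OF B that])
  define \<theta> where "\<theta> i x v = blinfun_apply (\<omega> i (chart_inv c x)) (lift c (chart_inv c x) v)" for i x v
  have lin\<theta>: "linear (\<theta> i x)" if "x \<in> S" for i x
    unfolding \<theta>_def using linear_compose[OF linear_lift[OF c Sq(2)[OF that]] linear_blinfun_apply]
    by (simp add: o_def)
  \<comment> \<open>Smoothness of a one-form is available only on vector fields; it is tested here
    on the field with constant components \<open>v\<close> in \<open>c\<close>.\<close>
  have sm\<theta>: "smooth_on S (\<lambda>x. \<theta> i x v)" if i: "i \<le> k" for i v
  proof -
    have "smooth_vector_field A U (\<lambda>q. lift c q v)"
      by (rule smooth_vector_field_lift[OF c UU(1,2), of "\<lambda>_. v"])
        (rule smooth_on_const[OF S[unfolded S_def]])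
    then have "smooth_fun A U (\<lambda>q. blinfun_apply (\<omega> i q) (lift c q v))"
      using cof i UU(1) unfolding web_coframe_def smooth_one_form_def by blast
    then show ?thesis unfolding smooth_fun_iff[OF c UU(1,2)] by (simp add: o_def \<theta>_def S_def)
  qed
  define M0 where "M0 q v = (\<Sum>i\<le>k. blinfun_apply (\<omega> i q) v *\<^sub>R B i)" for q v
  \<comment> \<open>\<open>M x\<close> is the coframe in chart components and \<open>N x\<close> its
    inverse, so that \<open>N x (B i)\<close> is the dual frame and its smoothness is that of an
    inverse family.\<close>
  define M where "M x v = (\<Sum>i\<le>k. \<theta> i x v *\<^sub>R B i)" for x v
  define N where "N x w = components A c (chart_inv c x) (inv (M0 (chart_inv c x)) w)" for x w
  have bijM0: "bij (M0 q)" if "q \<in> U" for q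
    unfolding M0_def by (rule coframe_bij(2)[OF bas[OF that] B])
  have MN: "M x (N x w) = w" if "x \<in> S" for x w
    using surj_f_inv_f[OF bij_is_surj[OF bijM0[OF Sq(1)[OF that]]]]
    by (simp add: M_def N_def \<theta>_def lift_components[OF c Sq(2)[OF that]] M0_def[symmetric])
  have NM: "N x (M x v) = v" if "x \<in> S" for x v
  proof -
    have "M x v = M0 (chart_inv c x) (lift c (chart_inv c x) v)" by (simp add: M_def M0_def \<theta>_def)
    then show ?thesis
      using inv_f_f[OF bij_is_inj[OF bijM0[OF Sq(1)[OF that]]]]
      by (simp add: N_def components_lift[OF c Sq(2)[OF that]])
  qed
  have linM: "linear (M x)" if "x \<in> S" for x
    unfolding M_def using lin\<theta>[OF that]
    by (intro linearI) (simp_all add: linear_add linear_scale scaleR_add_left sum.distrib scaleR_sum_right)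
  have smN: "smooth_on S (\<lambda>x. N x w)" for w
  proof (rule smooth_on_inverse_family[OF S linM _ NM MN])
    show "smooth_on S (\<lambda>x. M x v)" for v
      unfolding M_def by (intro smooth_on_sum smooth_on_scaleR smooth_on_const S sm\<theta>) simp
  qed
  define e where "e i x = N x (B i)" for i x
  define E where "E i q = lift c q (e i (snd c q))" for i q
  have smE: "smooth_vector_field A U (E i)" for i
    unfolding E_def [abs_def]
    by (rule smooth_vector_field_lift[OF c UU(1,2)]) (use smN in \<open>simp add: e_def S_def\<close>)
  have \<theta>e: "\<theta> i x (e j x) = (if i = j then 1 else 0)" if "x \<in> S" "i \<le> k" "j \<le> k" for i j x
  proof -
    have "\<theta> i x (e j x) = B j \<bullet> B i"
      unfolding \<theta>_def
      by (rule coframe_bij(3)[OF bas[OF Sq(1)[OF that(1)]] B _ that(2)])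
        (use MN[OF that(1), of "B j"] in \<open>simp add: M_def \<theta>_def e_def\<close>)
    then show ?thesis using BB[OF that(3,2)] by auto
  qed
  interpret framed_web_connection A D k F U \<omega> E
  proof unfold_locales
    show "blinfun_apply (\<omega> i q) (E j q) = (if i = j then 1 else 0)" if "q \<in> U" "i \<le> k" "j \<le> k" for i j q
      using \<theta>e[OF qS(1)[OF that(1)] that(2,3)] by (simp add: \<theta>_def E_def qS(2)[OF that(1)])
  qed (rule k DIM UU(1) cof smE)+
  \<comment> \<open>The values of the connection form \<alpha> on the frame fields; they are smooth
    because \<open>D\<close> preserves smoothness of fields.\<close>
  define aq where "aq i q = blinfun_apply (\<omega> 0 q) (D q (E i q) (E 0))" for i q
  define a where "a i x = aq i (chart_inv c x)" for i x
  have DE: "D q (E j q) (E i) = aq j q *\<^sub>R E i q" if "q \<in> U" "i \<le> k" for i j q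
    unfolding aq_def by (rule adapted_connection_on_frame[OF tg pc that])
  have sma: "smooth_on S (a i)" for i
  proof -
    have "smooth_vector_field A U (\<lambda>q. D q (E i q) (E 0))"
      by (rule connection_smooth[OF UU(1) smE smE])
    then have "smooth_fun A U (aq i)"
      using cof UU(1) unfolding web_coframe_def smooth_one_form_def aq_def [abs_def] by blast
    then show ?thesis unfolding smooth_fun_iff[OF c UU(1,2)] by (simp add: o_def a_def [abs_def] S_def)
  qed
  \<comment> \<open>The vector that represents the covector \<open>\<theta> i x\<close> by the inner
    product, as the frame calculus requires.\<close>
  define \<eta> where "\<eta> i x = (\<Sum>b\<in>Basis. \<theta> i x b *\<^sub>R b)" for i x
  have \<eta>: "\<eta> i x \<bullet> v = \<theta> i x v" if "x \<in> S" for i x v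
    using linear_Basis_expansion[OF lin\<theta>[OF that], of i v]
    by (simp add: \<eta>_def inner_sum_left inner_commute[of v] mult.commute)
  have sm\<eta>: "smooth_on S (\<eta> i)" if "i \<le> k" for i
    unfolding \<eta>_def [abs_def] by (intro smooth_on_sum smooth_on_scaleR smooth_on_const S sm\<theta> that)
  have inE: "in_chart A c (E i) x = e i x" if x: "x \<in> S" for i x
    using Sq[OF x] in_chart_at[OF c Sq(2)[OF x], of "E i"] by (simp add: E_def components_lift[OF c])
  \<comment> \<open>Vanishing torsion expresses the bracket of \<open>E i\<close> and
    \<open>E j\<close> through their covariant derivatives along each other, and each of these is a
    multiple of the field differentiated.\<close>
  have bracket: "frechet_derivative (e j) (at x) (e i x) - frechet_derivative (e i) (at x) (e j x) =
      a i x *\<^sub>R e j x - a j x *\<^sub>R e i x" if x: "x \<in> S" and ij: "i \<le> k" "j \<le> k" for x i j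
  proof -
    define q where "q = chart_inv c x"
    have q: "q \<in> U" "q \<in> fst c" "snd c q = x" using Sq[OF x] by (auto simp: q_def)
    have fd: "frechet_derivative (in_chart A c (E i)) (at x) = frechet_derivative (e i) (at x)" for i
      by (rule frechet_derivative_cong_open[OF S x inE])
    have "torsion A D (E i) (E j) q = 0"
      by (rule tf[unfolded torsion_free_def, rule_format, OF conjI[OF UU(1) conjI[OF smE smE]] q(1)])
    then have "lie_bracket A (E i) (E j) q = aq i q *\<^sub>R E j q - aq j q *\<^sub>R E i q"
      by (simp add: torsion_def DE[OF q(1)] ij)
    then have "components A c q (lie_bracket A (E i) (E j) q) = aq i q *\<^sub>R e j x - aq j q *\<^sub>R e i x"
      by (simp add: linear_diff[OF linear_components[OF c q(2)]] linear_scale[OF linear_components[OF c q(2)]]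
          E_def components_lift[OF c q(2)] q(3))
    then show ?thesis
      unfolding lie_bracket_in_chart[OF c q(2,1) UU(1) smE smE] q(3) fd inE[OF x]
      by (simp add: a_def q_def)
  qed
  \<comment> \<open>The Poincare lemma needs a convex domain, so the frame is restricted to a ball
    around the image of \<open>p\<close>.\<close>
  obtain r where r: "r > 0" "ball (snd c p) r \<subseteq> S"
    using S qS(1)[OF UU(3)] openE by blast
  define R where "R = ball (snd c p) r"
  have RS: "x \<in> R \<Longrightarrow> x \<in> S" for x using r(2) by (auto simp: R_def)
  interpret C: conformally_commuting_frame R k \<eta> e a
  proof unfold_locales
    show "open R" by (simp add: R_def)
    show "2 \<le> k" using k by simp
    show "smooth_on R (\<eta> i)" if "i \<le> k" for i using smooth_on_subset[OF sm\<eta>[OF that]] RS by auto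
    show "smooth_on R (e i)" for i
      using smooth_on_subset[OF smN, of R "B i"] RS by (auto simp: e_def [abs_def])
    show "smooth_on R (a i)" for i using smooth_on_subset[OF sma] RS by auto
    show "\<eta> i x \<bullet> e j x = (if i = j then 1 else 0)" if "x \<in> R" "i \<le> k" "j \<le> k" for x i j
      using \<eta> \<theta>e RS that by simp
    show "v = (\<Sum>i\<le>k. (\<eta> i x \<bullet> v) *\<^sub>R e i x)" if "x \<in> R" for x v
    proof -
      have x: "x \<in> S" by (rule RS[OF that])
      have "linear (N x)" by (rule inverse_family_linear[OF linM[OF x] NM[OF x] MN[OF x]])
      then have "N x (M x v) = (\<Sum>i\<le>k. \<theta> i x v *\<^sub>R e i x)"
        by (simp add: M_def e_def linear_sum linear_scale)
      then show ?thesis using NM[OF x] \<eta>[OF x] by simp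
    qed
    show "frechet_derivative (e j) (at x) (e i x) - frechet_derivative (e i) (at x) (e j x) =
      a i x *\<^sub>R e j x - a j x *\<^sub>R e i x" if "x \<in> R" "i \<le> k" "j \<le> k" for x i j
      by (rule bracket[OF RS[OF that(1)] that(2,3)])
  qed
  have R: "convex R" "snd c p \<in> R" using r(1) by (auto simp: R_def)
  show "\<exists>c \<omega> g \<alpha>. local_coordinates A c \<and> p \<in> fst c \<and> web_coframe A k F (fst c) \<omega> \<and>
        smooth_fun A (fst c) g \<and> (\<forall>q\<in>fst c. g q \<noteq> 0 \<and>
           (\<forall>i\<le>k. \<forall>v. g q * blinfun_apply (\<omega> i q) v = blinfun_apply (\<alpha> i) (components A c q v)))"
  proof (rule C.flat_coordinates[OF R B])
    fix g \<Phi> \<Psi> S' T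
    assume S': "open S'" "S' \<subseteq> R" "snd c p \<in> S'" and T: "open T"
      and hom: "homeomorphism S' T \<Phi> \<Psi>" and sm: "smooth_on S' \<Phi>" "smooth_on T \<Psi>"
      and g: "smooth_on R g" "\<And>x. x \<in> R \<Longrightarrow> g x > (0::real)"
      and der: "\<And>x v i. x \<in> S' \<Longrightarrow> i \<le> k \<Longrightarrow> frechet_derivative \<Phi> (at x) v \<bullet> B i = g x * (\<eta> i x \<bullet> v)"
    define c' where "c' = (chart_inv c ` S', \<Phi> \<circ> snd c)"
    have S'c: "S' \<subseteq> snd c ` fst c" using S'(2) RS by (auto simp: S_def)
    have q': "q \<in> U \<and> snd c q \<in> S'" if "q \<in> fst c'" for q
    proof -
      obtain x where x: "x \<in> S'" "q = chart_inv c x" using \<open>q \<in> fst c'\<close> by (auto simp: c'_def)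
      then show ?thesis using Sq[of x] RS S'(2) by auto
    qed
    have c': "local_coordinates A c'"
      unfolding c'_def by (rule local_coordinates_compose(1)[OF c S'(1) S'c T hom sm])
    have comp': "components A c' q v = frechet_derivative \<Phi> (at (snd c q)) (components A c q v)" if "q \<in> fst c'" for q v
      unfolding c'_def
      by (rule local_coordinates_compose(2)[OF c S'(1) S'c T hom sm]) (use that in \<open>simp add: c'_def\<close>)
    have sub: "fst c' \<subseteq> U" using q' by blast
    \<comment> \<open>The constant forms are the coordinate functionals of the basis
      \<open>B\<close>: composed with the derivative of \<open>\<Phi>\<close>, the i-th of them is
      \<open>g\<close> times the i-th form of the coframe in chart \<open>c\<close>.\<close>
    show ?thesis
    proof (rule exI[of _ c'], rule exI[of _ \<omega>], rule exI[of _ "g \<circ> snd c"], rule exI[of _ "\<lambda>i. blinfun_inner_left (B i)"],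
        intro conjI c' ballI allI impI)
      show "p \<in> fst c'" using S'(3) qS(2)[OF UU(3)] by (force simp: c'_def)
      show "web_coframe A k F (fst c') \<omega>" by (rule web_coframe_subset[OF cof sub])
      show "smooth_fun A (fst c') (g \<circ> snd c)"
      proof -
        have o': "open (fst c')" by (rule open_domain[OF c'])
        have im: "chart_image c (fst c') \<subseteq> S'" using q' by auto
        have "smooth_on (chart_image c (fst c')) ((g \<circ> snd c) \<circ> chart_inv c)"
        proof (rule smooth_on_eqI[OF open_chart_image[OF cc o']])
          show "smooth_on (chart_image c (fst c')) g" by (rule smooth_on_subset[OF g(1)]) (use im S'(2) in auto)
          show "((g \<circ> snd c) \<circ> chart_inv c) x = g x" if "x \<in> chart_image c (fst c')" for x
            using that im S'(2) RS Sq(3) by (simp add: subset_iff)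
        qed
        then show ?thesis using smooth_fun_iff[OF c o'] sub UU(2) by blast
      qed
      fix q assume q: "q \<in> fst c'"
      then have qq: "q \<in> U" "snd c q \<in> S'" "q \<in> fst c" using q' UU(2) by auto
      show "(g \<circ> snd c) q \<noteq> 0" using g(2)[of "snd c q"] qq S'(2) by auto
      show "(g \<circ> snd c) q * blinfun_apply (\<omega> i q) v = blinfun_apply (blinfun_inner_left (B i)) (components A c' q v)"
        if i: "i \<le> k" for i v
        using der[OF qq(2) i, of "components A c q v"] \<eta>[OF qS(1)[OF qq(1)], of i "components A c q v"]
        by (simp add: comp'[OF q] \<theta>_def qS(2)[OF qq(1)] lift_components[OF c qq(3)])
    qed
  qed
qed

end

theorem corollary11p3:
  fixes A :: "('m::{t2_space, second_countable_topology}, 'e::euclidean_space) chart set"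
    and k :: nat
    and F :: "real \<Rightarrow> 'm \<Rightarrow> 'e set"
  assumes "k > 2"
    and "DIM('e) = k + 1"
    and "smooth_manifold A"
    and "veronese_web A k F"
  shows "(\<not> flat_web A k F \<longrightarrow>
            (\<forall>D. affine_connection A D \<and> totally_geodesic A F D \<and> paraconformal A k F D \<longrightarrow>
                 \<not> torsion_free A D)) \<and>
         (\<forall>D. canonical_connection A k F D \<longrightarrow> (flat_web A k F \<longleftrightarrow> torsion_free A D))"
proof -
  \<comment> \<open>Its contrapositive is the first claim, and for a canonical connection it is one
    half of the second.\<close>
  have flat: "flat_web A k F"
    if "affine_connection A D" "totally_geodesic A F D" "paraconformal A k F D" "torsion_free A D" for D
    by (rule manifold_with_connection.flat_if_torsion_free[OF _ assms(1,2,4) that(2-4)])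
      (use assms(3) that(1) in \<open>unfold_locales\<close>)
  have tf: "torsion_free A D" if "canonical_connection A k F D" "flat_web A k F" for D
    by (rule manifold_with_connection.torsion_free_if_flat[OF _ assms(1,2) that(2,1)])
      (use assms(3) that(1) in \<open>unfold_locales, auto simp: canonical_connection_def\<close>)
  show ?thesis
  proof (intro conjI impI allI iffI)
    fix D
    assume "\<not> flat_web A k F" "affine_connection A D \<and> totally_geodesic A F D \<and> paraconformal A k F D"
    then show "\<not> torsion_free A D" using flat[of D] by blast
  next
    fix D
    assume "canonical_connection A k F D" "flat_web A k F"
    then show "torsion_free A D" by (rule tf)
  next
    fix D
    assume "canonical_connection A k F D" and free: "torsion_free A D"
    then have "affine_connection A D" "totally_geodesic A F D" "paraconformal A k F D"
      by (simp_all add: canonical_connection_def)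
    then show "flat_web A k F" using free by (rule flat)
  qed
qed

end
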